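(* Fix integers $\ell\ge 2$, $t\ge 4$ and $3\le r\le 2\ell-1$. If $t$ is odd, assume also that $r\le t-1$. There exists $n_0=n_0(\ell,t,r)$ such that the following holds for every $n\ge n_0$. If $G$ is an $n$-vertex $C_{2\ell+1}$-free graph and $$\mathcal N(P_t,G)\ge b^{\mathrm P}_{t,r}(n),$$ then either $G\in\mathcal G_{n,r}$ or $G\in\mathcal S_{t,r}(n)$.
   Context: Graphs are finite and simple, and membership in graph families is up to isomorphism. $P_t$ is the path with $t$ vertices and $C_t$ the cycle with $t$ vertices. $G$ is $F$-free if it contains no (not necessarily induced) subgraph isomorphic to $F$. $\mathcal N(F,G)$ is the number of unlabeled copies of $F$ in $G$, i.e. the number of subgraphs of $G$ isomorphic to $F$. $T_{m,2}$ is the complete bipartite graph with parts of sizes $\lfloor m/2\rfloor$ and $\lceil m/2\rceil$. Suspending a graph $H$ on a graph $B$ at a vertex $x\in V(B)$ means taking the disjoint union of $B$ and $H$, identifying $x$ with one vertex of $H$, and adding no further edges. For integers $n$ and $r\ge 2$, $\mathcal G_{n,r}$ is the family of all $n$-vertex graphs which can be obtained from a bipartite graph $B$ by suspending graphs $H_1,\dots,H_s$ on $B$ so that the sets $V(H_i)\setminus V(B)$ are pairwise disjoint and $\sum_{i=1}^s|V(H_i)\setminus V(B)|\le r-2$. $b^{\mathrm P}_{t,r}(n)=\max\{\mathcal N(P_t,H): H\in\mathcal G_{n,r+1}\setminus\mathcal G_{n,r}\}$. $\mathcal T^*(r,n)$ is the family of graphs obtained from $T_{n-r+1,2}$ by suspending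 a clique $K_r$ (at any vertex). $\mathcal S_{t,r}(n)$ is the subfamily of $\mathcal T^*(r,n)$ consisting of those graphs in $\mathcal T^*(r,n)$ with the maximum number of copies of $P_t$. *)

theory Defs
  imports Main
begin

record 'a graph =
  verts :: "'a set"
  edges :: "'a set set"

definition simple_graph :: "'a graph \<Rightarrow> bool" where
  "simple_graph G \<longleftrightarrow> finite (verts G) \<and> (\<forall>e\<in>edges G. e \<subseteq> verts G \<and> card e = 2)"

definition isomorphic :: "'a graph \<Rightarrow> 'b graph \<Rightarrow> bool" (infix "\<simeq>" 50) where
  "G \<simeq> H \<longleftrightarrow> simple_graph G \<and> simple_graph H \<and>
     (\<exists>f. bij_betw f (verts G) (verts H) \<and> edges H = (\<lambda>e. f ` e) ` edges G)"

definition subgraph :: "'a graph \<Rightarrow> 'a graph \<Rightarrow> bool" where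
  "subgraph S G \<longleftrightarrow> simple_graph S \<and> verts S \<subseteq> verts G \<and> edges S \<subseteq> edges G"

definition copies :: "'b graph \<Rightarrow> 'a graph \<Rightarrow> 'a graph set" where
  "copies F G = {S. subgraph S G \<and> S \<simeq> F}"

definition num_copies :: "'b graph \<Rightarrow> 'a graph \<Rightarrow> nat" where
  "num_copies F G = card (copies F G)"

definition free_of :: "'b graph \<Rightarrow> 'a graph \<Rightarrow> bool" where
  "free_of F G \<longleftrightarrow> \<not> (\<exists>S. subgraph S G \<and> S \<simeq> F)"

definition path_graph :: "nat \<Rightarrow> nat graph" where
  "path_graph t = \<lparr>verts = {..<t}, edges = {{i, i + 1} | i. i + 1 < t}\<rparr>"

definition cycle_graph :: "nat \<Rightarrow> nat graph" where
  "cycle_graph t = \<lparr>verts = {..<t}, edges = {{i, (i + 1) mod t} | i. i < t}\<rparr>"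

definition complete_graph :: "nat \<Rightarrow> nat graph" where
  "complete_graph r = \<lparr>verts = {..<r}, edges = {{i, j} | i j. i < r \<and> j < r \<and> i \<noteq> j}\<rparr>"

text \<open>The parts \<open>{..<m div 2}\<close> and \<open>{m div 2..<m}\<close> have sizes
  \<open>\<lfloor>m/2\<rfloor>\<close> and \<open>\<lceil>m/2\<rceil>\<close>.\<close>

definition turan2 :: "nat \<Rightarrow> nat graph" where
  "turan2 m = \<lparr>verts = {..<m},
     edges = {{i, j} | i j. i \<in> {..<m div 2} \<and> j \<in> {m div 2..<m}}\<rparr>"

definition bipartite :: "'a graph \<Rightarrow> bool" where
  "bipartite B \<longleftrightarrow> simple_graph B \<and>
     (\<exists>X Y. X \<union> Y = verts B \<and> X \<inter> Y = {} \<and>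
        edges B \<subseteq> {{x, y} | x y. x \<in> X \<and> y \<in> Y})"

text \<open>Suspension is modelled in place: the identification of a vertex of \<open>H\<close> with
  \<open>x\<close> is already carried out, so \<open>H\<close> and \<open>B\<close> share exactly the
  vertex \<open>x\<close>, and the suspended graph is their union. Up to isomorphism this is the disjoint
  union with two vertices identified.\<close>

definition suspendable :: "'a graph \<Rightarrow> 'a graph \<Rightarrow> 'a \<Rightarrow> bool" where
  "suspendable B H x \<longleftrightarrow> simple_graph B \<and> simple_graph H \<and> verts B \<inter> verts H = {x}"

definition suspend :: "'a graph \<Rightarrow> nat \<Rightarrow> (nat \<Rightarrow> 'a graph) \<Rightarrow> 'a graph" where
  "suspend B s H = \<lparr>verts = verts B \<union> (\<Union>i<s. verts (H i)),
                     edges = edges B \<union> (\<Union>i<s. edges (H i))\<rparr>"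

text \<open>Every finite graph is isomorphic to one with vertices in \<open>nat\<close>, so the families are
  isomorphism-closed sets of such graphs. The bound \<open>r - 2\<close> is written additively to avoid
  truncated subtraction; several \<open>H i\<close> may be suspended at the same vertex.\<close>

definition near_bip :: "nat \<Rightarrow> nat \<Rightarrow> nat graph set" where
  "near_bip n r = {G. card (verts G) = n \<and>
     (\<exists>(B :: nat graph) s H x.
        bipartite B \<and>
        (\<forall>i<s. suspendable B (H i) (x i)) \<and>
        (\<forall>i<s. \<forall>j<s. i \<noteq> j \<longrightarrow> (verts (H i) - verts B) \<inter> (verts (H j) - verts B) = {}) \<and>
        (\<Sum>i<s. card (verts (H i) - verts B)) + 2 \<le> r \<and>
        G \<simeq> suspend B s H)}"

text \<open>The set is finite, as its members are numbers of subgraphs of \<open>n\<close>-vertex graphs,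
  and it is nonempty for all large \<open>n\<close>.\<close>

definition bP :: "nat \<Rightarrow> nat \<Rightarrow> nat \<Rightarrow> nat" where
  "bP t r n = Max {num_copies (path_graph t) H | H. H \<in> near_bip n (r + 1) - near_bip n r}"

definition Tstar :: "nat \<Rightarrow> nat \<Rightarrow> nat graph set" where
  "Tstar r n = {G. \<exists>(K :: nat graph) x.
     K \<simeq> complete_graph r \<and>
     suspendable (turan2 (n + 1 - r)) K x \<and>
     G \<simeq> suspend (turan2 (n + 1 - r)) 1 (\<lambda>_. K)}"

definition Sfam :: "nat \<Rightarrow> nat \<Rightarrow> nat \<Rightarrow> nat graph set" where
  "Sfam t r n = {G \<in> Tstar r n.
     \<forall>H \<in> Tstar r n. num_copies (path_graph t) H \<le> num_copies (path_graph t) G}"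

end

theory Submission
  imports Defs Complex_Main
begin

text \<open>
  Path copies are counted through path lists, the injective sequences of \<open>t\<close> consecutively
  adjacent vertices. Every copy of \<open>P\<^sub>t\<close> is represented by the same number of lists, so comparing
  numbers of copies is the same as comparing numbers of lists.

  Every graph in \<open>\<T>\<^sup>*(r,n)\<close> lies in \<open>\<G>\<^bsub>n,r+1\<^esub>\<close> but not in
  \<open>\<G>\<^bsub>n,r\<^esub>\<close>, because a clique on \<open>r \<ge> 3\<close> vertices
  meets the removed vertices in at most \<open>r - 2\<close> points and therefore would have to live in the
  bipartite part. So \<open>b\<close> is at least the number of copies of \<open>P\<^sub>t\<close> in each of
  these graphs (\<open>Tstar_le_bP\<close>), and it is enough to show: a large \<open>C\<^bsub>2l+1\<^esub>\<close>-free graph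
  outside \<open>\<G>\<^bsub>n,r\<^esub>\<close> with at least as many path lists as the best graph of
  \<open>\<T>\<^sup>*(r,n)\<close> is itself in \<open>\<T>\<^sup>*(r,n)\<close>.

  \<^emph>\<open>Stability.\<close> In a \<open>C\<^bsub>2l+1\<^esub>\<close>-free graph no neighbourhood contains a path on \<open>2l\<close>
  vertices, so neighbourhoods span only linearly many edges. Hence at most about \<open>n\<^sup>2/4\<close> walks of two
  steps leave each vertex (\<open>two_step_bound\<close>), and extending lists two vertices at a time shows that
  having nearly \<open>2 (n/2)\<^sup>t\<close> path lists forces nearly \<open>n\<^sup>2/4\<close> edges
  (\<open>many_paths_imp_dense\<close>). The neighbourhood of a vertex of maximum degree and its complement are
  then an almost complete, almost balanced bipartition (\<open>missing_partition\<close>).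

  \<^emph>\<open>A connected core.\<close> Let \<open>M\<close> consist of the vertices whose degree is at
  least a small constant times \<open>n\<close>. Through the almost complete bipartition any two vertices of
  \<open>M\<close> are joined by paths of every short length of the right parity (\<open>core_linked\<close>), so
  \<open>M\<close> is bipartite. Each vertex outside \<open>M\<close> costs order
  \<open>n\<^bsup>t-1\<^esup>\<close> path lists, hence there are at most \<open>r - 1\<close> of them
  (\<open>few_low_vertices\<close>).

  \<^emph>\<open>Ears.\<close> A path through outside vertices that joins two vertices of the core and has the wrong
  parity would close up to a \<open>C\<^bsub>2l+1\<^esub>\<close>, because \<open>r \<le> 2l - 1\<close>. So all
  paths of this kind (ears) have the right parity and can be absorbed into the bipartite part, one after the
  other, and everything that is left hangs at
  single vertices (\<open>linked_decomposition\<close>). This puts the graph into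
  \<open>\<G>\<^bsub>n,r\<^esub>\<close> unless there are exactly \<open>r - 1\<close> outside vertices and no ear at all.

  \<^emph>\<open>The exact comparison.\<close> In the remaining case a path list leaves the core only at its ends. The
  lists with one outside vertex have order \<open>n\<^bsup>t-2\<^esup>\<close>, those ending in two outside vertices order
  \<open>n\<^bsup>t-3\<^esup>\<close>, and all others contribute \<open>O(n\<^bsup>t-4\<^esup>)\<close>. A missing
  edge of the core, an unbalanced core, or an outside vertex without neighbour in the core costs order
  \<open>n\<^bsup>t-2\<^esup>\<close>; a missing adjacency between outside vertices costs order
  \<open>n\<^bsup>t-3\<^esup>\<close> (\<open>final_comparison\<close>). So none of these occurs, and the graph is a
  balanced complete bipartite graph with a \<open>K\<^sub>r\<close> suspended on it.
\<close>

section \<open>Copies of a path and path lists\<close>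

definition adj :: "'a graph \<Rightarrow> 'a \<Rightarrow> 'a \<Rightarrow> bool" where
  "adj G u v \<longleftrightarrow> {u, v} \<in> edges G"

definition path_lists :: "('a \<Rightarrow> 'a \<Rightarrow> bool) \<Rightarrow> 'a set \<Rightarrow> nat \<Rightarrow> 'a list set" where
  "path_lists A S t = {xs. length xs = t \<and> distinct xs \<and> set xs \<subseteq> S \<and> successively A xs}"

definition list_graph :: "'a list \<Rightarrow> 'a graph" where
  "list_graph xs = \<lparr>verts = set xs, edges = {{xs ! i, xs ! (i + 1)} | i. i + 1 < length xs}\<rparr>"

text \<open>The automorphisms of \<open>P\<^sub>t\<close>, written as lists of images.\<close>

definition path_autos :: "nat \<Rightarrow> nat list set" where
  "path_autos t = {ps. length ps = t \<and> distinct ps \<and> list_graph ps = path_graph t}"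

definition graph_image :: "('a \<Rightarrow> 'b) \<Rightarrow> 'a graph \<Rightarrow> 'b graph" where
  "graph_image f G = \<lparr>verts = f ` verts G, edges = (\<lambda>e. f ` e) ` edges G\<rparr>"

lemma list_graph_map: "list_graph (map f xs) = graph_image f (list_graph xs)"
proof -
  have "{{map f xs ! i, map f xs ! (i + 1)} | i. i + 1 < length xs}
     = (\<lambda>e. f ` e) ` {{xs ! i, xs ! (i + 1)} | i. i + 1 < length xs}" (is "?L = ?R")
  proof
    show "?L \<subseteq> ?R"
    proof
      fix e assume "e \<in> ?L"
      then obtain i where i: "i + 1 < length xs" "e = {map f xs ! i, map f xs ! (i + 1)}" by blast
      then have "e = f ` {xs ! i, xs ! (i + 1)}" by simp
      then show "e \<in> ?R" using i by blast
    qed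
    show "?R \<subseteq> ?L"
    proof
      fix e assume "e \<in> ?R"
      then obtain i where i: "i + 1 < length xs" "e = f ` {xs ! i, xs ! (i + 1)}" by blast
      then have "e = {map f xs ! i, map f xs ! (i + 1)}" by simp
      then show "e \<in> ?L" using i by blast
    qed
  qed
  then show ?thesis by (simp add: list_graph_def graph_image_def)
qed

lemma list_graph_upt: "list_graph [0..<t] = path_graph t"
proof -
  have "[0..<t] ! i = i \<and> [0..<t] ! (i + 1) = i + 1" if "i + 1 < t" for i using that by simp
  then have "{{[0..<t] ! i, [0..<t] ! (i + 1)} | i. i + 1 < length [0..<t]} = {{i, i + 1} | i. i + 1 < t}"
    by (intro Collect_cong) (metis diff_zero length_upt)
  then show ?thesis by (simp add: list_graph_def path_graph_def atLeast0LessThan)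
qed

lemma simple_path_graph: "simple_graph (path_graph t)"
  by (auto simp: simple_graph_def path_graph_def)

lemma iso_image:
  assumes "simple_graph G" "inj_on f (verts G)"
  shows "G \<simeq> graph_image f G" "simple_graph (graph_image f G)"
proof -
  have "card (f ` e) = 2" if "e \<in> edges G" for e
    using that assms by (metis card_image inj_on_subset simple_graph_def)
  then show s: "simple_graph (graph_image f G)"
    using assms by (auto simp: simple_graph_def graph_image_def)
  show "G \<simeq> graph_image f G"
    unfolding isomorphic_def using assms s
    by (auto simp: graph_image_def bij_betw_def intro!: exI[of _ f])
qed

lemma iso_sym:
  assumes "G \<simeq> H" shows "H \<simeq> G"
proof -
  obtain f where f: "bij_betw f (verts G) (verts H)" "edges H = (\<lambda>e. f ` e) ` edges G"
    using assms unfolding isomorphic_def by (elim conjE exE)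
  have s: "simple_graph G" "simple_graph H" using assms by (simp_all add: isomorphic_def)
  let ?g = "the_inv_into (verts G) f"
  have g: "bij_betw ?g (verts H) (verts G)" using f bij_betw_the_inv_into by blast
  have "?g ` (f ` e) = e" if "e \<in> edges G" for e
  proof -
    have "e \<subseteq> verts G" using that s by (auto simp: simple_graph_def)
    then have "?g (f x) = x" if "x \<in> e" for x
      using that f(1) by (meson bij_betw_def subsetD the_inv_into_f_f)
    then show ?thesis by (simp add: image_image)
  qed
  then have "edges G = (\<lambda>e. ?g ` e) ` edges H" unfolding f(2) image_image by simp
  then show ?thesis unfolding isomorphic_def using s g by (intro conjI exI[of _ ?g])
qed

lemma iso_trans:
  assumes "G \<simeq> H" "H \<simeq> K" shows "G \<simeq> K"
proof -
  obtain f where f: "bij_betw f (verts G) (verts H)" "edges H = (\<lambda>e. f ` e) ` edges G"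
    using assms(1) unfolding isomorphic_def by (elim conjE exE) 
  obtain g where g: "bij_betw g (verts H) (verts K)" "edges K = (\<lambda>e. g ` e) ` edges H"
    using assms(2) unfolding isomorphic_def by (elim conjE exE)
  have "bij_betw (g \<circ> f) (verts G) (verts K)" by (rule bij_betw_trans[OF f(1) g(1)])
  moreover have "edges K = (\<lambda>e. (g \<circ> f) ` e) ` edges G"
    unfolding f(2) g(2) image_image comp_def ..
  moreover have "simple_graph G" "simple_graph K" using assms by (simp_all add: isomorphic_def)
  ultimately show ?thesis unfolding isomorphic_def by (intro conjI exI[of _ "g \<circ> f"])
qed

lemma iso_as_image:
  assumes "G \<simeq> H"
  obtains f where "inj_on f (verts G)" "H = graph_image f G"
proof -
  obtain f where f: "bij_betw f (verts G) (verts H)" "edges H = (\<lambda>e. f ` e) ` edges G"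
    using assms unfolding isomorphic_def by (elim conjE exE)
  have "H = graph_image f G"
    unfolding graph_image_def f(2)[symmetric] bij_betw_imp_surj_on[OF f(1)] by simp
  then show ?thesis using that[of f] bij_betw_imp_inj_on[OF f(1)] by blast
qed

lemma simple_list_graph:
  assumes "distinct xs" shows "simple_graph (list_graph xs)"
proof -
  have "card {xs ! i, xs ! (i + 1)} = 2" if "i + 1 < length xs" for i
    using assms that by (simp add: nth_eq_iff_index_eq)
  then show ?thesis unfolding simple_graph_def list_graph_def by fastforce
qed

lemma list_graph_iso_path:
  assumes "distinct xs" "length xs = t" shows "list_graph xs \<simeq> path_graph t"
proof -
  have e: "xs = map (nth xs) [0..<t]" using assms(2) map_nth by metis
  have "inj_on (nth xs) (verts (path_graph t))"
    using assms by (auto simp: path_graph_def inj_on_def nth_eq_iff_index_eq)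
  then have "path_graph t \<simeq> graph_image (nth xs) (path_graph t)" by (rule iso_image(1)[OF simple_path_graph])
  also have "graph_image (nth xs) (path_graph t) = list_graph xs"
    using list_graph_map[of "nth xs" "[0..<t]"] e list_graph_upt by metis
  finally show ?thesis by (rule iso_sym)
qed

lemma finite_lists: "finite S \<Longrightarrow> finite {xs. length xs = t \<and> distinct xs \<and> set xs \<subseteq> S}"
  by (rule finite_subset[OF _ finite_lists_length_eq[of S t]]) auto

lemma finite_path_lists: "finite S \<Longrightarrow> finite (path_lists A S t)"
  by (rule finite_subset[OF _ finite_lists[of S t]]) (auto simp: path_lists_def)

lemma path_autos_pos: "finite (path_autos t)" "card (path_autos t) > 0"
proof -
  have "path_autos t \<subseteq> {xs. length xs = t \<and> distinct xs \<and> set xs \<subseteq> {..<t}}"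
    by (auto simp: path_autos_def list_graph_def path_graph_def)
  then show f: "finite (path_autos t)" using finite_lists finite_subset by (metis finite_lessThan)
  have "[0..<t] \<in> path_autos t" by (simp add: path_autos_def list_graph_upt)
  then show "card (path_autos t) > 0" using f card_gt_0_iff by blast
qed

lemma subgraph_list_graph_iff:
  assumes "simple_graph G" "distinct xs" "length xs = t"
  shows "subgraph (list_graph xs) G \<longleftrightarrow> xs \<in> path_lists (adj G) (verts G) t"
  using assms simple_list_graph[OF assms(2)]
  by (auto simp: subgraph_def path_lists_def list_graph_def adj_def successively_conv_nth)

text \<open>The lists representing one fixed copy are obtained from each other by the
  automorphisms of \<open>P\<^sub>t\<close>, so all copies have equally many representatives.\<close>

lemma card_path_lists:
  assumes "simple_graph G"
  shows "card (path_lists (adj G) (verts G) t) = card (path_autos t) * num_copies (path_graph t) G"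
proof -
  let ?C = "copies (path_graph t) G"
  let ?P = "path_lists (adj G) (verts G) t"
  have fP: "finite ?P" using assms finite_path_lists by (auto simp: simple_graph_def)
  have fib: "card {xs \<in> ?P. list_graph xs = S} = card (path_autos t)" and ne: "\<exists>xs\<in>?P. list_graph xs = S"
    if S: "S \<in> ?C" for S
  proof -
    from S have S1: "subgraph S G" "path_graph t \<simeq> S" by (auto simp: copies_def intro: iso_sym)
    obtain g where g: "inj_on g {..<t}" "S = graph_image g (path_graph t)"
      using iso_as_image[OF S1(2)] by (auto simp: path_graph_def)
    have inj: "inj_on (map g) (path_autos t)"
      using g(1) by (auto simp: inj_on_def path_autos_def list_graph_def path_graph_def intro!: map_inj_on[of g])
    have im: "{xs \<in> ?P. list_graph xs = S} = map g ` path_autos t"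
    proof
      show "map g ` path_autos t \<subseteq> {xs \<in> ?P. list_graph xs = S}"
      proof
        fix xs assume "xs \<in> map g ` path_autos t"
        then obtain ps where ps: "length ps = t" "distinct ps" "list_graph ps = path_graph t" "xs = map g ps"
          by (auto simp: path_autos_def)
        have "set ps = {..<t}" using ps(3) by (simp add: list_graph_def path_graph_def)
        then have d: "distinct xs" "length xs = t" using ps g by (auto simp: distinct_map)
        have e: "list_graph xs = S" using ps g list_graph_map by metis
        then show "xs \<in> {xs \<in> ?P. list_graph xs = S}" using subgraph_list_graph_iff[OF assms d] S1 by simp
      qed
      show "{xs \<in> ?P. list_graph xs = S} \<subseteq> map g ` path_autos t"
      proof
        fix xs assume "xs \<in> {xs \<in> ?P. list_graph xs = S}"
        then have xs: "length xs = t" "distinct xs" "list_graph xs = S" by (auto simp: path_lists_def)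
        have sx: "set xs = g ` {..<t}" using xs(3) g by (simp add: list_graph_def graph_image_def path_graph_def)
        define h where "h = the_inv_into {..<t} g"
        have h1: "g (h y) = y" if "y \<in> g ` {..<t}" for y
          using that g(1) by (simp add: h_def f_the_inv_into_f)
        have h2: "h (g i) = i" if "i \<in> {..<t}" for i
          using that g(1) by (simp add: h_def the_inv_into_f_f)
        have m: "map g (map h xs) = xs" 
          unfolding map_map using h1 sx by (intro map_idI) simp
        have "list_graph (map h xs) = graph_image h S" using list_graph_map xs(3) by metis
        also have "\<dots> = graph_image (h \<circ> g) (path_graph t)"
          using g(2) by (simp add: graph_image_def image_image comp_def)
        also have "\<dots> = path_graph t"
        proof -
          have v: "(h \<circ> g) ` verts (path_graph t) = verts (path_graph t)"
            using h2 by (force simp: path_graph_def)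
          have "(h \<circ> g) ` e = e" if "e \<in> edges (path_graph t)" for e
          proof -
            have "e \<subseteq> {..<t}" using that by (auto simp: path_graph_def)
            then show ?thesis using h2 by force
          qed
          then have "(\<lambda>e. (h \<circ> g) ` e) ` edges (path_graph t) = edges (path_graph t)" by force
          then show ?thesis using v by (simp add: graph_image_def)
        qed
        finally have "list_graph (map h xs) = path_graph t" .
        moreover have "distinct (map h xs)" using xs(2) m by (metis distinct_map)
        ultimately have "map h xs \<in> path_autos t" using xs(1) by (simp add: path_autos_def)
        then show "xs \<in> map g ` path_autos t" using m by (metis image_eqI)
      qed
    qed
    show "card {xs \<in> ?P. list_graph xs = S} = card (path_autos t)" unfolding im by (rule card_image[OF inj])
    then have "card {xs \<in> ?P. list_graph xs = S} > 0" using path_autos_pos by simp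
    then show "\<exists>xs\<in>?P. list_graph xs = S" by (metis (mono_tags, lifting) card_gt_0_iff empty_Collect_eq)
  qed
  have imC: "?C = list_graph ` ?P"
  proof
    show "?C \<subseteq> list_graph ` ?P" using ne by blast
    show "list_graph ` ?P \<subseteq> ?C"
      by (auto simp: copies_def path_lists_def subgraph_list_graph_iff[OF assms] intro!: list_graph_iso_path)
  qed
  have "card ?P = (\<Sum>S\<in>?C. card {xs \<in> ?P. list_graph xs = S})"
    by (rule sum.group[symmetric, where g = list_graph and h = "\<lambda>_. 1::nat" and S = ?P, simplified])
      (use fP imC in auto)
  also have "\<dots> = (\<Sum>S\<in>?C. card (path_autos t))" using fib by simp
  also have "\<dots> = card (path_autos t) * num_copies (path_graph t) G" by (simp add: num_copies_def)
  finally show ?thesis .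
qed

lemma num_copies_le_iff:
  assumes "simple_graph G" "simple_graph H"
  shows "num_copies (path_graph t) G \<le> num_copies (path_graph t) H \<longleftrightarrow>
    card (path_lists (adj G) (verts G) t) \<le> card (path_lists (adj H) (verts H) t)"
  using card_path_lists[OF assms(1), of t] card_path_lists[OF assms(2), of t] path_autos_pos(2)[of t] by simp

lemma no_closed_list:
  assumes G: "simple_graph G" and free: "free_of (cycle_graph k) G" and k: "k \<ge> 3"
    and xs: "length xs = k" "distinct xs" "set xs \<subseteq> verts G" "successively (adj G) xs"
  shows "\<not> adj G (last xs) (hd xs)"
proof
  assume cl: "adj G (last xs) (hd xs)"
  have s: "simple_graph (cycle_graph k)"
  proof -
    have "card {i, (i + 1) mod k} = 2" if "i < k" for i
    proof -
      have "i \<noteq> (i + 1) mod k"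
      proof (cases "i + 1 = k")
        case True then show ?thesis using k by simp
      next
        case False then show ?thesis using that by simp
      qed
      then show ?thesis by simp
    qed
    moreover have "{i, (i + 1) mod k} \<subseteq> {..<k}" if "i < k" for i using that k by auto
    ultimately show ?thesis unfolding simple_graph_def cycle_graph_def by force
  qed
  have inj: "inj_on (nth xs) (verts (cycle_graph k))"
    using xs by (auto simp: cycle_graph_def inj_on_def nth_eq_iff_index_eq)
  let ?S = "graph_image (nth xs) (cycle_graph k)"
  have iso: "?S \<simeq> cycle_graph k" and sS: "simple_graph ?S"
    using iso_image[OF s inj] iso_sym by auto
  have e: "{xs ! i, xs ! ((i + 1) mod k)} \<in> edges G" if "i < k" for i
  proof (cases "i + 1 = k")
    case True
    have "xs \<noteq> []" using xs k by auto
    then have "last xs = xs ! i" "hd xs = xs ! 0"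
      using True xs(1) by (auto simp: last_conv_nth hd_conv_nth)
    then show ?thesis using cl True by (simp add: adj_def)
  next
    case False
    then show ?thesis using xs that by (auto simp: successively_conv_nth adj_def)
  qed
  have "subgraph ?S G"
    unfolding subgraph_def using sS xs e by (auto simp: graph_image_def cycle_graph_def)
  then show False using free iso by (auto simp: free_of_def)
qed

section \<open>Absorbing ears\<close>

text \<open>A finite simple graph given by its adjacency predicate rather than by a set of edges,
  so that paths are lists satisfying \<open>successively A\<close>.\<close>

locale fin_graph =
  fixes V :: "'a set" and A :: "'a \<Rightarrow> 'a \<Rightarrow> bool"
  assumes fin: "finite V"
    and sym: "A u v \<Longrightarrow> A v u"
    and irrefl: "\<not> A u u"
    and dom: "A u v \<Longrightarrow> u \<in> V"
begin

lemma dom': "A u v \<Longrightarrow> v \<in> V"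
  using sym dom by blast

lemma flip: "(\<lambda>x y. A y x) = A"
  using sym by (intro ext) blast

lemma successively_flip: "successively (\<lambda>x y. A y x) xs \<longleftrightarrow> successively A xs"
  unfolding flip ..

lemma successively_rev': "successively A (rev xs) \<longleftrightarrow> successively A xs"
  by (simp add: successively_flip)

definition path_between :: "'a set \<Rightarrow> 'a \<Rightarrow> 'a \<Rightarrow> nat \<Rightarrow> bool" where
  "path_between B u v m \<longleftrightarrow>
     (\<exists>xs. xs \<noteq> [] \<and> length xs = m \<and> distinct xs \<and> set xs \<subseteq> B \<and> successively A xs \<and> hd xs = u \<and> last xs = v)"

lemma path_between_sym:
  assumes "path_between B u v m" shows "path_between B v u m"
proof -
  obtain xs where xs: "xs \<noteq> []" "length xs = m" "distinct xs" "set xs \<subseteq> B" "successively A xs" "hd xs = u" "last xs = v"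
    using assms unfolding path_between_def by blast
  then show ?thesis unfolding path_between_def
    by (intro exI[of _ "rev xs"]) (simp add: successively_flip hd_rev last_rev)
qed

lemma path_between_mono: "path_between B u v m \<Longrightarrow> B \<subseteq> C \<Longrightarrow> path_between C u v m"
  unfolding path_between_def by blast

text \<open>The lower bound \<open>\<mu>\<close> on the number of vertices matters: it grows when ears are added,
  and the room between \<open>\<mu>\<close> and \<open>N\<close> is what limits the ears that can be absorbed. Proper
  colouring is not demanded, since it follows from \<open>cycle_free\<close>.\<close>

definition linked :: "nat \<Rightarrow> 'a set \<Rightarrow> nat \<Rightarrow> ('a \<Rightarrow> bool) \<Rightarrow> bool" where
  "linked N B \<mu> c \<longleftrightarrow> (\<forall>u\<in>B. \<forall>v\<in>B. \<forall>m. u \<noteq> v \<longrightarrow> \<mu> \<le> m \<longrightarrow> m \<le> N \<longrightarrow> (odd m \<longleftrightarrow> c u = c v)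
     \<longrightarrow> path_between B u v m)"

lemma linkedD:
  assumes "linked N B \<mu> c" "u \<in> B" "v \<in> B" "u \<noteq> v" "\<mu> \<le> m" "m \<le> N" "odd m \<longleftrightarrow> c u = c v"
  shows "path_between B u v m"
  using assms unfolding linked_def by blast

text \<open>No cycle on \<open>N\<close> vertices; for \<open>N \<ge> 3\<close> this is \<open>C\<^sub>N\<close>-freeness.\<close>

definition cycle_free :: "nat \<Rightarrow> bool" where
  "cycle_free N \<longleftrightarrow> (\<forall>xs. length xs = N \<longrightarrow> distinct xs \<longrightarrow> set xs \<subseteq> V \<longrightarrow> successively A xs \<longrightarrow>
     \<not> A (last xs) (hd xs))"

definition ear :: "'a set \<Rightarrow> 'a \<Rightarrow> 'a list \<Rightarrow> 'a \<Rightarrow> bool" where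
  "ear B a ws b \<longleftrightarrow> a \<in> B \<and> b \<in> B \<and> a \<noteq> b \<and> ws \<noteq> [] \<and> distinct ws \<and> set ws \<subseteq> V - B \<and>
     successively A ws \<and> A a (hd ws) \<and> A (last ws) b"

text \<open>An edge with equally coloured ends closes an odd path on \<open>N\<close> vertices to a cycle.\<close>

lemma linked_proper:
  assumes "linked N B \<mu> c" "odd N" "\<mu> \<le> N" "cycle_free N" "B \<subseteq> V" "u \<in> B" "v \<in> B" "A u v"
  shows "c u \<noteq> c v"
proof
  assume "c u = c v"
  moreover have "u \<noteq> v" using assms irrefl by blast
  ultimately have "path_between B v u N"
    using assms(1)[unfolded linked_def, rule_format, OF assms(7,6), of N] assms(2,3) by simp
  then show False using assms unfolding path_between_def cycle_free_def by blast
qed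

text \<open>An ear of the wrong parity is completed to a cycle on exactly \<open>N\<close> vertices by a path
  of \<open>B\<close> with \<open>N - length ws\<close> vertices; the hypothesis on the length ensures that \<open>B\<close> has
  such a path.\<close>

lemma ear_parity:
  assumes "linked N B \<mu> c" "odd N" "cycle_free N" "B \<subseteq> V" "ear B a ws b" "length ws + \<mu> \<le> N"
  shows "odd (length ws) \<longleftrightarrow> c a = c b"
proof (rule ccontr)
  assume n: "\<not> ?thesis"
  define m where "m = N - length ws"
  have m: "\<mu> \<le> m" "m \<le> N" "m + length ws = N" using assms by (auto simp: m_def)
  then have "odd m \<longleftrightarrow> c b = c a" using n \<open>odd N\<close> by (metis even_add)
  then have "path_between B b a m"
    using linkedD[OF assms(1), of b a m] m assms(5) unfolding ear_def by auto
  then obtain xs where xs: "xs \<noteq> []" "length xs = m" "distinct xs" "set xs \<subseteq> B" "successively A xs" "hd xs = b" "last xs = a"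
    unfolding path_between_def by blast
  have e: "ws \<noteq> []" "distinct ws" "set ws \<subseteq> V - B" "successively A ws" "A a (hd ws)" "A (last ws) b"
    using assms unfolding ear_def by auto
  have "length (xs @ ws) = N" "distinct (xs @ ws)" "set (xs @ ws) \<subseteq> V" "successively A (xs @ ws)"
    using xs e m assms(4) by (auto simp: successively_append_iff)
  moreover have "A (last (xs @ ws)) (hd (xs @ ws))" using xs e by simp
  ultimately show False using assms(3) unfolding cycle_free_def by blast
qed

text \<open>Two vertices of the enlarged set are connected by leaving the ear through its ends and
  continuing in \<open>B\<close>. The ends can be chosen so that the two ends used in \<open>B\<close> are distinct,
  and at most \<open>length ws\<close> vertices of the ear are used, which explains the new lower bound.
  The colours alternate along the ear.\<close>

lemma ear_extend:
  assumes L: "linked N B \<mu> c" and e: "ear B a ws b" and par: "odd (length ws) \<longleftrightarrow> c a = c b"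
  shows "\<exists>c'. linked N (B \<union> set ws) (\<mu> + length ws) c'"
proof -
  have e': "ws \<noteq> []" "distinct ws" "set ws \<inter> B = {}" "successively A ws" "A a (hd ws)" "A (last ws) b"
     "a \<in> B" "b \<in> B" "a \<noteq> b" using e unfolding ear_def by auto
  define k where "k = length ws"
  \<comment> \<open>the vertex with index \<open>i\<close> is reached from \<open>a\<close> after \<open>i + 1\<close> steps\<close>
  define c' where "c' = (\<lambda>x. if x \<in> set ws then odd (THE i. i < k \<and> ws ! i = x) = c a else c x)"
  have cw: "c' (ws ! i) \<longleftrightarrow> (odd i = c a)" if "i < k" for i
  proof -
    have "(THE j. j < k \<and> ws ! j = ws ! i) = i"
      using that e'(2) by (auto simp: k_def nth_eq_iff_index_eq)
    then show ?thesis using that by (simp add: c'_def k_def)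
  qed
  have cB: "c' x = c x" if "x \<in> B" for x using that e' by (auto simp: c'_def)
  have up: "path_between (B \<union> set ws) u v m" if "path_between B u v m" for u v m
    using that path_between_mono by blast
  \<comment> \<open>The two ways out of the ear.\<close>
  define lft where "lft = (\<lambda>i. rev (take (Suc i) ws))"
  define rgt where "rgt = (\<lambda>i. drop i ws)"
  have lft: "lft i \<noteq> []" "length (lft i) = Suc i" "distinct (lft i)" "set (lft i) \<subseteq> set ws"
    "successively A (lft i)" "hd (lft i) = ws ! i" "A (last (lft i)) a" if "i < k" for i
  proof -
    show "lft i \<noteq> []" "length (lft i) = Suc i" "distinct (lft i)" "set (lft i) \<subseteq> set ws"
      using that e' by (auto simp: lft_def k_def dest: in_set_takeD)
    show "successively A (lft i)"
      unfolding lft_def successively_rev' using e'(4)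
      by (metis append_take_drop_id successively_append_iff)
    show "hd (lft i) = ws ! i" using that by (simp add: lft_def k_def hd_rev take_Suc_conv_app_nth)
    have "last (lft i) = hd ws" using that e' by (simp add: lft_def k_def last_rev hd_conv_nth)
    then show "A (last (lft i)) a" using e' sym by simp
  qed
  have rgt: "rgt i \<noteq> []" "length (rgt i) = k - i" "distinct (rgt i)" "set (rgt i) \<subseteq> set ws"
    "successively A (rgt i)" "hd (rgt i) = ws ! i" "A (last (rgt i)) b" if "i < k" for i
  proof -
    show "rgt i \<noteq> []" "length (rgt i) = k - i" "distinct (rgt i)" "set (rgt i) \<subseteq> set ws"
      using that e' by (auto simp: rgt_def k_def dest: in_set_dropD)
    show "successively A (rgt i)"
      unfolding rgt_def using e'(4) by (metis append_take_drop_id successively_append_iff)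
    show "hd (rgt i) = ws ! i" using that by (simp add: rgt_def k_def hd_drop_conv_nth)
    show "A (last (rgt i)) b" using that e' by (simp add: rgt_def k_def)
  qed
  have join: "path_between (B \<union> set ws) (hd ys) v (length ys + m)"
    if ys: "ys \<noteq> []" "distinct ys" "set ys \<subseteq> set ws" "successively A ys" "A (last ys) x" "path_between B x v m" for ys x v m
  proof -
    obtain xs where xs: "xs \<noteq> []" "length xs = m" "distinct xs" "set xs \<subseteq> B" "successively A xs" "hd xs = x" "last xs = v"
      using ys(6) unfolding path_between_def by blast
    show ?thesis unfolding path_between_def
      by (rule exI[of _ "ys @ xs"]) (use xs ys e' in \<open>auto simp: successively_append_iff\<close>)
  qed
  have one: "path_between (B \<union> set ws) (ws ! i) v m"
    if i: "i < k" and v: "v \<in> B" and m: "\<mu> + k \<le> m" "m \<le> N" and p: "odd m \<longleftrightarrow> c' (ws ! i) = c' v" for i v m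
  proof (cases "v = a")
    case False
    define m' where "m' = m - Suc i"
    have m': "m = Suc i + m'" "\<mu> \<le> m'" "m' \<le> N" using m i by (auto simp: m'_def)
    have "odd m' \<longleftrightarrow> c a = c v"
      using p cw[OF i] cB[OF v] unfolding m'(1) by auto
    then have "path_between B a v m'" using linkedD[OF L, of a v m'] m' v False e'(7) by simp
    from join[OF lft(1)[OF i] lft(3)[OF i] lft(4)[OF i] lft(5)[OF i] lft(7)[OF i] this]
    show ?thesis using lft(2,6)[OF i] m'(1) by simp
  next
    case True
    \<comment> \<open>\<open>a\<close> itself is the target, so leave through \<open>b\<close>\<close>
    define m' where "m' = m - (k - i)"
    have m': "m = (k - i) + m'" "\<mu> \<le> m'" "m' \<le> N" using m i by (auto simp: m'_def)
    have "m + i = k + m'" using m'(1) i by simp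
    then have "odd m' \<longleftrightarrow> (odd m \<noteq> (odd i \<noteq> odd k))" by presburger
    then have "odd m' \<longleftrightarrow> c b = c v"
      using p cw[OF i] cB[OF v] par True unfolding k_def by auto
    then have "path_between B b v m'" using linkedD[OF L, of b v m'] m' v True e'(8,9) by simp
    from join[OF rgt(1)[OF i] rgt(3)[OF i] rgt(4)[OF i] rgt(5)[OF i] rgt(7)[OF i] this]
    show ?thesis using rgt(2,6)[OF i] m'(1) by simp
  qed
  have two: "path_between (B \<union> set ws) (ws ! i) (ws ! j) m"
    if i: "i < j" and j: "j < k" and m: "\<mu> + k \<le> m" "m \<le> N" and p: "odd m \<longleftrightarrow> c' (ws ! i) = c' (ws ! j)" for i j m
  proof -
    define m' where "m' = m - (Suc i + (k - j))"
    have h: "Suc i + (k - j) \<le> k" using i j by linarith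
    have m': "m = Suc i + m' + (k - j)" "\<mu> \<le> m'" "m' \<le> N"
      unfolding m'_def using m h by linarith+
    have ik: "i < k" using i j by simp
    have "m + j = Suc i + k + m'" using m'(1) j by simp
    then have "odd m' \<longleftrightarrow> (odd m \<noteq> ((odd i \<noteq> odd j) = odd k))" by presburger
    then have "odd m' \<longleftrightarrow> c a = c b"
      using p cw[OF ik] cw[OF j] par unfolding k_def by auto
    then have "path_between B a b m'" using linkedD[OF L, of a b m'] m' e'(7-9) by simp
    then obtain xs where xs: "xs \<noteq> []" "length xs = m'" "distinct xs" "set xs \<subseteq> B" "successively A xs" "hd xs = a" "last xs = b"
      unfolding path_between_def by blast
    have dd: "set (lft i) \<inter> set (rgt j) = {}"
      using e'(2) i by (simp add: lft_def rgt_def set_take_disj_set_drop_if_distinct)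
    let ?p = "lft i @ xs @ rev (rgt j)"
    have nn: "lft i \<noteq> []" "rgt j \<noteq> []" using lft(1)[OF ik] rgt(1)[OF j] .
    have "?p \<noteq> []" "length ?p = m" "hd ?p = ws ! i" "last ?p = ws ! j"
      using xs(2) lft(2,6)[OF ik] rgt(2,6)[OF j] nn m'(1) by (simp_all add: last_rev)
    moreover have "set ?p \<subseteq> B \<union> set ws" using xs(4) lft(4)[OF ik] rgt(4)[OF j] by auto
    moreover have "distinct ?p"
    proof -
      have "set xs \<inter> set (rgt j) = {}" "set (lft i) \<inter> (set xs \<union> set (rgt j)) = {}"
        using xs(4) lft(4)[OF ik] rgt(4)[OF j] dd e'(3) by blast+
      then show ?thesis using xs(3) lft(3)[OF ik] rgt(3)[OF j] by simp
    qed
    moreover have "successively A ?p"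
      using xs(1,5,6,7) lft(5,7)[OF ik] rgt(5)[OF j] sym[OF rgt(7)[OF j]] nn
      by (simp add: successively_append_iff successively_flip hd_rev)
    ultimately show ?thesis unfolding path_between_def by (intro exI[of _ ?p] conjI)
  qed
  have "path_between (B \<union> set ws) u v m"
    if u: "u \<in> B \<union> set ws" and v: "v \<in> B \<union> set ws" and ne: "u \<noteq> v" and m: "\<mu> + k \<le> m" "m \<le> N"
      and p: "odd m \<longleftrightarrow> c' u = c' v" for u v m
  proof -
    consider "u \<in> B" "v \<in> B" | "u \<in> set ws" "v \<in> B" | "u \<in> B" "v \<in> set ws" | "u \<in> set ws" "v \<in> set ws"
      using u v by blast
    then show ?thesis
    proof cases
      case 1
      then have "path_between B u v m" using linkedD[OF L, of u v m] ne m p cB by simp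
      then show ?thesis by (rule up)
    next
      case 2
      then obtain i where "i < k" "u = ws ! i" by (auto simp: in_set_conv_nth k_def)
      then show ?thesis using one 2 m p by blast
    next
      case 3
      then obtain i where "i < k" "v = ws ! i" by (auto simp: in_set_conv_nth k_def)
      then show ?thesis using one[of i u m] 3 m p path_between_sym by (auto simp: eq_commute)
    next
      case 4
      then obtain i j where ij: "i < k" "u = ws ! i" "j < k" "v = ws ! j" by (auto simp: in_set_conv_nth k_def)
      then consider "i < j" | "j < i" using ne by (metis linorder_less_linear)
      then show ?thesis
      proof cases
        case 1 then show ?thesis using two ij m p by blast
      next
        case 2 then show ?thesis using two[of j i m] ij m p path_between_sym by (auto simp: eq_commute)
      qed
    qed
  qed
  then have "linked N (B \<union> set ws) (\<mu> + length ws) c'" unfolding linked_def k_def by blast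
  then show ?thesis by blast
qed

text \<open>Every outside vertex is assigned the only vertex of \<open>B\<close> at which its component may be
  attached. Components without any neighbour in \<open>B\<close> are assigned an arbitrary vertex.\<close>

definition hung :: "'a set \<Rightarrow> ('a \<Rightarrow> 'a) \<Rightarrow> bool" where
  "hung B att \<longleftrightarrow> att ` (V - B) \<subseteq> B \<and> (\<forall>x\<in>V - B. \<forall>y\<in>V - B. A x y \<longrightarrow> att x = att y) \<and>
     (\<forall>x\<in>V - B. \<forall>b\<in>B. A x b \<longrightarrow> att x = b)"

lemma simple_path_of_rtrancl:
  assumes "(x, y) \<in> {(x, y). x \<in> U \<and> y \<in> U \<and> A x y}\<^sup>*" "y \<in> U"
  shows "\<exists>ws. ws \<noteq> [] \<and> distinct ws \<and> set ws \<subseteq> U \<and> successively A ws \<and> hd ws = x \<and> last ws = y"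
  using assms(1)
proof (induction rule: converse_rtrancl_induct)
  case base
  show ?case using assms(2) by (intro exI[of _ "[y]"]) auto
next
  case (step x z)
  then obtain ws where ws: "ws \<noteq> []" "distinct ws" "set ws \<subseteq> U" "successively A ws" "hd ws = z" "last ws = y"
    by blast
  show ?case
  proof (cases "x \<in> set ws")
    case False
    then show ?thesis using ws step(1)
      by (intro exI[of _ "x # ws"]) (auto simp: successively_Cons)
  next
    case True
    then obtain ps qs where pq: "ws = ps @ x # qs" by (meson split_list)
    show ?thesis using ws unfolding pq
      by (intro exI[of _ "x # qs"]) (auto simp: successively_append_iff)
  qed
qed

text \<open>If two vertices of \<open>B\<close> could be reached from the same outside vertex, a path of
  outside vertices between them would be an ear.\<close>

lemma hung_if_no_ear:
  assumes "B \<subseteq> V" "B \<noteq> {}" and ne: "\<And>a ws b. \<not> ear B a ws b"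
  shows "\<exists>att. hung B att"
proof -
  define R where "R = {(x, y). x \<in> V - B \<and> y \<in> V - B \<and> A x y}"
  define reach where "reach = (\<lambda>x b. b \<in> B \<and> (\<exists>y\<in>V - B. (x, y) \<in> R\<^sup>* \<and> A y b))"
  obtain b0 where b0: "b0 \<in> B" using assms by blast
  have "sym R" unfolding R_def sym_def using local.sym by blast
  then have sR: "(y, x) \<in> R\<^sup>*" if "(x, y) \<in> R\<^sup>*" for x y using that by (meson symD sym_rtrancl)
  have uniq: "b1 = b2" if r: "reach x b1" "reach x b2" for x b1 b2
  proof (rule ccontr)
    assume d: "b1 \<noteq> b2"
    obtain y1 y2 where y: "y1 \<in> V - B" "(x, y1) \<in> R\<^sup>*" "A y1 b1" "y2 \<in> V - B" "(x, y2) \<in> R\<^sup>*" "A y2 b2"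
      using r unfolding reach_def by blast
    have "(y1, y2) \<in> R\<^sup>*" using sR[OF y(2)] y(5) by (rule rtrancl_trans)
    then obtain ws where ws: "ws \<noteq> []" "distinct ws" "set ws \<subseteq> V - B" "successively A ws" "hd ws = y1" "last ws = y2"
      using simple_path_of_rtrancl[of y1 y2 "V - B"] y(4) unfolding R_def by blast
    have "ear B b1 ws b2" unfolding ear_def
      using ws y d r sym by (auto simp: reach_def)
    then show False using ne by blast
  qed
  define att where "att = (\<lambda>x. if \<exists>b. reach x b then SOME b. reach x b else b0)"
  have att: "att x = b" if "reach x b" for x b
    using that uniq unfolding att_def by (metis someI_ex)
  have "att x \<in> B" for x
    using att b0 unfolding att_def reach_def by (metis (mono_tags, lifting) someI_ex)
  moreover have "att x = att y" if "x \<in> V - B" "y \<in> V - B" "A x y" for x y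
  proof -
    have "(x, y) \<in> R" "(y, x) \<in> R" using that sym by (auto simp: R_def)
    then have "reach x = reach y"
      unfolding reach_def by (meson converse_rtrancl_into_rtrancl)
    then show ?thesis unfolding att_def by (rule arg_cong)
  qed
  moreover have "att x = b" if "x \<in> V - B" "b \<in> B" "A x b" for x b
    by (rule att) (use that in \<open>auto simp: reach_def\<close>)
  ultimately show ?thesis unfolding hung_def by (intro exI[of _ att]) blast
qed

text \<open>Absorb ears as long as there are any. Each one moves \<open>length ws\<close> vertices into \<open>B\<close> and
  raises the lower bound by the same amount, so the hypothesis on \<open>card (V - B) + \<mu>\<close> is
  preserved.\<close>

lemma linked_decomposition:
  assumes "linked N B \<mu> c" "odd N" "cycle_free N" "B \<subseteq> V" "B \<noteq> {}" "card (V - B) + \<mu> \<le> N"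
  shows "\<exists>B' (c' :: 'a \<Rightarrow> bool) att. B \<subseteq> B' \<and> B' \<subseteq> V \<and> (\<forall>u\<in>B'. \<forall>v\<in>B'. A u v \<longrightarrow> c' u \<noteq> c' v) \<and> hung B' att"
  using assms
proof (induction "card (V - B)" arbitrary: B \<mu> c rule: less_induct)
  case less
  show ?case
  proof (cases "\<exists>a ws b. ear B a ws b")
    case False
    then obtain att where "hung B att" using hung_if_no_ear[OF less.prems(4,5)] by blast
    moreover have "\<forall>u\<in>B. \<forall>v\<in>B. A u v \<longrightarrow> c u \<noteq> c v"
      using linked_proper[OF less.prems(1,2) _ less.prems(3,4)] less.prems(6) by simp
    ultimately show ?thesis using less.prems(4) by (intro exI[of _ B] exI[of _ c] exI[of _ att]) simp
  next
    case True
    then obtain a ws b where e: "ear B a ws b" by blast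
    then have ws: "set ws \<subseteq> V - B" "distinct ws" "ws \<noteq> []" by (auto simp: ear_def)
    have cw: "length ws = card (set ws)" using ws by (simp add: distinct_card)
    have fV: "finite (V - B)" using fin by simp
    have le: "length ws \<le> card (V - B)" using cw card_mono[OF fV ws(1)] by simp
    have "V - (B \<union> set ws) = (V - B) - set ws" by blast
    then have cd: "card (V - (B \<union> set ws)) = card (V - B) - length ws"
      using card_Diff_subset[of "set ws" "V - B"] ws cw by simp
    have pos: "length ws > 0" using ws by simp
    have "odd (length ws) \<longleftrightarrow> c a = c b"
      using ear_parity[OF less.prems(1,2,3,4) e] le less.prems(6) by simp
    then obtain c' where c': "linked N (B \<union> set ws) (\<mu> + length ws) c'"
      using ear_extend[OF less.prems(1) e] by blast
    have lt: "card (V - (B \<union> set ws)) < card (V - B)" using cd pos le by linarith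
    have sub: "B \<union> set ws \<subseteq> V" "B \<union> set ws \<noteq> {}" using less.prems(4,5) ws by auto
    have bd: "card (V - (B \<union> set ws)) + (\<mu> + length ws) \<le> N" using cd le less.prems(6) by linarith
    obtain B' and c'' :: "'a \<Rightarrow> bool" and att where "B \<union> set ws \<subseteq> B'" "B' \<subseteq> V" "\<forall>u\<in>B'. \<forall>v\<in>B'. A u v \<longrightarrow> c'' u \<noteq> c'' v" "hung B' att"
      using less.hyps[OF lt c' less.prems(2,3) sub bd] by (elim exE conjE) (rule that)
    then show ?thesis by (intro exI[of _ B'] exI[of _ c''] exI[of _ att]) simp
  qed
qed

end

section \<open>Paths in complete bipartite graphs\<close>

text \<open>The number of alternating lists of length \<open>j\<close> in the complete bipartite graph with
  parts of sizes \<open>a\<close> and \<open>b\<close> that start in the first part: after the first vertex is chosen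
  and deleted, the roles of the parts are exchanged.\<close>

fun alt_count :: "nat \<Rightarrow> nat \<Rightarrow> nat \<Rightarrow> nat" where
  "alt_count a b 0 = 1"
| "alt_count a b (Suc j) = a * alt_count b (a - 1) j"

fun alternating_lists :: "'a set \<Rightarrow> 'a set \<Rightarrow> nat \<Rightarrow> 'a list set" where
  "alternating_lists X Y 0 = {[]}"
| "alternating_lists X Y (Suc j) = (\<Union>x\<in>X. (#) x ` alternating_lists Y (X - {x}) j)"

definition bip :: "'a set \<Rightarrow> 'a set \<Rightarrow> 'a \<Rightarrow> 'a \<Rightarrow> bool" where
  "bip X Y u v \<longleftrightarrow> (u \<in> X \<and> v \<in> Y) \<or> (u \<in> Y \<and> v \<in> X)"

lemma bip_commute: "bip X Y = bip Y X"
  by (intro ext) (auto simp: bip_def)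

lemma finite_alternating_lists:
  assumes "finite X" "finite Y" shows "finite (alternating_lists X Y j)"
  using assms by (induction X Y j rule: alternating_lists.induct) auto

lemma card_alternating_lists:
  assumes "finite X" "finite Y" shows "card (alternating_lists X Y j) = alt_count (card X) (card Y) j"
  using assms
proof (induction j arbitrary: X Y)
  case (Suc j)
  have "card (alternating_lists X Y (Suc j)) = (\<Sum>x\<in>X. card ((#) x ` alternating_lists Y (X - {x}) j))"
    unfolding alternating_lists.simps by (rule card_UN_disjoint) (auto simp: Suc.prems finite_alternating_lists)
  also have "\<dots> = (\<Sum>x\<in>X. alt_count (card Y) (card X - 1) j)"
    by (rule sum.cong) (use Suc in \<open>auto simp: card_image\<close>)
  finally show ?case by simp
qed simp

lemma alternating_lists_iff:
  assumes "X \<inter> Y = {}"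
  shows "xs \<in> alternating_lists X Y j \<longleftrightarrow> length xs = j \<and> distinct xs \<and> set xs \<subseteq> X \<union> Y \<and>
    successively (bip X Y) xs \<and> (xs \<noteq> [] \<longrightarrow> hd xs \<in> X)"
  using assms
proof (induction j arbitrary: X Y xs)
  case 0
  then show ?case by auto
next
  case (Suc j)
  show ?case
  proof (cases xs)
    case Nil
    then show ?thesis by auto
  next
    case (Cons x ys)
    have IH: "ys \<in> alternating_lists Y (X - {x}) j \<longleftrightarrow> length ys = j \<and> distinct ys \<and> set ys \<subseteq> Y \<union> (X - {x}) \<and>
       successively (bip Y (X - {x})) ys \<and> (ys \<noteq> [] \<longrightarrow> hd ys \<in> Y)"
      by (rule Suc.IH) (use Suc.prems in auto)
    have c: "successively (bip Y (X - {x})) ys \<longleftrightarrow> successively (bip X Y) ys" if "x \<notin> set ys"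
      by (rule successively_cong) (use that in \<open>auto simp: bip_def\<close>)
    have d: "x \<in> X \<Longrightarrow> ys \<noteq> [] \<Longrightarrow> bip X Y x (hd ys) \<longleftrightarrow> hd ys \<in> Y"
      using Suc.prems by (auto simp: bip_def)
    show ?thesis
    proof (cases "x \<in> X \<and> x \<notin> set ys")
      case True
      have "xs \<in> alternating_lists X Y (Suc j) \<longleftrightarrow> ys \<in> alternating_lists Y (X - {x}) j" using Cons True by auto
      also have "\<dots> \<longleftrightarrow> length ys = j \<and> distinct ys \<and> set ys \<subseteq> X \<union> Y \<and>
         successively (bip X Y) ys \<and> (ys \<noteq> [] \<longrightarrow> hd ys \<in> Y)"
        unfolding IH using c True by blast
      also have "\<dots> \<longleftrightarrow> length xs = Suc j \<and> distinct xs \<and> set xs \<subseteq> X \<union> Y \<and>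
         successively (bip X Y) xs \<and> (xs \<noteq> [] \<longrightarrow> hd xs \<in> X)"
        using Cons True d by (auto simp: successively_Cons)
      finally show ?thesis .
    next
      case False
      then have "xs \<notin> alternating_lists X Y (Suc j)" using Cons IH Suc.prems by auto
      then show ?thesis using False Cons by auto
    qed
  qed
qed

text \<open>The number of lists of length \<open>j + 1\<close> that start at a fixed vertex of the complete
  bipartite graph, maximised (here) or minimised (below) over the side of that vertex.\<close>

definition rooted_max :: "nat \<Rightarrow> nat \<Rightarrow> nat \<Rightarrow> nat" where
  "rooted_max p q j = max (alt_count q (p - 1) j) (alt_count p (q - 1) j)"

definition rooted_min :: "nat \<Rightarrow> nat \<Rightarrow> nat \<Rightarrow> nat" where
  "rooted_min p q j = min (alt_count q (p - 1) j) (alt_count p (q - 1) j)"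

definition Kcount :: "nat \<Rightarrow> nat \<Rightarrow> nat \<Rightarrow> nat" where
  "Kcount p q t = alt_count p q t + alt_count q p t"

lemma alt_count_mono: "a \<le> a' \<Longrightarrow> b \<le> b' \<Longrightarrow> alt_count a b j \<le> alt_count a' b' j"
  by (induction j arbitrary: a b a' b') (auto intro!: mult_le_mono)

lemma alt_count_lower: "m + j \<le> a \<Longrightarrow> m + j \<le> b \<Longrightarrow> m ^ j \<le> alt_count a b j"
proof (induction j arbitrary: a b)
  case (Suc j)
  have "m ^ j \<le> alt_count b (a - 1) j" using Suc by auto
  then have "m * m ^ j \<le> a * alt_count b (a - 1) j" using Suc.prems by (intro mult_le_mono) auto
  then show ?case by simp
qed simp

lemma alt_count_upper: "a \<le> n \<Longrightarrow> b \<le> n \<Longrightarrow> alt_count a b j \<le> n ^ j"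
proof (induction j arbitrary: a b)
  case (Suc j)
  have "alt_count b (a - 1) j \<le> n ^ j" using Suc by auto
  then have "a * alt_count b (a - 1) j \<le> n * n ^ j" using Suc.prems by (intro mult_le_mono) auto
  then show ?case by simp
qed simp

text \<open>Moving a bounded number of vertices between the parts changes the count only in the
  next lower order. Truncated differences make the one-sided estimate valid for all sizes.\<close>

lemma alt_count_lipschitz:
  assumes "a \<le> n" "b \<le> n" "a' \<le> n" "b' \<le> n"
  shows "alt_count a b j \<le> alt_count a' b' j + j * ((a - a') + (b - b')) * n ^ (j - 1)"
  using assms
proof (induction j arbitrary: a b a' b')
  case (Suc j)
  let ?d = "(a - a') + (b - b')"
  have IH: "alt_count b (a - 1) j \<le> alt_count b' (a' - 1) j + j * ?d * n ^ (j - 1)"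
  proof -
    have "alt_count b (a - 1) j \<le> alt_count b' (a' - 1) j + j * ((b - b') + ((a - 1) - (a' - 1))) * n ^ (j - 1)"
      using Suc.prems by (intro Suc.IH) auto
    also have "\<dots> \<le> alt_count b' (a' - 1) j + j * ?d * n ^ (j - 1)"
    proof -
      have "(b - b') + ((a - 1) - (a' - 1)) \<le> ?d" by linarith
      then show ?thesis by (intro add_left_mono mult_le_mono1 mult_le_mono2)
    qed
    finally show ?thesis .
  qed
  have u: "alt_count b (a - 1) j \<le> n ^ j" using Suc.prems by (intro alt_count_upper) auto
  have "alt_count a b (Suc j) \<le> (a' + (a - a')) * alt_count b (a - 1) j"
    unfolding alt_count.simps by (intro mult_le_mono1) simp
  also have "\<dots> = a' * alt_count b (a - 1) j + (a - a') * alt_count b (a - 1) j" by (simp add: add_mult_distrib)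
  also have "\<dots> \<le> a' * (alt_count b' (a' - 1) j + j * ?d * n ^ (j - 1)) + (a - a') * n ^ j"
    using IH u by (intro add_mono mult_le_mono2)
  also have "\<dots> = alt_count a' b' (Suc j) + a' * (j * ?d * n ^ (j - 1)) + (a - a') * n ^ j"
    by (simp add: algebra_simps)
  also have "a' * (j * ?d * n ^ (j - 1)) \<le> j * ?d * n ^ j"
  proof (cases j)
    case (Suc i)
    have "a' * (j * ?d * n ^ i) \<le> n * (j * ?d * n ^ i)" using Suc.prems by (intro mult_le_mono1) simp
    then show ?thesis using Suc by (simp add: algebra_simps)
  qed simp
  also have "(a - a') * n ^ j \<le> ?d * n ^ j" by (intro mult_le_mono1) simp
  finally have "alt_count a b (Suc j) \<le> alt_count a' b' (Suc j) + j * ?d * n ^ j + ?d * n ^ j" by simp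
  also have "\<dots> = alt_count a' b' (Suc j) + Suc j * ?d * n ^ (Suc j - 1)"
    by (simp only: add.assoc mult_Suc add_mult_distrib diff_Suc_1 add.commute[of "?d * n ^ j"])
  finally show ?case .
qed simp

text \<open>The falling factorial \<open>n (n - 1) \<dots> (n - k + 1)\<close>.\<close>

fun falling :: "nat \<Rightarrow> nat \<Rightarrow> nat" where
  "falling n 0 = 1"
| "falling n (Suc k) = n * falling (n - 1) k"

lemma falling_Suc': "falling n (Suc k) = falling n k * (n - k)"
proof (induction k arbitrary: n)
  case (Suc k)
  have "falling n (Suc (Suc k)) = n * falling (n - 1) (Suc k)" by (rule falling.simps(2))
  also have "\<dots> = n * (falling (n - 1) k * (n - 1 - k))" by (simp only: Suc.IH)
  also have "\<dots> = falling n (Suc k) * (n - Suc k)" by simp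
  finally show ?case .
qed simp

lemma alt_count_falling:
  "alt_count a b (2 * h) = falling a h * falling b h"
  "alt_count a b (Suc (2 * h)) = falling a (Suc h) * falling b h"
proof -
  have e: "alt_count a b (2 * h) = falling a h * falling b h" for a b
    by (induction h arbitrary: a b) (auto simp: algebra_simps)
  then show "alt_count a b (2 * h) = falling a h * falling b h" .
  show "alt_count a b (Suc (2 * h)) = falling a (Suc h) * falling b h" using e by simp
qed

text \<open>In terms of falling factorials, the gain from moving a vertex from the larger part \<open>p\<close>
  to the smaller part \<open>q\<close> is a product of falling factorials of \<open>p - 1\<close> and \<open>q\<close> times a
  positive multiple of \<open>p - q - 1\<close>, for odd \<open>t\<close> with one more factor of order \<open>p + q\<close>.\<close>

lemma Kcount_step:
  assumes pq: "p \<ge> q + 2" and q: "q \<ge> m + t" and t: "t \<ge> 2" and m: "m \<ge> 1"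
  shows "Kcount p q t + m ^ (t - 2) \<le> Kcount (p - 1) (q + 1) t"
proof -
  define h where "h = t div 2"
  have h: "h \<ge> 1" using t by (auto simp: h_def)
  obtain g where g: "h = Suc g" using h by (cases h) auto
  define p' where "p' = p - 1"
  have p: "p = Suc p'" using pq by (simp add: p'_def)
  define F where "F = falling p' g * falling q g"
  have base: "falling p h * falling q h + h * (p - q - 1) * F = falling p' h * falling (q + 1) h"
  proof -
    have 1: "falling p h * falling q h = Suc p' * (q - g) * F"
      unfolding F_def g p falling_Suc'[of q g] falling.simps(2)[of "Suc p'" g] diff_Suc_1
      by (simp only: ac_simps)
    have 2: "falling p' h * falling (q + 1) h = (p' - g) * Suc q * F"
      unfolding F_def g p falling_Suc'[of p' g] Suc_eq_plus1[symmetric] falling.simps(2)[of "Suc q" g] diff_Suc_1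
      by (simp only: ac_simps)
    have ht: "2 * h \<le> t" by (simp add: h_def)
    have "q \<ge> g" "p' \<ge> q + 1" using q pq p g ht by linarith+
    then obtain x y where x: "q = g + x" and y: "p' = g + x + 1 + y" by (metis le_Suc_ex)
    have "Suc p' * (q - g) + h * (p - q - 1) = (p' - g) * Suc q"
      unfolding p x y g by (simp add: algebra_simps)
    then show ?thesis unfolding 1 2 by (metis add_mult_distrib)
  qed
  have ht: "2 * h \<le> t" by (simp add: h_def)
  have Flow: "m ^ (2 * g) \<le> F"
  proof -
    have "m ^ (2 * g) \<le> alt_count p' q (2 * g)" using q pq p g ht by (intro alt_count_lower) auto
    then show ?thesis by (simp add: alt_count_falling(1) F_def)
  qed
  have hp: "1 \<le> h * (p - q - 1)" using h pq by simp
  show ?thesis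
  proof (cases "even t")
    case True
    then have th: "t = 2 * h" by (simp add: h_def)
    have K: "Kcount a b t = 2 * (falling a h * falling b h)" for a b
      by (simp add: Kcount_def th alt_count_falling(1))
    have "m ^ (t - 2) \<le> h * (p - q - 1) * F"
    proof -
      have "m ^ (t - 2) \<le> F" using Flow th g by simp
      then show ?thesis using hp mult_le_mono[OF hp, of "m ^ (t - 2)" F] by simp
    qed
    then show ?thesis unfolding K using base by (simp add: p'_def)
  next
    case False
    then have th: "t = Suc (2 * h)" by (auto simp: h_def elim: oddE)
    have K: "Kcount a b t = (falling a h * falling b h) * (a + b - 2 * h)" if "a \<ge> h" "b \<ge> h" for a b
    proof -
      have "Kcount a b t = falling a h * (a - h) * falling b h + falling b h * (b - h) * falling a h"
        unfolding Kcount_def th alt_count_falling(2) falling_Suc' by simp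
      also have "\<dots> = (falling a h * falling b h) * ((a - h) + (b - h))" by (simp add: algebra_simps)
      also have "(a - h) + (b - h) = a + b - 2 * h" using that by simp
      finally show ?thesis .
    qed
    have ge: "p \<ge> h" "q \<ge> h" "p' \<ge> h" using q pq p ht by linarith+
    have s: "p' + (q + 1) = p + q" using p by simp
    have "Kcount p' (q + 1) t = (falling p' h * falling (q + 1) h) * (p' + (q + 1) - 2 * h)"
      using ge by (intro K) auto
    also have "\<dots> = (falling p h * falling q h + h * (p - q - 1) * F) * (p + q - 2 * h)"
      unfolding base s ..
    also have "\<dots> = Kcount p q t + h * (p - q - 1) * F * (p + q - 2 * h)"
      unfolding K[OF ge(1,2)] by (rule add_mult_distrib)
    finally have "Kcount p' (q + 1) t = Kcount p q t + h * (p - q - 1) * F * (p + q - 2 * h)" .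
    moreover have "m ^ (t - 2) \<le> h * (p - q - 1) * F * (p + q - 2 * h)"
    proof -
      have "m \<le> p + q - 2 * h" using q pq ht by linarith
      then have "m ^ (2 * g) * m \<le> (h * (p - q - 1) * F) * (p + q - 2 * h)"
        using mult_le_mono[OF hp Flow] by (intro mult_le_mono) auto
      moreover have "m ^ (t - 2) = m ^ (2 * g) * m" using th g by simp
      ultimately show ?thesis by simp
    qed
    ultimately show ?thesis by (simp add: p'_def)
  qed
qed

definition Kbal :: "nat \<Rightarrow> nat \<Rightarrow> nat" where
  "Kbal k t = Kcount (k div 2) (k - k div 2) t"

lemma Kcount_commute: "Kcount p q t = Kcount q p t"
  by (simp add: Kcount_def)

lemma Kcount_le_Kbal_aux:
  assumes "q \<ge> m + t" "t \<ge> 2" "m \<ge> 1" "q \<le> p"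
  shows "Kcount p q t + ((p - q) div 2) * m ^ (t - 2) \<le> Kbal (p + q) t"
  using assms
proof (induction "p - q" arbitrary: p q rule: less_induct)
  case less
  show ?case
  proof (cases "p \<ge> q + 2")
    case False
    then have "p = q \<or> p = Suc q" using less.prems by linarith
    then show ?thesis
    proof
      assume p: "p = Suc q"
      have "(p + q) div 2 = q" "(p + q) - q = p" using p by auto
      then show ?thesis using p by (simp add: Kbal_def Kcount_commute)
    qed (simp add: Kbal_def mult_2[symmetric])
  next
    case True
    have IH: "Kcount (p - 1) (q + 1) t + ((p - 1 - (q + 1)) div 2) * m ^ (t - 2) \<le> Kbal (p - 1 + (q + 1)) t"
      by (rule less.hyps) (use True less.prems in auto)
    have s: "p - 1 + (q + 1) = p + q" using True by simp
    have d: "(p - q) div 2 = Suc ((p - 1 - (q + 1)) div 2)"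
    proof -
      obtain z where "p = q + 2 + z" using True le_Suc_ex by blast
      then show ?thesis by simp
    qed
    have "Kcount p q t + m ^ (t - 2) \<le> Kcount (p - 1) (q + 1) t"
      using Kcount_step[OF True less.prems(1,2,3)] .
    then show ?thesis using IH unfolding s d by simp
  qed
qed

text \<open>The loss of an unbalanced complete bipartite graph is proportional to the number of
  vertices that have to be moved, which later outweighs the variation of the rooted counts.\<close>

lemma Kcount_le_Kbal:
  assumes "p \<ge> m + t" "q \<ge> m + t" "t \<ge> 2" "m \<ge> 1"
  shows "Kcount p q t + (((p - q) + (q - p)) div 2) * m ^ (t - 2) \<le> Kbal (p + q) t"
proof (cases "q \<le> p")
  case True
  then show ?thesis using Kcount_le_Kbal_aux[OF assms(2-4) True] by simp
next
  case False
  then have "p \<le> q" by simp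
  from Kcount_le_Kbal_aux[OF assms(1,3,4) this] show ?thesis
    using False by (simp add: Kcount_commute add.commute)
qed

lemma Kcount_Suc:
  assumes "p \<ge> m + t" "q \<ge> m + t" "t \<ge> 1"
  shows "Kcount p q t + m ^ (t - 1) \<le> Kcount (Suc p) q t"
proof -
  obtain j where j: "t = Suc j" using assms by (cases t) auto
  have "alt_count p q t \<le> p * alt_count q p j"
    unfolding j by (simp add: alt_count_mono mult_le_mono2)
  moreover have "alt_count (Suc p) q t = p * alt_count q p j + alt_count q p j" unfolding j by simp
  moreover have "m ^ j \<le> alt_count q p j" using assms j by (intro alt_count_lower) auto
  moreover have "alt_count q p t \<le> alt_count q (Suc p) t" by (rule alt_count_mono) auto
  moreover have "t - 1 = j" using j by simp
  ultimately show ?thesis unfolding Kcount_def by (simp only:)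
qed

lemma Kbal_Suc:
  assumes "k div 2 \<ge> m + t" "t \<ge> 1"
  shows "Kbal k t + m ^ (t - 1) \<le> Kbal (Suc k) t"
proof -
  have kk: "k - k div 2 \<ge> m + t" using assms by linarith
  show ?thesis
  proof (cases "even k")
    case True
    have e: "Suc k div 2 = k div 2" "Suc k - k div 2 = Suc (k - k div 2)" using True by auto
    show ?thesis unfolding Kbal_def e
      using Kcount_Suc[OF kk assms(1,2)] by (simp add: Kcount_commute)
  next
    case False
    have e: "Suc k div 2 = Suc (k div 2)" "Suc k - Suc (k div 2) = k - k div 2" using False by auto
    show ?thesis unfolding Kbal_def e using Kcount_Suc[OF assms(1) kk assms(2)] .
  qed
qed

text \<open>Each vertex of a balanced complete bipartite graph is worth order \<open>n\<^bsup>t-1\<^esup>\<close> path lists.\<close>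

lemma Kbal_add:
  assumes "k div 2 \<ge> m + t" "t \<ge> 1"
  shows "Kbal k t + d * m ^ (t - 1) \<le> Kbal (k + d) t"
proof (induction d)
  case (Suc d)
  have "(k + d) div 2 \<ge> m + t" using assms by linarith
  from Kbal_Suc[OF this assms(2)] have "Kbal (k + d) t + m ^ (t - 1) \<le> Kbal (k + Suc d) t" by simp
  moreover have "Suc d * m ^ (t - 1) = d * m ^ (t - 1) + m ^ (t - 1)" by simp
  ultimately show ?case using Suc.IH by linarith
qed simp

section \<open>Stability\<close>

context fin_graph
begin

definition nb :: "'a \<Rightarrow> 'a set" where "nb v = {u. A v u}"

definition deg :: "'a \<Rightarrow> nat" where "deg v = card (nb v)"

definition degsum :: nat where "degsum = (\<Sum>v\<in>V. deg v)"

lemma nb_subset: "nb v \<subseteq> V"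
  using dom' by (auto simp: nb_def)

lemma finite_nb [simp]: "finite (nb v)"
  using nb_subset fin finite_subset by blast

lemma deg_le: "deg v \<le> card V"
  unfolding deg_def by (rule card_mono[OF fin nb_subset])

text \<open>As long as a path in \<open>S\<close> has at most \<open>k\<close> vertices, its first vertex has a neighbour in
  \<open>S\<close> off the path.\<close>

lemma min_degree_path:
  assumes S: "S \<subseteq> V" "S \<noteq> {}" and d: "\<And>v. v \<in> S \<Longrightarrow> card (nb v \<inter> S) > k"
  shows "\<exists>xs. length xs = Suc k \<and> distinct xs \<and> set xs \<subseteq> S \<and> successively A xs"
proof -
  have "\<exists>xs. length xs = Suc j \<and> distinct xs \<and> set xs \<subseteq> S \<and> successively A xs" if "j \<le> k" for j
    using that
  proof (induction j)
    case 0
    obtain x where "x \<in> S" using S by blast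
    then show ?case by (intro exI[of _ "[x]"]) simp
  next
    case (Suc j)
    then obtain xs where xs: "length xs = Suc j" "distinct xs" "set xs \<subseteq> S" "successively A xs" by auto
    then have ne: "xs \<noteq> []" by auto
    then have h: "hd xs \<in> S" using xs by auto
    have "card (set xs) \<le> k" using xs Suc.prems by (simp add: distinct_card)
    then have "card (set xs) < card (nb (hd xs) \<inter> S)" using d[OF h] by simp
    then have "\<not> nb (hd xs) \<inter> S \<subseteq> set xs" by (metis List.finite_set card_mono leD)
    then obtain y where y: "y \<in> S" "A (hd xs) y" "y \<notin> set xs" by (auto simp: nb_def)
    then show ?case using xs ne sym
      by (intro exI[of _ "y # xs"]) (auto simp: successively_Cons)
  qed
  then show ?thesis by blast
qed

text \<open>Repeatedly delete a vertex of degree at most \<open>k\<close>; one exists, since otherwise large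
  minimum degree would give a path.\<close>

lemma path_free_degree_sum:
  assumes "S \<subseteq> V" "\<And>xs. length xs = Suc k \<Longrightarrow> distinct xs \<Longrightarrow> set xs \<subseteq> S \<Longrightarrow> \<not> successively A xs"
  shows "(\<Sum>v\<in>S. card (nb v \<inter> S)) \<le> 2 * k * card S"
  using assms
proof (induction "card S" arbitrary: S rule: less_induct)
  case less
  have fS: "finite S" using less.prems(1) fin finite_subset by blast
  show ?case
  proof (cases "S = {}")
    case False
    have "\<not> (\<forall>v\<in>S. card (nb v \<inter> S) > k)"
      using min_degree_path[OF less.prems(1) False] less.prems(2) by blast
    then obtain v where v: "v \<in> S" "card (nb v \<inter> S) \<le> k" by (auto simp: not_less)
    let ?T = "S - {v}"
    have lt: "card ?T < card S" using v fS by (meson card_Diff1_less)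
    have IH: "(\<Sum>u\<in>?T. card (nb u \<inter> ?T)) \<le> 2 * k * card ?T"
      using less.hyps[OF lt] less.prems by blast
    have e: "card (nb u \<inter> S) = card (nb u \<inter> ?T) + (if u \<in> nb v then 1 else 0)" if "u \<in> ?T" for u
    proof (cases "u \<in> nb v")
      case True
      then have "nb u \<inter> S = insert v (nb u \<inter> ?T)" using v sym by (auto simp: nb_def)
      then show ?thesis using True by simp
    next
      case False
      then have "nb u \<inter> S = nb u \<inter> ?T" using sym by (auto simp: nb_def)
      then show ?thesis using False by simp
    qed
    have "(\<Sum>u\<in>S. card (nb u \<inter> S)) = card (nb v \<inter> S) + (\<Sum>u\<in>?T. card (nb u \<inter> S))"
      using sum.remove[OF fS v(1)] by simp
    also have "(\<Sum>u\<in>?T. card (nb u \<inter> S)) = (\<Sum>u\<in>?T. card (nb u \<inter> ?T)) + (\<Sum>u\<in>?T. if u \<in> nb v then 1 else 0)"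
      unfolding sum.distrib[symmetric] by (rule sum.cong[OF refl e])
    also have "(\<Sum>u\<in>?T. if u \<in> nb v then 1 else 0::nat) = card (nb v \<inter> ?T)"
      using fS by (simp add: sum.If_cases Int_commute)
    also have "\<dots> \<le> card (nb v \<inter> S)" by (rule card_mono) auto
    finally have "(\<Sum>u\<in>S. card (nb u \<inter> S)) \<le> 2 * k + 2 * k * card ?T" using IH v(2) by linarith
    moreover have "card S = Suc (card ?T)" using v fS by (metis card_Suc_Diff1)
    ultimately show ?thesis by simp
  qed simp
qed

text \<open>A path in the neighbourhood of \<open>v\<close> closes through \<open>v\<close> to a cycle with one more vertex.\<close>

lemma nb_degree_sum:
  assumes "cycle_free (Suc (Suc k))"
  shows "(\<Sum>u\<in>nb v. card (nb u \<inter> nb v)) \<le> 2 * k * deg v"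
  unfolding deg_def
proof (rule path_free_degree_sum[OF nb_subset])
  fix xs assume xs: "length xs = Suc k" "distinct xs" "set xs \<subseteq> nb v"
  show "\<not> successively A xs"
  proof
    assume s: "successively A xs"
    have ne: "xs \<noteq> []" using xs by auto
    then have hl: "hd xs \<in> nb v" "last xs \<in> nb v" using xs by auto
    have "v \<notin> set xs" using xs(3) irrefl by (auto simp: nb_def)
    then have "length (v # xs) = Suc (Suc k)" "distinct (v # xs)" "set (v # xs) \<subseteq> V" "successively A (v # xs)"
      "A (last (v # xs)) (hd (v # xs))"
      using xs s hl ne nb_subset[of v] sym dom by (auto simp: nb_def successively_Cons)
    then show False using assms unfolding cycle_free_def by blast
  qed
qed

text \<open>The neighbours of \<open>v\<close> have few neighbours in common with \<open>v\<close>, so almost all of their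
  edges leave the neighbourhood.\<close>

lemma two_step_bound:
  assumes "cycle_free (Suc (Suc k))"
  shows "(\<Sum>u\<in>nb v. deg u) \<le> 2 * k * deg v + deg v * (card V - deg v)"
proof -
  have "deg u \<le> card (nb u \<inter> nb v) + (card V - deg v)" for u
  proof -
    have "nb u \<subseteq> (nb u \<inter> nb v) \<union> (V - nb v)" using nb_subset by blast
    then have "card (nb u) \<le> card ((nb u \<inter> nb v) \<union> (V - nb v))" by (rule card_mono[rotated]) (simp add: fin)
    also have "\<dots> \<le> card (nb u \<inter> nb v) + card (V - nb v)" by (rule card_Un_le)
    also have "card (V - nb v) = card V - deg v" unfolding deg_def by (rule card_Diff_subset) (simp_all add: nb_subset)
    finally show ?thesis by (simp add: deg_def)
  qed
  then have "(\<Sum>u\<in>nb v. deg u) \<le> (\<Sum>u\<in>nb v. card (nb u \<inter> nb v) + (card V - deg v))" by (intro sum_mono)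
  also have "\<dots> = (\<Sum>u\<in>nb v. card (nb u \<inter> nb v)) + deg v * (card V - deg v)"
    by (simp add: sum.distrib deg_def)
  finally show ?thesis using nb_degree_sum[OF assms, of v] by linarith
qed

text \<open>The maximum of the bound in \<open>two_step_bound\<close>, attained at degree about \<open>n/2\<close>.\<close>

definition two_step_cap :: "nat \<Rightarrow> real" where
  "two_step_cap k = real (card V) ^ 2 / 4 + 2 * real k * real (card V)"

lemma two_step_le_cap:
  assumes "cycle_free (Suc (Suc k))"
  shows "real (\<Sum>u\<in>nb v. deg u) \<le> two_step_cap k"
proof -
  have "real (\<Sum>u\<in>nb v. deg u) \<le> real (2 * k * deg v + deg v * (card V - deg v))"
    using two_step_bound[OF assms, of v] by (simp only: of_nat_le_iff)
  also have "\<dots> = 2 * real k * real (deg v) + real (deg v) * (real (card V) - real (deg v))"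
    using deg_le[of v] by (simp add: of_nat_diff)
  also have "\<dots> \<le> 2 * real k * real (card V) + real (card V) ^ 2 / 4"
  proof (rule add_mono)
    show "2 * real k * real (deg v) \<le> 2 * real k * real (card V)"
      using deg_le[of v] by (intro mult_left_mono) auto
    have "0 \<le> (real (card V) / 2 - real (deg v)) ^ 2" by simp
    then show "real (deg v) * (real (card V) - real (deg v)) \<le> real (card V) ^ 2 / 4"
      by (simp add: power2_eq_square algebra_simps)
  qed
  finally show ?thesis by (simp add: two_step_cap_def)
qed

lemma sum_nb_swap: "(\<Sum>v\<in>V. \<Sum>u\<in>nb v. f u) = (\<Sum>u\<in>V. deg u * f u)" for f :: "'a \<Rightarrow> nat"
proof -
  have "(\<Sum>v\<in>V. \<Sum>u\<in>nb v. f u) = (\<Sum>v\<in>V. \<Sum>u\<in>V. if A v u then f u else 0)"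
  proof (rule sum.cong[OF refl])
    fix v
    have "(\<Sum>u\<in>V. if A v u then f u else 0) = (\<Sum>u\<in>V \<inter> {u. A v u}. f u)"
      using fin by (simp add: sum.If_cases)
    also have "V \<inter> {u. A v u} = nb v" using nb_subset[of v] by (auto simp: nb_def)
    finally show "(\<Sum>u\<in>nb v. f u) = (\<Sum>u\<in>V. if A v u then f u else 0)" by simp
  qed
  also have "\<dots> = (\<Sum>u\<in>V. \<Sum>v\<in>V. if A v u then f u else 0)" by (rule sum.swap)
  also have "\<dots> = (\<Sum>u\<in>V. deg u * f u)"
  proof (rule sum.cong[OF refl])
    fix u
    have "(\<Sum>v\<in>V. if A v u then f u else 0) = (\<Sum>v\<in>V \<inter> {v. A v u}. f u)"
      using fin by (simp add: sum.If_cases)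
    also have "V \<inter> {v. A v u} = nb u" using nb_subset[of u] sym dom by (auto simp: nb_def)
    finally show "(\<Sum>v\<in>V. if A v u then f u else 0) = deg u * f u" by (simp add: deg_def)
  qed
  finally show ?thesis .
qed

lemma path_lists_two_more:
  assumes "cycle_free (Suc (Suc k))" "t \<ge> 1"
  shows "real (card (path_lists A V (Suc (Suc t)))) \<le> two_step_cap k * real (card (path_lists A V t))"
proof -
  let ?P = "path_lists A V t"
  have fP: "finite ?P" using finite_path_lists[OF fin] .
  let ?F = "\<lambda>xs. \<Union>b\<in>nb (hd xs). (\<lambda>a. a # b # xs) ` nb b"
  have sub: "path_lists A V (Suc (Suc t)) \<subseteq> (\<Union>xs\<in>?P. ?F xs)"
  proof
    fix ys assume ys: "ys \<in> path_lists A V (Suc (Suc t))"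
    then obtain a b xs where e: "ys = a # b # xs" "length xs = t"
      by (auto simp: path_lists_def length_Suc_conv)
    have ne: "xs \<noteq> []" using e assms(2) by auto
    have "xs \<in> ?P" "b \<in> nb (hd xs)" "a \<in> nb b"
      using ys e ne sym by (auto simp: path_lists_def nb_def successively_Cons)
    then show "ys \<in> (\<Union>xs\<in>?P. ?F xs)" unfolding e(1) by blast
  qed
  have cF: "card (?F xs) \<le> (\<Sum>b\<in>nb (hd xs). deg b)" for xs
  proof -
    have "card (?F xs) \<le> (\<Sum>b\<in>nb (hd xs). card ((\<lambda>a. a # b # xs) ` nb b))" by (rule card_UN_le) simp
    also have "\<dots> \<le> (\<Sum>b\<in>nb (hd xs). deg b)" unfolding deg_def by (intro sum_mono card_image_le) simp
    finally show ?thesis .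
  qed
  have "card (path_lists A V (Suc (Suc t))) \<le> card (\<Union>xs\<in>?P. ?F xs)"
    by (rule card_mono[OF _ sub]) (use fP in auto)
  also have "\<dots> \<le> (\<Sum>xs\<in>?P. card (?F xs))" by (rule card_UN_le[OF fP])
  also have "\<dots> \<le> (\<Sum>xs\<in>?P. \<Sum>b\<in>nb (hd xs). deg b)" by (intro sum_mono cF)
  finally have "real (card (path_lists A V (Suc (Suc t)))) \<le> real (\<Sum>xs\<in>?P. \<Sum>b\<in>nb (hd xs). deg b)"
    by (simp only: of_nat_le_iff)
  also have "\<dots> = (\<Sum>xs\<in>?P. real (\<Sum>b\<in>nb (hd xs). deg b))" by (rule of_nat_sum)
  also have "\<dots> \<le> (\<Sum>xs\<in>?P. two_step_cap k)" by (intro sum_mono two_step_le_cap[OF assms(1)])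
  finally show ?thesis by (simp add: mult.commute)
qed

lemma path_lists_2: "card (path_lists A V 2) \<le> degsum"
proof -
  have sub: "path_lists A V 2 \<subseteq> (\<Union>b\<in>V. (\<lambda>a. [a, b]) ` nb b)"
  proof
    fix ys assume ys: "ys \<in> path_lists A V 2"
    then obtain a b where e: "ys = [a, b]" by (auto simp: path_lists_def numeral_2_eq_2 length_Suc_conv)
    then have "b \<in> V" "a \<in> nb b" using ys sym by (auto simp: path_lists_def nb_def)
    then show "ys \<in> (\<Union>b\<in>V. (\<lambda>a. [a, b]) ` nb b)" unfolding e by blast
  qed
  have "card (path_lists A V 2) \<le> card (\<Union>b\<in>V. (\<lambda>a. [a, b]) ` nb b)"
    by (rule card_mono[OF _ sub]) (use fin in auto)
  also have "\<dots> \<le> (\<Sum>b\<in>V. card ((\<lambda>a. [a, b]) ` nb b))" by (rule card_UN_le[OF fin])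
  also have "\<dots> \<le> degsum" unfolding degsum_def deg_def by (intro sum_mono card_image_le) simp
  finally show ?thesis .
qed

text \<open>The sum of the squared degrees occurs on both sides of the summed two-step bound; this
  keeps a factor \<open>degsum\<close> on the right, so that many paths force many edges also for odd
  \<open>t\<close>.\<close>

lemma path_lists_3:
  assumes "cycle_free (Suc (Suc k))"
  shows "real (card (path_lists A V 3)) \<le> (real (card V) + 2 * real k) * real degsum / 2"
proof -
  let ?S = "\<Sum>v\<in>V. deg v * deg v"
  have sub: "path_lists A V 3 \<subseteq> (\<Union>b\<in>V. (\<lambda>(a, c). [a, b, c]) ` (nb b \<times> nb b))"
  proof
    fix ys assume ys: "ys \<in> path_lists A V 3"
    then obtain a b c where e: "ys = [a, b, c]" by (auto simp: path_lists_def numeral_3_eq_3 length_Suc_conv)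
    then have "b \<in> V" "(a, c) \<in> nb b \<times> nb b" using ys sym by (auto simp: path_lists_def nb_def)
    then show "ys \<in> (\<Union>b\<in>V. (\<lambda>(a, c). [a, b, c]) ` (nb b \<times> nb b))" unfolding e by force
  qed
  have "card (path_lists A V 3) \<le> card (\<Union>b\<in>V. (\<lambda>(a, c). [a, b, c]) ` (nb b \<times> nb b))"
    by (rule card_mono[OF _ sub]) (use fin in auto)
  also have "\<dots> \<le> (\<Sum>b\<in>V. card ((\<lambda>(a, c). [a, b, c]) ` (nb b \<times> nb b)))" by (rule card_UN_le[OF fin])
  also have "\<dots> \<le> (\<Sum>b\<in>V. card (nb b \<times> nb b))" by (intro sum_mono card_image_le) simp
  also have "\<dots> = ?S" by (simp add: deg_def card_cartesian_product)
  finally have c: "card (path_lists A V 3) \<le> ?S" .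
  have "?S = (\<Sum>v\<in>V. \<Sum>u\<in>nb v. deg u)" by (rule sum_nb_swap[symmetric])
  also have "\<dots> \<le> (\<Sum>v\<in>V. 2 * k * deg v + deg v * (card V - deg v))"
    by (intro sum_mono two_step_bound[OF assms])
  finally have "?S + ?S \<le> (\<Sum>v\<in>V. 2 * k * deg v + deg v * (card V - deg v)) + ?S" by simp
  also have "\<dots> = (\<Sum>v\<in>V. (card V + 2 * k) * deg v)"
    unfolding sum.distrib[symmetric]
  proof (rule sum.cong[OF refl])
    fix v
    have "deg v * (card V - deg v) + deg v * deg v = deg v * card V"
      using deg_le[of v] by (simp add: diff_mult_distrib2)
    then show "2 * k * deg v + deg v * (card V - deg v) + deg v * deg v = (card V + 2 * k) * deg v"
      by (simp add: algebra_simps)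
  qed
  also have "\<dots> = (card V + 2 * k) * degsum" by (simp add: degsum_def sum_distrib_left)
  finally have "2 * card (path_lists A V 3) \<le> (card V + 2 * k) * degsum" using c by linarith
  then have "real (2 * card (path_lists A V 3)) \<le> real ((card V + 2 * k) * degsum)" by (simp only: of_nat_le_iff)
  then show ?thesis by simp
qed

lemma two_step_cap_nonneg: "0 \<le> two_step_cap k"
  by (simp add: two_step_cap_def)

lemma path_lists_bound:
  assumes "cycle_free (Suc (Suc k))"
  shows "real (card (path_lists A V (2 * h + 2))) \<le> two_step_cap k ^ h * real degsum"
    and "real (card (path_lists A V (2 * h + 3))) \<le> two_step_cap k ^ h * ((real (card V) + 2 * real k) * real degsum / 2)"
proof -
  show "real (card (path_lists A V (2 * h + 2))) \<le> two_step_cap k ^ h * real degsum"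
  proof (induction h)
    case 0
    show ?case using path_lists_2 by (simp add: numeral_2_eq_2)
  next
    case (Suc h)
    have "real (card (path_lists A V (2 * Suc h + 2))) \<le> two_step_cap k * real (card (path_lists A V (2 * h + 2)))"
      using path_lists_two_more[OF assms, of "2 * h + 2"] by simp
    also have "\<dots> \<le> two_step_cap k * (two_step_cap k ^ h * real degsum)" by (rule mult_left_mono[OF Suc.IH two_step_cap_nonneg])
    finally show ?case by (simp add: mult.assoc)
  qed
  show "real (card (path_lists A V (2 * h + 3))) \<le> two_step_cap k ^ h * ((real (card V) + 2 * real k) * real degsum / 2)"
  proof (induction h)
    case 0
    show ?case using path_lists_3[OF assms] by (simp add: numeral_3_eq_3)
  next
    case (Suc h)
    have "real (card (path_lists A V (2 * Suc h + 3))) \<le> two_step_cap k * real (card (path_lists A V (2 * h + 3)))"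
      using path_lists_two_more[OF assms, of "2 * h + 3"] by simp
    also have "\<dots> \<le> two_step_cap k * (two_step_cap k ^ h * ((real (card V) + 2 * real k) * real degsum / 2))"
      by (rule mult_left_mono[OF Suc.IH two_step_cap_nonneg])
    finally show ?case by (simp add: mult.assoc)
  qed
qed

definition missing :: "'a set \<Rightarrow> 'a set \<Rightarrow> ('a \<times> 'a) set" where
  "missing X Y = {(x, y). x \<in> X \<and> y \<in> Y \<and> \<not> A x y}"

text \<open>Take the neighbourhood \<open>X\<close> of a vertex of maximum degree. It spans few edges, and the
  degrees in its complement \<open>Y\<close> add up to at most \<open>card X * card Y\<close>. Since \<open>card X * card Y\<close>
  is at most \<open>n\<^sup>2/4\<close>, a nearly maximal degree sum makes both the number of missing pairs
  small and the parts nearly equal.\<close>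

lemma missing_partition:
  assumes cf: "cycle_free (Suc (Suc k))" and ne: "V \<noteq> {}"
  shows "\<exists>X Y. X \<union> Y = V \<and> X \<inter> Y = {} \<and>
    card (missing X Y) + degsum \<le> 2 * card X * card Y + 2 * k * card V"
proof -
  obtain x where x: "x \<in> V" "\<And>v. v \<in> V \<Longrightarrow> deg v \<le> deg x"
  proof -
    have "Max (deg ` V) \<in> deg ` V" using ne fin by (intro Max_in) auto
    then obtain x where "x \<in> V" "deg x = Max (deg ` V)" by force
    then show ?thesis using that[of x] fin by simp
  qed
  define X where "X = nb x"
  define Y where "Y = V - nb x"
  have fX: "finite X" and fY: "finite Y" using fin by (auto simp: X_def Y_def)
  have U: "X \<union> Y = V" "X \<inter> Y = {}" using nb_subset by (auto simp: X_def Y_def)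
  have s1: "(\<Sum>y\<in>Y. deg y) \<le> card Y * card X"
  proof -
    have "(\<Sum>y\<in>Y. deg y) \<le> (\<Sum>y\<in>Y. deg x)" by (intro sum_mono x(2)) (auto simp: Y_def)
    then show ?thesis by (simp add: X_def deg_def)
  qed
  have s2: "(\<Sum>u\<in>X. deg u) = (\<Sum>u\<in>X. card (nb u \<inter> X)) + (\<Sum>u\<in>X. card (nb u \<inter> Y))"
    unfolding sum.distrib[symmetric]
  proof (rule sum.cong[OF refl])
    fix u
    have "nb u = (nb u \<inter> X) \<union> (nb u \<inter> Y)" using U nb_subset by blast
    moreover have "(nb u \<inter> X) \<inter> (nb u \<inter> Y) = {}" using U by blast
    ultimately show "deg u = card (nb u \<inter> X) + card (nb u \<inter> Y)"
      unfolding deg_def by (metis card_Un_disjoint finite_Int finite_nb)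
  qed
  have s3: "(\<Sum>u\<in>X. card (nb u \<inter> X)) \<le> 2 * k * card V"
  proof -
    have "(\<Sum>u\<in>X. card (nb u \<inter> X)) \<le> 2 * k * deg x" using nb_degree_sum[OF cf, of x] by (simp add: X_def)
    also have "\<dots> \<le> 2 * k * card V" using deg_le by simp
    finally show ?thesis .
  qed
  have s4: "(\<Sum>u\<in>X. card (nb u \<inter> Y)) + card (missing X Y) = card X * card Y"
  proof -
    have "missing X Y = (SIGMA u:X. Y - nb u)" by (auto simp: missing_def nb_def)
    then have "card (missing X Y) = (\<Sum>u\<in>X. card (Y - nb u))" using fX fY by simp
    then have "(\<Sum>u\<in>X. card (nb u \<inter> Y)) + card (missing X Y) = (\<Sum>u\<in>X. card (nb u \<inter> Y) + card (Y - nb u))"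
      by (simp add: sum.distrib)
    also have "\<dots> = (\<Sum>u\<in>X. card Y)"
    proof (rule sum.cong[OF refl])
      fix u
      have "card ((nb u \<inter> Y) \<union> (Y - nb u)) = card (nb u \<inter> Y) + card (Y - nb u)"
        by (rule card_Un_disjoint) (use fY in auto)
      moreover have "(nb u \<inter> Y) \<union> (Y - nb u) = Y" by blast
      ultimately show "card (nb u \<inter> Y) + card (Y - nb u) = card Y" by simp
    qed
    finally show ?thesis by simp
  qed
  have ds: "degsum = (\<Sum>u\<in>X. deg u) + (\<Sum>y\<in>Y. deg y)"
    using sum.union_disjoint[OF fX fY U(2), of deg] unfolding U(1) degsum_def .
  have "card (missing X Y) + degsum \<le> 2 * card X * card Y + 2 * k * card V"
  proof -
    have "2 * card X * card Y = card X * card Y + card Y * card X" by simp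
    then show ?thesis using ds s1 s2 s3 s4 by linarith
  qed
  then show ?thesis using U by (intro exI[of _ X] exI[of _ Y] conjI)
qed

end

text \<open>The limit form of dividing the lower bound \<open>2 (n/2 - c)\<^sup>t\<close> by the upper bounds of
  \<open>path_lists_bound\<close>; both parities of \<open>t\<close> give the limit \<open>1/2\<close>.\<close>

lemma degsum_asymptotics:
  fixes c \<delta> :: real and k h t :: nat
  assumes d: "\<delta> > 0"
  defines "q \<equiv> \<lambda>n::nat. real n ^ 2 / 4 + 2 * real k * real n"
  shows "\<exists>n0. \<forall>n\<ge>n0. \<forall>D.
     (2 * (real n / 2 - c) ^ (2 * h + 2) \<le> q n ^ h * D \<longrightarrow> (1/2 - \<delta>) * real n ^ 2 \<le> D) \<and>
     (2 * (real n / 2 - c) ^ (2 * h + 3) \<le> q n ^ h * ((real n + 2 * real k) * D / 2) \<longrightarrow> (1/2 - \<delta>) * real n ^ 2 \<le> D)"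
proof -
  define x where "x = (\<lambda>n::nat. 1/2 - c / real n)"
  define y where "y = (\<lambda>n::nat. 1/4 + 2 * real k / real n)"
  define z where "z = (\<lambda>n::nat. 1 + 2 * real k / real n)"
  have lx: "x \<longlonglongrightarrow> 1/2" unfolding x_def by (rule tendsto_eq_intros lim_const_over_n refl | simp)+
  have ly: "y \<longlonglongrightarrow> 1/4" unfolding y_def by (rule tendsto_eq_intros lim_const_over_n refl | simp)+
  have lz: "z \<longlonglongrightarrow> 1" unfolding z_def by (rule tendsto_eq_intros lim_const_over_n refl | simp)+
  have p4: "(1/2::real) ^ (2 * h) = (1/4) ^ h" by (simp add: power_mult power2_eq_square)
  have "(\<lambda>n. 2 * x n ^ (2 * h + 2) / y n ^ h) \<longlonglongrightarrow> 2 * (1/2) ^ (2 * h + 2) / (1/4) ^ h"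
    by (intro tendsto_intros lx ly) simp
  also have "2 * (1/2::real) ^ (2 * h + 2) / (1/4) ^ h = 1/2"
    unfolding power_add p4 by (simp add: power2_eq_square)
  finally have l1: "(\<lambda>n. 2 * x n ^ (2 * h + 2) / y n ^ h) \<longlonglongrightarrow> 1/2" .
  have "(\<lambda>n. 4 * x n ^ (2 * h + 3) / (y n ^ h * z n)) \<longlonglongrightarrow> 4 * (1/2) ^ (2 * h + 3) / ((1/4) ^ h * 1)"
    by (intro tendsto_intros lx ly lz) simp
  also have "4 * (1/2::real) ^ (2 * h + 3) / ((1/4) ^ h * 1) = 1/2"
    unfolding power_add p4 by (simp add: power3_eq_cube)
  finally have l2: "(\<lambda>n. 4 * x n ^ (2 * h + 3) / (y n ^ h * z n)) \<longlonglongrightarrow> 1/2" .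
  have "eventually (\<lambda>n. 2 * x n ^ (2 * h + 2) / y n ^ h > 1/2 - \<delta>) sequentially"
    using l1 d by (intro order_tendstoD(1)) auto
  moreover have "eventually (\<lambda>n. 4 * x n ^ (2 * h + 3) / (y n ^ h * z n) > 1/2 - \<delta>) sequentially"
    using l2 d by (intro order_tendstoD(1)) auto
  ultimately have "eventually (\<lambda>n. 2 * x n ^ (2 * h + 2) / y n ^ h > 1/2 - \<delta> \<and>
      4 * x n ^ (2 * h + 3) / (y n ^ h * z n) > 1/2 - \<delta>) sequentially"
    by (rule eventually_conj)
  then obtain n1 where n1: "\<And>n. n \<ge> n1 \<Longrightarrow> 2 * x n ^ (2 * h + 2) / y n ^ h > 1/2 - \<delta> \<and>
      4 * x n ^ (2 * h + 3) / (y n ^ h * z n) > 1/2 - \<delta>"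
    by (auto simp: eventually_sequentially)
  show ?thesis
  proof (intro exI[of _ "max n1 1"] allI impI conjI)
    fix n :: nat and D :: real
    assume n: "max n1 1 \<le> n"
    define r where "r = real n"
    have r0: "r > 0" using n by (simp add: r_def)
    have ex: "r / 2 - c = r * x n" and ey: "q n = r ^ 2 * y n" and ez: "r + 2 * real k = r * z n"
      using r0 by (simp_all add: x_def y_def z_def q_def r_def power2_eq_square field_simps)
    have y0: "y n > 0" and z0: "z n > 0" using r0 by (simp_all add: y_def z_def r_def add_pos_nonneg)
    have pw: "(r ^ 2 * y n) ^ h = r ^ (2 * h) * y n ^ h" by (simp add: power_mult_distrib power_mult)
    have qh: "q n ^ h = r ^ (2 * h) * y n ^ h" unfolding ey by (rule pw)
    have xh: "(real n / 2 - c) ^ (2 * h + i) = r ^ (2 * h) * r ^ i * x n ^ (2 * h + i)" for i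
      unfolding r_def[symmetric] ex power_mult_distrib power_add by simp
    have rh: "r ^ (2 * h) > 0" using r0 by simp
    {
      assume "2 * (real n / 2 - c) ^ (2 * h + 2) \<le> q n ^ h * D"
      then have "2 * (r ^ (2 * h) * r ^ 2 * x n ^ (2 * h + 2)) \<le> r ^ (2 * h) * y n ^ h * D"
        unfolding xh qh by simp
      then have "r ^ (2 * h) * (2 * r ^ 2 * x n ^ (2 * h + 2)) \<le> r ^ (2 * h) * (y n ^ h * D)" by (simp add: mult_ac)
      then have "2 * r ^ 2 * x n ^ (2 * h + 2) \<le> y n ^ h * D" using rh by simp
      then have "r ^ 2 * (2 * x n ^ (2 * h + 2) / y n ^ h) \<le> D" using y0 by (simp add: field_simps)
      moreover have "r ^ 2 * (1/2 - \<delta>) \<le> r ^ 2 * (2 * x n ^ (2 * h + 2) / y n ^ h)"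
        using n1[of n] n by (intro mult_left_mono) auto
      ultimately show "(1/2 - \<delta>) * real n ^ 2 \<le> D" by (simp add: r_def mult.commute)
    }
    {
      assume "2 * (real n / 2 - c) ^ (2 * h + 3) \<le> q n ^ h * ((real n + 2 * real k) * D / 2)"
      then have "2 * (r ^ (2 * h) * r ^ 3 * x n ^ (2 * h + 3)) \<le> r ^ (2 * h) * y n ^ h * (r * z n * D / 2)"
        unfolding xh qh ez[unfolded r_def] r_def by simp
      then have "r ^ (2 * h) * (r * (4 * r ^ 2 * x n ^ (2 * h + 3))) \<le> r ^ (2 * h) * (r * (y n ^ h * z n * D))"
        by (simp add: mult_ac power2_eq_square power3_eq_cube)
      then have "4 * r ^ 2 * x n ^ (2 * h + 3) \<le> y n ^ h * z n * D" using rh r0 by simp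
      then have "r ^ 2 * (4 * x n ^ (2 * h + 3) / (y n ^ h * z n)) \<le> D" using y0 z0 by (simp add: field_simps)
      moreover have "r ^ 2 * (1/2 - \<delta>) \<le> r ^ 2 * (4 * x n ^ (2 * h + 3) / (y n ^ h * z n))"
        using n1[of n] n by (intro mult_left_mono) auto
      ultimately show "(1/2 - \<delta>) * real n ^ 2 \<le> D" by (simp add: r_def mult.commute)
    }
  qed
qed

section \<open>A robust bipartite core\<close>

lemma exists_outside:
  assumes "finite S" "finite Z" "card (S - T) + card Z < card S"
  shows "\<exists>w\<in>S \<inter> T. w \<notin> Z"
proof (rule ccontr)
  assume "\<not> ?thesis"
  then have "S \<subseteq> (S - T) \<union> Z" by blast
  then have "card S \<le> card ((S - T) \<union> Z)" using assms by (intro card_mono) auto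
  also have "\<dots> \<le> card (S - T) + card Z" by (rule card_Un_le)
  finally show False using assms by simp
qed

context fin_graph
begin

definition side :: "'a set \<Rightarrow> 'a set \<Rightarrow> bool \<Rightarrow> 'a set" where
  "side X Y s = (if s then X else Y)"

text \<open>Each vertex of one side is adjacent to all but at most \<open>a\<close> vertices of the other.\<close>

definition robust :: "'a set \<Rightarrow> 'a set \<Rightarrow> nat \<Rightarrow> bool" where
  "robust X Y a \<longleftrightarrow> X \<subseteq> V \<and> Y \<subseteq> V \<and> (\<forall>x\<in>X. card (Y - nb x) \<le> a) \<and> (\<forall>y\<in>Y. card (X - nb y) \<le> a)"

lemma robust_side:
  assumes "robust X Y a" "z \<in> side X Y s"
  shows "card (side X Y (\<not> s) - nb z) \<le> a"
  using assms by (auto simp: robust_def side_def split: if_splits)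

lemma finite_side: "robust X Y a \<Longrightarrow> finite (side X Y s)"
  using fin finite_subset by (auto simp: robust_def side_def)

text \<open>All vertices but the last are chosen arbitrarily on alternating sides. The last one
  must in addition be a neighbour of the target \<open>v\<close>; this is possible because \<open>v\<close> has more
  than \<open>a\<close> neighbours on the side where the path arrives.\<close>

lemma greedy_path:
  assumes rb: "robust X Y a"
  shows "z \<in> side X Y s \<Longrightarrow> finite Z \<Longrightarrow> j \<ge> 1 \<Longrightarrow>
    (\<And>s'. a + card Z + j < card (side X Y s')) \<Longrightarrow>
    a + card Z + j < card (nb v \<inter> side X Y (s = even j)) \<Longrightarrow>
    \<exists>zs. length zs = j \<and> distinct zs \<and> set zs \<subseteq> X \<union> Y \<and> set zs \<inter> Z = {} \<and>
      successively A (z # zs) \<and> A (last zs) v"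
proof (induction j arbitrary: z s Z)
  case (Suc j)
  show ?case
  proof (cases "j = 0")
    case True
    let ?S = "nb v \<inter> side X Y (\<not> s)"
    have fS: "finite ?S" by simp
    have "card (?S - nb z) \<le> card (side X Y (\<not> s) - nb z)"
      using finite_side[OF rb] by (intro card_mono) auto
    also have "\<dots> \<le> a" by (rule robust_side[OF rb Suc.prems(1)])
    finally have "card (?S - nb z) + card Z < card ?S" using Suc.prems(5) True by simp
    then obtain w where w: "w \<in> ?S \<inter> nb z" "w \<notin> Z" using exists_outside[OF fS Suc.prems(2)] by blast
    have "w \<in> X \<union> Y" using w by (auto simp: side_def split: if_splits)
    then show ?thesis using w True sym
      by (intro exI[of _ "[w]"]) (auto simp: nb_def)
  next
    case False
    let ?S = "side X Y (\<not> s)"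
    have "card (?S - nb z) + card Z < card ?S"
      using robust_side[OF rb Suc.prems(1)] Suc.prems(4)[of "\<not> s"] by linarith
    then obtain w where w: "w \<in> ?S \<inter> nb z" "w \<notin> Z" using exists_outside[OF finite_side[OF rb] Suc.prems(2)] by blast
    have c: "card (insert w Z) = Suc (card Z)" using w Suc.prems(2) by simp
    have "\<exists>zs. length zs = j \<and> distinct zs \<and> set zs \<subseteq> X \<union> Y \<and> set zs \<inter> insert w Z = {} \<and>
      successively A (w # zs) \<and> A (last zs) v"
    proof (rule Suc.IH)
      show "w \<in> side X Y (\<not> s)" using w by blast
      show "a + card (insert w Z) + j < card (side X Y s')" for s' using Suc.prems(4)[of s'] c by simp
      have "((\<not> s) = even j) = (s = even (Suc j))" by auto
      then show "a + card (insert w Z) + j < card (nb v \<inter> side X Y ((\<not> s) = even j))"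
        using Suc.prems(5) c by simp
    qed (use Suc.prems False in auto)
    then obtain zs where zs: "length zs = j" "distinct zs" "set zs \<subseteq> X \<union> Y" "set zs \<inter> insert w Z = {}"
      "successively A (w # zs)" "A (last zs) v" by blast
    have "w \<in> X \<union> Y" using w by (auto simp: side_def split: if_splits)
    moreover have "zs \<noteq> []" using zs(1) False by auto
    ultimately show ?thesis using zs w
      by (intro exI[of _ "w # zs"]) (auto simp: nb_def)
  qed
qed simp

text \<open>The case \<open>u = v\<close> is included: it yields a cycle through a vertex that has many
  neighbours on both sides.\<close>

lemma robust_connect:
  assumes rb: "robust X Y a" and k: "2 \<le> k" "k \<le> N" and par: "odd k \<longleftrightarrow> su = sv"
    and bd: "\<And>s. a + N + 3 < card (side X Y s)"
    and u: "a + N + 3 < card (nb u \<inter> side X Y su)" and v: "a + N + 3 < card (nb v \<inter> side X Y sv)"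
  shows "\<exists>zs. zs \<noteq> [] \<and> length zs = k \<and> distinct zs \<and> set zs \<subseteq> (X \<union> Y) - {u, v} \<and> successively A zs \<and>
    A u (hd zs) \<and> A (last zs) v"
proof -
  let ?S = "nb u \<inter> side X Y su"
  have cuv: "card {u, v} \<le> 2" by (simp add: card_insert_if)
  have "card (?S - UNIV) + card {u, v} < card ?S" using u cuv by simp
  then obtain w where w: "w \<in> ?S" "w \<notin> {u, v}"
    using exists_outside[of ?S "{u, v}" UNIV] by auto
  have cz: "card {w, u, v} \<le> 3" by (simp add: card_insert_if)
  have "\<exists>zs. length zs = k - 1 \<and> distinct zs \<and> set zs \<subseteq> X \<union> Y \<and> set zs \<inter> {w, u, v} = {} \<and>
      successively A (w # zs) \<and> A (last zs) v"
  proof (rule greedy_path[OF rb])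
    show "w \<in> side X Y su" using w by blast
    show "a + card {w, u, v} + (k - 1) < card (side X Y s')" for s'
      using bd[of s'] cz k by linarith
    have "(su = even (k - 1)) = sv" using par k by (cases k) auto
    then show "a + card {w, u, v} + (k - 1) < card (nb v \<inter> side X Y (su = even (k - 1)))"
      using v cz k by simp
  qed (use k in auto)
  then obtain zs where zs: "length zs = k - 1" "distinct zs" "set zs \<subseteq> X \<union> Y" "set zs \<inter> {w, u, v} = {}"
      "successively A (w # zs)" "A (last zs) v" by blast
  have "w \<in> X \<union> Y" using w by (auto simp: side_def split: if_splits)
  moreover have "zs \<noteq> []" using zs(1) k by auto
  ultimately show ?thesis using zs w k
    by (intro exI[of _ "w # zs"]) (auto simp: nb_def)
qed

lemma core_size:
  assumes "finite X" "finite Y"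
  shows "card {x \<in> X. \<not> card (Y - nb x) \<le> a} * a \<le> card (missing X Y)"
proof -
  let ?B = "{x \<in> X. \<not> card (Y - nb x) \<le> a}"
  have "card ?B * a = (\<Sum>x\<in>?B. a)" by simp
  also have "\<dots> \<le> (\<Sum>x\<in>?B. card (Y - nb x))" by (rule sum_mono) auto
  also have "\<dots> = card (SIGMA x:?B. Y - nb x)" using assms by simp
  also have "\<dots> \<le> card (missing X Y)"
  proof (rule card_mono)
    show "finite (missing X Y)" by (rule finite_subset[of _ "X \<times> Y"]) (use assms in \<open>auto simp: missing_def\<close>)
    show "(SIGMA x:?B. Y - nb x) \<subseteq> missing X Y" by (auto simp: missing_def nb_def)
  qed
  finally show ?thesis .
qed

lemma card_missing_swap: "card (missing X Y) = card (missing Y X)"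
proof -
  have "missing Y X = prod.swap ` missing X Y" using sym by (force simp: missing_def)
  then show ?thesis by (simp add: card_image)
qed

text \<open>A vertex of \<open>M\<close> has many neighbours on exactly one side of the core: on some side by
  its degree, and not on both because of \<open>cycle_free\<close>. Its colour records this side. Paths
  start and end on the sides seen by their end vertices, so parities match the colours; two
  inner vertices are needed because two vertices of small degree may have no common
  neighbour, whence the bound 4.\<close>

lemma core_linked:
  assumes cf: "cycle_free N" and N: "odd N" "N \<ge> 5"
    and rb: "robust X Y a" and b: "a + N + 3 < b"
    and d: "2 * b + card (V - (X \<union> Y)) \<le> d" "d + a \<le> card X" "d + a \<le> card Y"
  defines "M \<equiv> {v \<in> V. d \<le> deg v}" and "c \<equiv> \<lambda>v. b \<le> card (nb v \<inter> X)"
  shows "linked N M 4 c" "X \<subseteq> {v \<in> M. \<not> c v}" "Y \<subseteq> {v \<in> M. c v}"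
proof -
  have sd: "side X Y True = X" "side X Y False = Y" by (simp_all add: side_def)
  have bd: "a + N + 3 < card (side X Y s)" for s
    using b d by (cases s) (simp_all add: side_def)
  have excl: "card (nb v \<inter> Y) < b" if "c v" for v
  proof (rule ccontr)
    assume "\<not> ?thesis"
    then have "a + N + 3 < card (nb v \<inter> side X Y True)" "a + N + 3 < card (nb v \<inter> side X Y False)"
      using that b by (simp_all add: sd c_def)
    moreover have "2 \<le> N - 1" "N - 1 \<le> N" "odd (N - 1) \<longleftrightarrow> True = False" using N by auto
    ultimately obtain zs where zs: "zs \<noteq> []" "length zs = N - 1" "distinct zs" "set zs \<subseteq> (X \<union> Y) - {v, v}"
      "successively A zs" "A v (hd zs)" "A (last zs) v"
      using robust_connect[OF rb _ _ _ bd, of "N - 1" True False v v] by blast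
    have "X \<union> Y \<subseteq> V" using rb by (simp add: robust_def)
    then have "length (v # zs) = N" "distinct (v # zs)" "set (v # zs) \<subseteq> V" "successively A (v # zs)"
      "A (last (v # zs)) (hd (v # zs))"
      using zs N dom[OF zs(6)] by (auto simp: successively_Cons)
    then show False using cf unfolding cycle_free_def by blast
  qed
  have sees: "b \<le> card (nb v \<inter> side X Y (c v))" if "v \<in> M" for v
  proof (cases "c v")
    case True
    then show ?thesis by (simp add: sd c_def)
  next
    case False
    have "nb v \<subseteq> (nb v \<inter> X) \<union> (nb v \<inter> Y) \<union> (V - (X \<union> Y))" using nb_subset by blast
    then have "deg v \<le> card ((nb v \<inter> X) \<union> (nb v \<inter> Y) \<union> (V - (X \<union> Y)))"
      unfolding deg_def by (rule card_mono[rotated]) (simp add: fin)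
    also have "\<dots> \<le> card (nb v \<inter> X) + card (nb v \<inter> Y) + card (V - (X \<union> Y))"
      by (meson add_le_mono card_Un_le le_refl le_trans)
    finally have "2 * b \<le> card (nb v \<inter> X) + card (nb v \<inter> Y)" using that d(1) by (simp add: M_def)
    then show ?thesis using False by (simp add: sd c_def)
  qed
  have XYV: "X \<subseteq> V" "Y \<subseteq> V" using rb by (simp_all add: robust_def)
  have fXY: "finite X" "finite Y" using XYV fin finite_subset by blast+
  have xdeg: "d \<le> card (nb x \<inter> Y)" if "x \<in> X" for x
  proof -
    have "card (Y - nb x) \<le> a" using rb that by (simp add: robust_def)
    moreover have "card Y = card (nb x \<inter> Y) + card (Y - nb x)"
      using card_Diff_subset_Int[of Y "nb x"] card_mono[of Y "nb x \<inter> Y"] fXY by (simp add: Int_commute)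
    ultimately show ?thesis using d by linarith
  qed
  have ydeg: "d \<le> card (nb y \<inter> X)" if "y \<in> Y" for y
  proof -
    have "card (X - nb y) \<le> a" using rb that by (simp add: robust_def)
    moreover have "card X = card (nb y \<inter> X) + card (X - nb y)"
      using card_Diff_subset_Int[of X "nb y"] card_mono[of X "nb y \<inter> X"] fXY by (simp add: Int_commute)
    ultimately show ?thesis using d by linarith
  qed
  have le: "card (nb v \<inter> S) \<le> deg v" for v S unfolding deg_def by (rule card_mono) auto
  have XM: "X \<subseteq> M" "Y \<subseteq> M" using xdeg ydeg le XYV unfolding M_def by (force intro: order_trans)+
  show "Y \<subseteq> {v \<in> M. c v}" using XM ydeg d unfolding c_def by force
  show "X \<subseteq> {v \<in> M. \<not> c v}" using XM xdeg d excl by force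
  show "linked N M 4 c"
    unfolding linked_def
  proof (intro ballI allI impI)
    fix u v m assume u: "u \<in> M" and v: "v \<in> M" and ne: "u \<noteq> v" and m: "4 \<le> m" "m \<le> N"
      and p: "odd m \<longleftrightarrow> c u = c v"
    obtain zs where zs: "zs \<noteq> []" "length zs = m - 2" "distinct zs" "set zs \<subseteq> (X \<union> Y) - {u, v}"
      "successively A zs" "A u (hd zs)" "A (last zs) v"
    proof -
      have "2 \<le> m - 2" "m - 2 \<le> N" "odd (m - 2) \<longleftrightarrow> c u = c v" using m p by auto
      moreover have "a + N + 3 < card (nb u \<inter> side X Y (c u))" "a + N + 3 < card (nb v \<inter> side X Y (c v))"
        using sees[OF u] sees[OF v] b by linarith+
      ultimately show ?thesis using robust_connect[OF rb _ _ _ bd, of "m - 2" "c u" "c v" u v] that by blast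
    qed
    let ?p = "u # zs @ [v]"
    have "length ?p = m" "distinct ?p" "set ?p \<subseteq> M" "successively A ?p" "hd ?p = u" "last ?p = v"
      using zs m ne u v XM by (auto simp: successively_Cons successively_append_iff)
    then show "path_between M u v m" unfolding path_between_def by (intro exI[of _ ?p] conjI) simp_all
  qed
qed

end

section \<open>Upper bounds for the number of path lists\<close>

text \<open>Each entry forced into \<open>Z\<close> costs a factor of order \<open>card V\<close>. The inequality is
  multiplied out to avoid subtraction in the exponent.\<close>

lemma card_lists_with_many_in:
  assumes fV: "finite V" and Z: "Z \<subseteq> V"
  shows "card {xs. length xs = t \<and> set xs \<subseteq> V \<and> k \<le> length (filter (\<lambda>x. x \<in> Z) xs)} * card V ^ k
    \<le> 2 ^ t * card Z ^ k * card V ^ t"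
proof (induction t arbitrary: k)
  case 0
  show ?case
  proof (cases k)
    case 0
    have "{xs. length xs = 0 \<and> set xs \<subseteq> V \<and> 0 \<le> length (filter (\<lambda>x. x \<in> Z) xs)} = {[]}" by auto
    then show ?thesis using 0 by simp
  next
    case (Suc k')
    have "{xs. length xs = 0 \<and> set xs \<subseteq> V \<and> k \<le> length (filter (\<lambda>x. x \<in> Z) xs)} = {}" using Suc by auto
    then show ?thesis by (metis card.empty mult_0 zero_le)
  qed
next
  case (Suc t)
  define S where "S = (\<lambda>t k. {xs. length xs = t \<and> set xs \<subseteq> V \<and> k \<le> length (filter (\<lambda>x. x \<in> Z) xs)})"
  have fS: "finite (S t k)" for t k
    by (rule finite_subset[OF _ finite_lists_length_eq[OF fV, of t]]) (auto simp: S_def)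
  have IH: "card (S t k) * card V ^ k \<le> 2 ^ t * card Z ^ k * card V ^ t" for k
    using Suc.IH[of k] by (simp add: S_def)
  have fZ: "finite Z" using fV Z finite_subset by blast
  have "card (S (Suc t) k) * card V ^ k \<le> 2 ^ Suc t * card Z ^ k * card V ^ Suc t"
  proof (cases k)
    case 0
    have "card (S (Suc t) k) \<le> card {xs. set xs \<subseteq> V \<and> length xs = Suc t}"
      by (rule card_mono) (auto simp: S_def finite_lists_length_eq[OF fV])
    also have "\<dots> = card V ^ Suc t" by (rule card_lists_length_eq[OF fV])
    also have "\<dots> \<le> 2 ^ Suc t * card V ^ Suc t" by simp
    finally show ?thesis using 0 by simp
  next
    case (Suc j)
    have "S (Suc t) k \<subseteq> (\<lambda>(x, xs). x # xs) ` (Z \<times> S t j) \<union> (\<lambda>(x, xs). x # xs) ` (V \<times> S t k)"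
    proof
      fix ys assume ys: "ys \<in> S (Suc t) k"
      then obtain x xs where e: "ys = x # xs" by (auto simp: S_def length_Suc_conv)
      show "ys \<in> (\<lambda>(x, xs). x # xs) ` (Z \<times> S t j) \<union> (\<lambda>(x, xs). x # xs) ` (V \<times> S t k)"
      proof (cases "x \<in> Z")
        case True
        then have "(x, xs) \<in> Z \<times> S t j" using ys e Suc by (auto simp: S_def)
        then show ?thesis unfolding e by force
      next
        case False
        then have "(x, xs) \<in> V \<times> S t k" using ys e Suc by (auto simp: S_def)
        then show ?thesis unfolding e by force
      qed
    qed
    then have "card (S (Suc t) k) \<le> card ((\<lambda>(x, xs). x # xs) ` (Z \<times> S t j) \<union> (\<lambda>(x, xs). x # xs) ` (V \<times> S t k))"
      by (rule card_mono[rotated]) (use fS fZ fV in auto)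
    also have "\<dots> \<le> card ((\<lambda>(x, xs). x # xs) ` (Z \<times> S t j)) + card ((\<lambda>(x, xs). x # xs) ` (V \<times> S t k))"
      by (rule card_Un_le)
    also have "\<dots> \<le> card (Z \<times> S t j) + card (V \<times> S t k)"
      by (intro add_mono card_image_le) (use fS fZ fV in auto)
    also have "\<dots> = card Z * card (S t j) + card V * card (S t k)" by (simp add: card_cartesian_product)
    finally have "card (S (Suc t) k) * card V ^ k \<le> (card Z * card (S t j) + card V * card (S t k)) * card V ^ k"
      by (rule mult_le_mono1)
    also have "\<dots> = card Z * card V * (card (S t j) * card V ^ j) + card V * (card (S t k) * card V ^ k)"
      using Suc by (simp add: algebra_simps)
    also have "\<dots> \<le> card Z * card V * (2 ^ t * card Z ^ j * card V ^ t) + card V * (2 ^ t * card Z ^ k * card V ^ t)"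
      by (intro add_mono mult_le_mono2 IH)
    also have "\<dots> = 2 ^ Suc t * card Z ^ k * card V ^ Suc t" using Suc by (simp add: algebra_simps)
    finally show ?thesis .
  qed
  then show ?case by (simp add: S_def)
qed

context fin_graph
begin

text \<open>A list through a vertex of small degree contains an edge at that vertex, at one of
  fewer than \<open>t\<close> positions and in one of two directions; all other entries are free.\<close>

lemma low_vertex_count:
  assumes t: "t \<ge> 2" and M: "M \<subseteq> V" and d: "\<And>v. v \<in> V - M \<Longrightarrow> deg v \<le> d"
  shows "card (path_lists A V t) \<le> card (path_lists A M t) + 2 * t * card (V - M) * d * card V ^ (t - 2)"
proof -
  define S where "S = (SIGMA v:V - M. nb v)"
  define W where "W = (\<lambda>i. {xs. set xs \<subseteq> V \<and> length xs = i})"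
  have fW: "finite (W i)" and cW: "card (W i) = card V ^ i" for i
    using finite_lists_length_eq[OF fin] card_lists_length_eq[OF fin] by (auto simp: W_def)
  have fS: "finite S" using fin by (auto simp: S_def)
  have cS: "card S \<le> card (V - M) * d"
  proof -
    have "card S = (\<Sum>v\<in>V - M. deg v)" using fin by (simp add: S_def deg_def)
    also have "\<dots> \<le> (\<Sum>v\<in>V - M. d)" by (intro sum_mono d)
    finally show ?thesis by simp
  qed
  define f where "f = (\<lambda>(as :: 'a list, (v, w), bs). as @ v # w # bs)"
  define g where "g = (\<lambda>(as :: 'a list, (v, w), bs). as @ w # v # bs)"
  define T where "T = (\<lambda>i. W i \<times> S \<times> W (t - 2 - i))"
  have fT: "finite (T i)" for i using fW fS by (simp add: T_def)
  have cT: "card (T i) = card S * card V ^ (t - 2)" if "i \<le> t - 2" for i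
  proof -
    have "card (T i) = card S * (card V ^ i * card V ^ (t - 2 - i))"
      by (simp add: T_def card_cartesian_product cW)
    moreover have "i + (t - 2 - i) = t - 2" using that by simp
    ultimately show ?thesis by (simp only: power_add[symmetric])
  qed
  have sub: "path_lists A V t \<subseteq> path_lists A M t \<union> (\<Union>i\<le>t - 2. f ` T i \<union> g ` T i)"
  proof
    fix xs assume xs: "xs \<in> path_lists A V t"
    show "xs \<in> path_lists A M t \<union> (\<Union>i\<le>t - 2. f ` T i \<union> g ` T i)"
    proof (cases "set xs \<subseteq> M")
      case True
      then show ?thesis using xs by (simp add: path_lists_def)
    next
      case False
      then obtain v where v: "v \<in> set xs" "v \<in> V - M" using xs by (auto simp: path_lists_def)
      then obtain as bs where e: "xs = as @ v # bs" by (meson split_list)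
      show ?thesis
      proof (cases bs)
        case (Cons w bs')
        have "(as, (v, w), bs') \<in> T (length as)"
          using xs v e Cons by (auto simp: T_def W_def S_def path_lists_def nb_def successively_append_iff)
        moreover have "length as \<le> t - 2" using xs e Cons by (auto simp: path_lists_def)
        moreover have "xs = f (as, (v, w), bs')" using e Cons by (simp add: f_def)
        ultimately show ?thesis by blast
      next
        case Nil
        have "as \<noteq> []" using xs e Nil t by (auto simp: path_lists_def)
        then obtain as' w where as: "as = as' @ [w]" by (metis rev_exhaust)
        have "(as', (v, w), []) \<in> T (length as')"
          using xs v e Nil as sym by (auto simp: T_def W_def S_def path_lists_def nb_def successively_append_iff)
        moreover have "length as' \<le> t - 2" using xs e Nil as by (auto simp: path_lists_def)
        moreover have "xs = g (as', (v, w), [])" using e Nil as by (simp add: g_def)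
        ultimately show ?thesis by blast
      qed
    qed
  qed
  have "card (\<Union>i\<le>t - 2. f ` T i \<union> g ` T i) \<le> (\<Sum>i\<le>t - 2. card (f ` T i \<union> g ` T i))"
    by (rule card_UN_le) simp
  also have "\<dots> \<le> (\<Sum>i\<le>t - 2. 2 * (card S * card V ^ (t - 2)))"
  proof (rule sum_mono)
    fix i assume "i \<in> {..t - 2}"
    then have i: "i \<le> t - 2" by simp
    have "card (f ` T i \<union> g ` T i) \<le> card (f ` T i) + card (g ` T i)" by (rule card_Un_le)
    also have "\<dots> \<le> card (T i) + card (T i)" by (intro add_mono card_image_le fT)
    finally show "card (f ` T i \<union> g ` T i) \<le> 2 * (card S * card V ^ (t - 2))" using cT[OF i] by simp
  qed
  also have "\<dots> = Suc (t - 2) * (2 * (card S * card V ^ (t - 2)))" by simp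
  also have "\<dots> \<le> t * (2 * ((card (V - M) * d) * card V ^ (t - 2)))"
    using t cS by (intro mult_le_mono) auto
  finally have b: "card (\<Union>i\<le>t - 2. f ` T i \<union> g ` T i) \<le> 2 * t * card (V - M) * d * card V ^ (t - 2)"
    by (simp add: mult_ac)
  have fM: "finite M" using M fin finite_subset by blast
  have "card (path_lists A V t) \<le> card (path_lists A M t \<union> (\<Union>i\<le>t - 2. f ` T i \<union> g ` T i))"
    by (rule card_mono[OF _ sub]) (use fT finite_path_lists[OF fM] in auto)
  also have "\<dots> \<le> card (path_lists A M t) + card (\<Union>i\<le>t - 2. f ` T i \<union> g ` T i)" by (rule card_Un_le)
  finally show ?thesis using b by linarith
qed

definition independent :: "'a set \<Rightarrow> bool" where
  "independent S \<longleftrightarrow> (\<forall>u\<in>S. \<forall>v\<in>S. \<not> A u v)"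

lemma path_lists_alternate:
  assumes PR: "P \<inter> R = {}" and ind: "independent P" "independent R"
    and xs: "xs \<in> path_lists A (P \<union> R) t"
  shows "xs \<noteq> [] \<Longrightarrow> hd xs \<in> P \<Longrightarrow> xs \<in> alternating_lists P R t"
    and "xs \<noteq> [] \<Longrightarrow> hd xs \<in> R \<Longrightarrow> xs \<in> alternating_lists R P t"
proof -
  have s: "successively (bip P R) xs"
  proof -
    have "successively A xs" "set xs \<subseteq> P \<union> R" using xs by (auto simp: path_lists_def)
    moreover have "bip P R u v" if "A u v" "u \<in> P \<union> R" "v \<in> P \<union> R" for u v
      using that ind by (auto simp: bip_def independent_def)
    ultimately show ?thesis unfolding successively_conv_nth by (simp add: subset_iff)
  qed
  then show "xs \<noteq> [] \<Longrightarrow> hd xs \<in> P \<Longrightarrow> xs \<in> alternating_lists P R t"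
    using xs alternating_lists_iff[OF PR] by (auto simp: path_lists_def)
  have RP: "R \<inter> P = {}" using PR by blast
  show "xs \<noteq> [] \<Longrightarrow> hd xs \<in> R \<Longrightarrow> xs \<in> alternating_lists R P t"
    using s xs alternating_lists_iff[OF RP] by (auto simp: path_lists_def bip_commute[of R P])
qed

text \<open>Lists whose first step is a missing pair are present in the complete bipartite graph
  and absent here, and different missing pairs give different lists.\<close>

lemma bipartite_count:
  assumes fPR: "finite P" "finite R" and PR: "P \<inter> R = {}" and ind: "independent P" "independent R" and t: "t \<ge> 2"
  shows "card (path_lists A (P \<union> R) t) + card (missing P R) * alt_count (card P - 1) (card R - 1) (t - 2)
    \<le> Kcount (card P) (card R) t"
proof -
  obtain j where j: "t = Suc (Suc j)" using t by (metis One_nat_def Suc_1 add_2_eq_Suc le_Suc_ex)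
  define D where "D = (\<Union>(x, y)\<in>missing P R. (\<lambda>zs. x # y # zs) ` alternating_lists (P - {x}) (R - {y}) j)"
  have RP: "R \<inter> P = {}" using PR by blast
  have fm: "finite (missing P R)" by (rule finite_subset[of _ "P \<times> R"]) (use fPR in \<open>auto simp: missing_def\<close>)
  have fa: "finite (alternating_lists P R t)" "finite (alternating_lists R P t)" using fPR finite_alternating_lists by auto
  have Dsub: "D \<subseteq> alternating_lists P R t"
    unfolding D_def j by (auto simp: missing_def)
  have fD: "finite D" using Dsub fa finite_subset by blast
  have cD: "card D = card (missing P R) * alt_count (card P - 1) (card R - 1) j"
  proof -
    have "card D = (\<Sum>e\<in>missing P R. card (case e of (x, y) \<Rightarrow> (\<lambda>zs. x # y # zs) ` alternating_lists (P - {x}) (R - {y}) j))"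
      unfolding D_def by (rule card_UN_disjoint) (use fm fPR in \<open>auto simp: finite_alternating_lists\<close>)
    also have "\<dots> = (\<Sum>e\<in>missing P R. alt_count (card P - 1) (card R - 1) j)"
    proof (rule sum.cong[OF refl])
      fix e assume "e \<in> missing P R"
      then obtain x y where e: "e = (x, y)" "x \<in> P" "y \<in> R" by (auto simp: missing_def)
      have "card ((\<lambda>zs. x # y # zs) ` alternating_lists (P - {x}) (R - {y}) j) = card (alternating_lists (P - {x}) (R - {y}) j)"
        by (rule card_image) (auto simp: inj_on_def)
      also have "\<dots> = alt_count (card P - 1) (card R - 1) j"
        using card_alternating_lists[of "P - {x}" "R - {y}" j] fPR e by simp
      finally show "card (case e of (x, y) \<Rightarrow> (\<lambda>zs. x # y # zs) ` alternating_lists (P - {x}) (R - {y}) j) = alt_count (card P - 1) (card R - 1) j"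
        using e by simp
    qed
    finally show ?thesis by simp
  qed
  have disj: "path_lists A (P \<union> R) t \<inter> D = {}"
    unfolding D_def by (auto simp: path_lists_def missing_def)
  have sub: "path_lists A (P \<union> R) t \<subseteq> alternating_lists P R t \<union> alternating_lists R P t"
  proof
    fix xs assume xs: "xs \<in> path_lists A (P \<union> R) t"
    then have ne: "xs \<noteq> []" using t by (auto simp: path_lists_def)
    then have "hd xs \<in> P \<union> R" using xs hd_in_set[OF ne] unfolding path_lists_def by blast
    then show "xs \<in> alternating_lists P R t \<union> alternating_lists R P t" using path_lists_alternate[OF PR ind xs] ne by blast
  qed
  have fp: "finite (path_lists A (P \<union> R) t)" using fPR finite_path_lists by blast
  have "card (path_lists A (P \<union> R) t) + card D = card (path_lists A (P \<union> R) t \<union> D)"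
    by (rule card_Un_disjoint[symmetric, OF fp fD disj])
  also have "\<dots> \<le> card (alternating_lists P R t \<union> alternating_lists R P t)"
    by (rule card_mono) (use fa sub Dsub in auto)
  also have "\<dots> \<le> card (alternating_lists P R t) + card (alternating_lists R P t)" by (rule card_Un_le)
  also have "\<dots> = Kcount (card P) (card R) t" by (simp add: Kcount_def card_alternating_lists fPR)
  finally show ?thesis using cD j by simp
qed

lemma rooted_count:
  assumes fPR: "finite P" "finite R" and PR: "P \<inter> R = {}" and ind: "independent P" "independent R"
    and x: "x \<in> P \<union> R"
  shows "card {ys \<in> path_lists A (P \<union> R) (Suc j). hd ys = x} \<le> rooted_max (card P) (card R) j"
proof -
  have one: "card {ys \<in> path_lists A (P \<union> R) (Suc j). hd ys = x} \<le> alt_count (card R) (card P - 1) j"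
    if "x \<in> P" "finite P" "finite R" "P \<inter> R = {}" "independent P" "independent R" for P R
  proof -
    have "{ys \<in> path_lists A (P \<union> R) (Suc j). hd ys = x} \<subseteq> (#) x ` alternating_lists R (P - {x}) j"
    proof
      fix ys assume ys: "ys \<in> {ys \<in> path_lists A (P \<union> R) (Suc j). hd ys = x}"
      then obtain zs where e: "ys = x # zs" by (cases ys) (auto simp: path_lists_def)
      have "ys \<in> alternating_lists P R (Suc j)" using path_lists_alternate(1)[OF that(4-6), of ys "Suc j"] ys e that(1) by simp
      then show "ys \<in> (#) x ` alternating_lists R (P - {x}) j" using e by auto
    qed
    then have "card {ys \<in> path_lists A (P \<union> R) (Suc j). hd ys = x} \<le> card ((#) x ` alternating_lists R (P - {x}) j)"
      by (rule card_mono[rotated]) (simp add: that finite_alternating_lists)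
    also have "\<dots> = card (alternating_lists R (P - {x}) j)" by (rule card_image) simp
    also have "\<dots> = alt_count (card R) (card P - 1) j" using that card_alternating_lists[of R "P - {x}" j] by simp
    finally show ?thesis .
  qed
  have RP: "R \<inter> P = {}" using PR by blast
  show ?thesis
  proof (cases "x \<in> P")
    case True
    then show ?thesis using one[OF True fPR PR ind] by (simp add: rooted_max_def)
  next
    case False
    then have "x \<in> R" using x by blast
    from one[OF this fPR(2,1) RP ind(2,1)] show ?thesis by (simp add: rooted_max_def Un_commute)
  qed
qed

end

context fin_graph
begin

text \<open>The outside vertices with a neighbour in \<open>M\<close>; for a hung graph that neighbour is \<open>att
  u\<close>.\<close>

definition attached :: "'a set \<Rightarrow> ('a \<Rightarrow> 'a) \<Rightarrow> 'a set" where
  "attached M att = {u \<in> V - M. A u (att u)}"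

definition chains :: "'a set \<Rightarrow> ('a \<Rightarrow> 'a) \<Rightarrow> ('a \<times> 'a) set" where
  "chains M att = {(u, w). u \<in> V - M \<and> w \<in> attached M att \<and> A u w}"

text \<open>Path lists whose first entry, and only this one, lies outside \<open>M\<close>; \<open>ending_in_two\<close> is
  the analogue for the first two entries.\<close>

definition ending_in_one :: "'a set \<Rightarrow> ('a \<Rightarrow> 'a) \<Rightarrow> nat \<Rightarrow> 'a list set" where
  "ending_in_one M att t = (\<Union>u\<in>attached M att. (#) u ` {ys \<in> path_lists A M (t - 1). hd ys = att u})"

definition ending_in_two :: "'a set \<Rightarrow> ('a \<Rightarrow> 'a) \<Rightarrow> nat \<Rightarrow> 'a list set" where
  "ending_in_two M att t =
     (\<Union>(u, w)\<in>chains M att. (\<lambda>ys. u # w # ys) ` {ys \<in> path_lists A M (t - 2). hd ys = att w})"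

lemma hungD:
  assumes "hung M att" "x \<in> V - M" "b \<in> M" "A x b" shows "att x = b"
  using assms unfolding hung_def by blast

lemma hd_last_mem: "set xs \<subseteq> S \<Longrightarrow> xs \<noteq> [] \<Longrightarrow> hd xs \<in> S \<and> last xs \<in> S"
  using hd_in_set last_in_set by blast

lemma hung_path_const:
  assumes h: "hung M att" and cs: "successively A cs" "set cs \<subseteq> V - M" "x \<in> set cs"
  shows "att x = att (hd cs)"
  using cs
proof (induction cs)
  case (Cons c cs)
  show ?case
  proof (cases "x = c")
    case False
    then have "x \<in> set cs" using Cons.prems by simp
    then have "cs \<noteq> []" by auto
    then have "A c (hd cs)" "hd cs \<in> V - M" "c \<in> V - M"
      using Cons.prems hd_last_mem[of cs "V - M"] by (auto simp: successively_Cons)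
    then have "att c = att (hd cs)" using h unfolding hung_def by blast
    moreover have "att x = att (hd cs)"
      using Cons \<open>x \<in> set cs\<close> by (auto simp: successively_Cons)
    ultimately show ?thesis by simp
  qed simp
qed simp

text \<open>A list that returned to \<open>M\<close> after leaving it would return at the vertex where it left.\<close>

lemma hung_path_shape:
  assumes h: "hung M att" and xs: "xs \<in> path_lists A V t"
  shows "\<exists>as ms bs. xs = as @ ms @ bs \<and> set as \<subseteq> V - M \<and> set ms \<subseteq> M \<and> set bs \<subseteq> V - M"
proof -
  define as where "as = takeWhile (\<lambda>x. x \<notin> M) xs"
  define r1 where "r1 = dropWhile (\<lambda>x. x \<notin> M) xs"
  define ms where "ms = takeWhile (\<lambda>x. x \<in> M) r1"
  define bs where "bs = dropWhile (\<lambda>x. x \<in> M) r1"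
  have e: "xs = as @ ms @ bs" by (simp only: as_def r1_def ms_def bs_def takeWhile_dropWhile_id)
  have xV: "set xs \<subseteq> V" "distinct xs" "successively A xs" using xs by (auto simp: path_lists_def)
  have a: "set as \<subseteq> V - M"
  proof
    fix x assume "x \<in> set as"
    then have "x \<in> set xs \<and> x \<notin> M" unfolding as_def by (rule set_takeWhileD)
    then show "x \<in> V - M" using xV(1) by blast
  qed
  have m: "set ms \<subseteq> M"
  proof
    fix x assume "x \<in> set ms"
    then show "x \<in> M" unfolding ms_def by (metis set_takeWhileD)
  qed
  have "set bs \<inter> M = {}"
  proof (rule ccontr)
    assume "\<not> ?thesis"
    then have ex: "\<exists>x\<in>set bs. x \<in> M" by blast
    define cs where "cs = takeWhile (\<lambda>x. x \<notin> M) bs"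
    define ds where "ds = dropWhile (\<lambda>x. x \<notin> M) bs"
    have b: "bs = cs @ ds" by (simp add: cs_def ds_def)
    have bn: "bs \<noteq> []" using ex by auto
    then have hb: "hd bs \<notin> M" using hd_dropWhile[of "\<lambda>x. x \<in> M" r1] by (simp add: bs_def)
    then have cn: "cs \<noteq> []" using bn by (cases bs) (auto simp: cs_def)
    have dn: "ds \<noteq> []" using ex by (auto simp: ds_def dropWhile_eq_Nil_conv)
    then have hd: "hd ds \<in> M" using hd_dropWhile[of "\<lambda>x. x \<notin> M" bs] by (simp add: ds_def)
    have "set bs \<subseteq> V" using xV(1) e by auto
    moreover have "x \<in> set bs \<and> x \<notin> M" if "x \<in> set cs" for x
      using that unfolding cs_def by (rule set_takeWhileD)
    ultimately have csM: "set cs \<subseteq> V - M" by blast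
    have rn: "r1 \<noteq> []" using bn by (auto simp: bs_def)
    then have "hd r1 \<in> M" using hd_dropWhile[of "\<lambda>x. x \<notin> M" xs] by (simp add: r1_def)
    then have mn: "ms \<noteq> []" using rn by (cases r1) (auto simp: ms_def)
    have lm: "last ms \<in> M" "hd cs \<in> V - M" "last cs \<in> V - M"
      using hd_last_mem[OF m mn] hd_last_mem[OF csM cn] by auto
    have s: "A (last ms) (hd cs)" "successively A cs" "A (last cs) (hd ds)"
      using xV(3) mn cn dn unfolding e b by (auto simp: successively_append_iff)
    have "att (hd cs) = last ms" using hungD[OF h lm(2,1) sym[OF s(1)]] .
    moreover have "att (last cs) = hd ds" using hungD[OF h lm(3) hd s(3)] .
    moreover have "att (last cs) = att (hd cs)" using hung_path_const[OF h s(2) csM last_in_set[OF cn]] .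
    ultimately have "last ms = hd ds" by simp
    then have "last ms \<in> set ms \<inter> set ds" using last_in_set[OF mn] hd_in_set[OF dn] by simp
    moreover have "set ms \<inter> set ds = {}" using xV(2) unfolding e b by auto
    ultimately show False by blast
  qed
  then have "set bs \<subseteq> V - M" using xV(1) e by auto
  then show ?thesis using e a m by (intro exI[of _ as] exI[of _ ms] exI[of _ bs] conjI)
qed

lemma length_filter_in: "set as \<subseteq> Z \<Longrightarrow> length (filter (\<lambda>x. x \<in> Z) as) = length as"
  by (simp add: subset_iff)

text \<open>The set \<open>Z\<close> contains the outside vertices and the vertices of \<open>M\<close> at which they hang.
  A list with at least three outside entries also passes through an attachment vertex or has
  only outside entries; a list leaving \<open>M\<close> at both ends contains two attachment vertices. In
  either case four entries lie in \<open>Z\<close>.\<close>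

lemma hung_path_cases:
  assumes h: "hung M att" and M: "M \<subseteq> V" and xs: "xs \<in> path_lists A V t" and t: "t \<ge> 4"
  defines "Z \<equiv> (V - M) \<union> att ` (V - M)"
  shows "xs \<in> path_lists A M t \<or> xs \<in> ending_in_one M att t \<or> rev xs \<in> ending_in_one M att t \<or>
    xs \<in> ending_in_two M att t \<or> rev xs \<in> ending_in_two M att t \<or> 4 \<le> length (filter (\<lambda>x. x \<in> Z) xs)"
proof -
  have one: "ys \<in> ending_in_one M att t \<or> ys \<in> ending_in_two M att t \<or> 4 \<le> length (filter (\<lambda>x. x \<in> Z) ys)"
    if ys: "ys \<in> path_lists A V t" "ys = as @ ms" and as: "set as \<subseteq> V - M" "as \<noteq> []" and ms: "set ms \<subseteq> M" "ms \<noteq> []" for ys as ms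
  proof -
    have p: "length ys = t" "distinct ys" "successively A ys" using ys by (auto simp: path_lists_def)
    have lh: "A (last as) (hd ms)" using p(3) as ms unfolding ys(2) by (simp add: successively_append_iff)
    have lM: "last as \<in> V - M" "hd ms \<in> M" using hd_last_mem[OF as] hd_last_mem[OF ms] by auto
    have at: "att (last as) = hd ms" using h lM lh unfolding hung_def by blast
    have ad: "last as \<in> attached M att" using lM lh at by (simp add: attached_def)
    have hZ: "hd ms \<in> Z" using at lM unfolding Z_def by (metis UnI2 imageI)
    have mp: "distinct ms" "successively A ms" using p unfolding ys(2) by (auto simp: successively_append_iff)
    consider "length as = 1" | "length as = 2" | "length as \<ge> 3"
      using as(2) by (metis One_nat_def Suc_1 Suc_leI length_greater_0_conv linorder_neqE_nat not_less_eq_eq numeral_3_eq_3)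
    then show ?thesis
    proof cases
      case 1
      then obtain u where u: "as = [u]" by (auto simp: length_Suc_conv)
      have "ms \<in> {ys \<in> path_lists A M (t - 1). hd ys = att u}"
        using p mp ms at u ys(2) by (auto simp: path_lists_def)
      then have "ys \<in> ending_in_one M att t" unfolding ending_in_one_def using ad u ys(2) by auto
      then show ?thesis by blast
    next
      case 2
      then obtain u w where u: "as = [u, w]" by (auto simp: numeral_2_eq_2 length_Suc_conv)
      have "ms \<in> {ys \<in> path_lists A M (t - 2). hd ys = att w}"
        using p mp ms at u ys(2) by (auto simp: path_lists_def)
      moreover have "(u, w) \<in> chains M att"
        using ad u as p(3) unfolding ys(2) by (auto simp: chains_def)
      ultimately have "ys \<in> ending_in_two M att t" unfolding ending_in_two_def using u ys(2) by force
      then show ?thesis by blast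
    next
      case 3
      have "length (filter (\<lambda>x. x \<in> Z) as) = length as" using as by (intro length_filter_in) (auto simp: Z_def)
      moreover have "length (filter (\<lambda>x. x \<in> Z) ms) \<ge> 1" using hZ ms by (cases ms) auto
      ultimately have "4 \<le> length (filter (\<lambda>x. x \<in> Z) ys)" using 3 unfolding ys(2) by simp
      then show ?thesis by blast
    qed
  qed
  obtain as ms bs where e: "xs = as @ ms @ bs" "set as \<subseteq> V - M" "set ms \<subseteq> M" "set bs \<subseteq> V - M"
    using hung_path_shape[OF h xs] by blast
  have p: "length xs = t" "distinct xs" "successively A xs" "set xs \<subseteq> V" using xs by (auto simp: path_lists_def)
  have fa: "length (filter (\<lambda>x. x \<in> Z) as) = length as" "length (filter (\<lambda>x. x \<in> Z) bs) = length bs"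
  proof -
    have "set as \<subseteq> Z" "set bs \<subseteq> Z" using e by (auto simp: Z_def)
    then show "length (filter (\<lambda>x. x \<in> Z) as) = length as" "length (filter (\<lambda>x. x \<in> Z) bs) = length bs"
      using length_filter_in by blast+
  qed
  consider "ms = []" | "ms \<noteq> []" "as = []" "bs = []" | "ms \<noteq> []" "as \<noteq> []" "bs = []" | "ms \<noteq> []" "as = []" "bs \<noteq> []"
    | "ms \<noteq> []" "as \<noteq> []" "bs \<noteq> []" by blast
  then show ?thesis
  proof cases
    case 1
    then have "length (filter (\<lambda>x. x \<in> Z) xs) = length xs" using fa e(1) by simp
    then show ?thesis using p t by simp
  next
    case 2
    then have "xs \<in> path_lists A M t" using p e by (simp add: path_lists_def)
    then show ?thesis by blast
  next
    case 3
    then show ?thesis using one[OF xs _ e(2) _ e(3)] e(1) by auto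
  next
    case 4
    have "rev xs \<in> path_lists A V t" using p by (auto simp: path_lists_def successively_flip)
    then have "rev xs \<in> ending_in_one M att t \<or> rev xs \<in> ending_in_two M att t \<or> 4 \<le> length (filter (\<lambda>x. x \<in> Z) (rev xs))"
      using one[of "rev xs" "rev bs" "rev ms"] 4 e by simp
    moreover have "length (filter (\<lambda>x. x \<in> Z) (rev xs)) = length (filter (\<lambda>x. x \<in> Z) xs)"
      by (simp add: rev_filter[symmetric])
    ultimately show ?thesis by auto
  next
    case 5
    have lh: "A (last as) (hd ms)" "A (last ms) (hd bs)"
      using p(3) 5 unfolding e(1) by (auto simp: successively_append_iff)
    have lM: "last as \<in> V - M" "hd ms \<in> M" "last ms \<in> M" "hd bs \<in> V - M"
      using hd_last_mem[OF e(2) 5(2)] hd_last_mem[OF e(3) 5(1)] hd_last_mem[OF e(4) 5(3)] by auto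
    have at: "att (last as) = hd ms" using h lM lh unfolding hung_def by blast
    have at2: "att (hd bs) = last ms" using h lM sym[OF lh(2)] unfolding hung_def by blast
    have hZ: "hd ms \<in> Z" "last ms \<in> Z" using at at2 lM unfolding Z_def by (metis UnI2 imageI)+
    have "1 \<le> length (filter (\<lambda>x. x \<in> Z) ms)" using hZ 5 by (cases ms) auto
    moreover have "2 \<le> length (filter (\<lambda>x. x \<in> Z) ms)" if l2: "length ms \<ge> 2"
    proof -
      obtain y zs where ms: "ms = y # zs" "zs \<noteq> []" using l2 by (cases ms) fastforce+
      obtain ws z where zs: "zs = ws @ [z]" using ms(2) by (metis rev_exhaust)
      show ?thesis using hZ unfolding ms zs by simp
    qed
    moreover have "length as \<ge> 1" "length bs \<ge> 1" using 5 by (simp_all add: Suc_leI)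
    moreover have "length as + length ms + length bs \<ge> 4" using p(1) t e(1) by simp
    ultimately have "4 \<le> length as + length (filter (\<lambda>x. x \<in> Z) ms) + length bs"
      by (cases "length ms \<ge> 2") linarith+
    then have "4 \<le> length (filter (\<lambda>x. x \<in> Z) xs)" using fa unfolding e(1) by simp
    then show ?thesis by blast
  qed
qed

text \<open>The last summand bounds the lists with four entries in \<open>Z\<close>; it is of order \<open>n\<^bsup>t-4\<^esup>\<close>.\<close>

lemma hung_count:
  assumes h: "hung (P \<union> R) att" and M: "P \<union> R \<subseteq> V" and PR: "P \<inter> R = {}" and ind: "independent P" "independent R"
    and t: "t \<ge> 4" and ne: "V \<noteq> {}"
  shows "card (path_lists A V t) \<le> card (path_lists A (P \<union> R) t)
     + 2 * card (attached (P \<union> R) att) * rooted_max (card P) (card R) (t - 2)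
     + 2 * card (chains (P \<union> R) att) * rooted_max (card P) (card R) (t - 3)
     + 2 ^ t * (2 * card (V - (P \<union> R))) ^ 4 * card V ^ (t - 4)"
proof -
  let ?M = "P \<union> R"
  define Z where "Z = (V - ?M) \<union> att ` (V - ?M)"
  have fPR: "finite P" "finite R" using M fin finite_subset by auto
  have attM: "att ` (V - ?M) \<subseteq> ?M" using h by (simp add: hung_def)
  have ZV: "Z \<subseteq> V" using attM M by (auto simp: Z_def)
  have cZ: "card Z \<le> 2 * card (V - ?M)"
  proof -
    have "card Z \<le> card (V - ?M) + card (att ` (V - ?M))" unfolding Z_def by (rule card_Un_le)
    also have "card (att ` (V - ?M)) \<le> card (V - ?M)" using fin by (intro card_image_le) simp
    finally show ?thesis by simp
  qed
  define W where "W = {xs. length xs = t \<and> set xs \<subseteq> V \<and> 4 \<le> length (filter (\<lambda>x. x \<in> Z) xs)}"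
  have fW: "finite W" by (rule finite_subset[OF _ finite_lists_length_eq[OF fin, of t]]) (auto simp: W_def)
  have cW: "card W \<le> 2 ^ t * (2 * card (V - ?M)) ^ 4 * card V ^ (t - 4)"
  proof -
    have "card W * card V ^ 4 \<le> 2 ^ t * card Z ^ 4 * card V ^ t"
      unfolding W_def by (rule card_lists_with_many_in[OF fin ZV])
    also have "card V ^ t = card V ^ (t - 4) * card V ^ 4" using t by (simp add: power_add[symmetric])
    finally have "card W * card V ^ 4 \<le> (2 ^ t * card Z ^ 4 * card V ^ (t - 4)) * card V ^ 4"
      by (simp only: mult.assoc)
    moreover have "card V ^ 4 > 0" using ne fin by (simp add: card_gt_0_iff)
    ultimately have "card W \<le> 2 ^ t * card Z ^ 4 * card V ^ (t - 4)" by (metis mult_le_cancel2)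
    also have "\<dots> \<le> 2 ^ t * (2 * card (V - ?M)) ^ 4 * card V ^ (t - 4)"
      using cZ by (intro mult_le_mono power_mono) auto
    finally show ?thesis .
  qed
  let ?E = "ending_in_one ?M att t" and ?F = "ending_in_two ?M att t"
  have fatt: "finite (attached ?M att)" using fin by (simp add: attached_def)
  have fch: "finite (chains ?M att)"
    by (rule finite_subset[of _ "V \<times> V"]) (use fin in \<open>auto simp: chains_def attached_def\<close>)
  have fpl: "finite (path_lists A ?M j)" for j using fPR finite_path_lists by blast
  have cE: "card ?E \<le> card (attached ?M att) * rooted_max (card P) (card R) (t - 2)"
  proof -
    have "card ?E \<le> (\<Sum>u\<in>attached ?M att. card ((#) u ` {ys \<in> path_lists A ?M (t - 1). hd ys = att u}))"
      unfolding ending_in_one_def by (rule card_UN_le[OF fatt])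
    also have "\<dots> \<le> (\<Sum>u\<in>attached ?M att. rooted_max (card P) (card R) (t - 2))"
    proof (rule sum_mono)
      fix u assume "u \<in> attached ?M att"
      then have x: "att u \<in> ?M" using attM by (auto simp: attached_def)
      have "card ((#) u ` {ys \<in> path_lists A ?M (t - 1). hd ys = att u}) \<le> card {ys \<in> path_lists A ?M (t - 1). hd ys = att u}"
        by (rule card_image_le) (simp add: fpl)
      also have "\<dots> \<le> rooted_max (card P) (card R) (t - 2)"
      proof -
        have "t - 1 = Suc (t - 2)" using t by simp
        then show ?thesis using rooted_count[OF fPR PR ind x, of "t - 2"] by simp
      qed
      finally show "card ((#) u ` {ys \<in> path_lists A ?M (t - 1). hd ys = att u}) \<le> rooted_max (card P) (card R) (t - 2)" .
    qed
    finally show ?thesis by simp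
  qed
  have cF: "card ?F \<le> card (chains ?M att) * rooted_max (card P) (card R) (t - 3)"
  proof -
    have "card ?F \<le> (\<Sum>e\<in>chains ?M att. card (case e of (u, w) \<Rightarrow> (\<lambda>ys. u # w # ys) ` {ys \<in> path_lists A ?M (t - 2). hd ys = att w}))"
      unfolding ending_in_two_def by (rule card_UN_le[OF fch])
    also have "\<dots> \<le> (\<Sum>e\<in>chains ?M att. rooted_max (card P) (card R) (t - 3))"
    proof (rule sum_mono)
      fix e assume "e \<in> chains ?M att"
      then obtain u w where e: "e = (u, w)" "w \<in> attached ?M att" by (auto simp: chains_def)
      then have x: "att w \<in> ?M" using attM by (auto simp: attached_def)
      have "card ((\<lambda>ys. u # w # ys) ` {ys \<in> path_lists A ?M (t - 2). hd ys = att w}) \<le> card {ys \<in> path_lists A ?M (t - 2). hd ys = att w}"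
        by (rule card_image_le) (simp add: fpl)
      also have "\<dots> \<le> rooted_max (card P) (card R) (t - 3)"
      proof -
        have "t - 2 = Suc (t - 3)" using t by simp
        then show ?thesis using rooted_count[OF fPR PR ind x, of "t - 3"] by simp
      qed
      finally show "card (case e of (u, w) \<Rightarrow> (\<lambda>ys. u # w # ys) ` {ys \<in> path_lists A ?M (t - 2). hd ys = att w}) \<le> rooted_max (card P) (card R) (t - 3)"
        using e by simp
    qed
    finally show ?thesis by simp
  qed
  have fE: "finite ?E" unfolding ending_in_one_def using fatt fpl by auto
  have fF: "finite ?F" unfolding ending_in_two_def using fch fpl by auto
  have sub: "path_lists A V t \<subseteq> path_lists A ?M t \<union> (?E \<union> rev ` ?E) \<union> (?F \<union> rev ` ?F) \<union> W"
  proof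
    fix xs assume xs: "xs \<in> path_lists A V t"
    have r: "xs \<in> rev ` S" if "rev xs \<in> S" for S using that by (metis image_eqI rev_rev_ident)
    have "xs \<in> W" if "4 \<le> length (filter (\<lambda>x. x \<in> Z) xs)" using that xs by (auto simp: W_def path_lists_def)
    then show "xs \<in> path_lists A ?M t \<union> (?E \<union> rev ` ?E) \<union> (?F \<union> rev ` ?F) \<union> W"
      using hung_path_cases[OF h M xs t] r unfolding Z_def[symmetric] by blast
  qed
  have "card (path_lists A V t) \<le> card (path_lists A ?M t \<union> (?E \<union> rev ` ?E) \<union> (?F \<union> rev ` ?F) \<union> W)"
    by (rule card_mono[OF _ sub]) (simp add: fpl fE fF fW)
  also have "\<dots> \<le> card (path_lists A ?M t) + (card ?E + card (rev ` ?E)) + (card ?F + card (rev ` ?F)) + card W"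
    by (intro order_trans[OF card_Un_le] add_mono card_Un_le order_refl)
  also have "\<dots> \<le> card (path_lists A ?M t) + (card ?E + card ?E) + (card ?F + card ?F) + card W"
    by (intro add_mono card_image_le fE fF order_refl)
  finally show ?thesis using cE cF cW by linarith
qed

end

section \<open>The graph families\<close>

definition clique_in :: "'a graph \<Rightarrow> 'a set \<Rightarrow> bool" where
  "clique_in G C \<longleftrightarrow> C \<subseteq> verts G \<and> (\<forall>u\<in>C. \<forall>v\<in>C. u \<noteq> v \<longrightarrow> {u, v} \<in> edges G)"

lemma clique_in_iso:
  assumes "G \<simeq> H" "clique_in G C"
  shows "\<exists>C'. clique_in H C' \<and> card C' = card C"
proof -
  obtain f where f: "inj_on f (verts G)" "H = graph_image f G" using iso_as_image[OF assms(1)] .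
  have inj: "inj_on f C" using f(1) assms(2) inj_on_subset by (auto simp: clique_in_def)
  have "{f u, f v} \<in> edges H" if "u \<in> C" "v \<in> C" "f u \<noteq> f v" for u v
  proof -
    have "u \<noteq> v" using that by auto
    then have "{u, v} \<in> edges G" using that assms(2) unfolding clique_in_def by blast
    then have "f ` {u, v} \<in> (\<lambda>e. f ` e) ` edges G" by (rule imageI)
    then show ?thesis by (simp add: f(2) graph_image_def)
  qed
  then have "clique_in H (f ` C)" using assms(2) f(2) by (auto simp: clique_in_def graph_image_def)
  then show ?thesis using card_image[OF inj] by blast
qed

text \<open>At least two vertices of a clique of size \<open>r\<close> stay in the bipartite part. A clique
  vertex in a suspended graph would have both of them as neighbours, but a suspended graph
  shares only one vertex with the bipartite part. So the clique lies in the bipartite part,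
  which has no triangle.\<close>

lemma no_large_clique_in_near_bip:
  assumes G: "G \<in> near_bip n r" and C: "clique_in G C" and r: "r \<ge> 3"
  shows "card C < r"
proof (rule ccontr)
  assume "\<not> ?thesis"
  then have cC: "r \<le> card C" by simp
  obtain B :: "nat graph" and s H x where bip: "bipartite B" and sus': "\<forall>i<s. suspendable B (H i) (x i)"
    and dj': "\<forall>i<s. \<forall>j<s. i \<noteq> j \<longrightarrow> (verts (H i) - verts B) \<inter> (verts (H j) - verts B) = {}"
    and sm: "(\<Sum>i<s. card (verts (H i) - verts B)) + 2 \<le> r" and iso: "G \<simeq> suspend B s H"
    using G unfolding near_bip_def mem_Collect_eq by (elim conjE exE) (rule that; assumption)
  have sus: "suspendable B (H i) (x i)" if "i < s" for i using sus' that by blast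
  have dj: "(verts (H i) - verts B) \<inter> (verts (H j) - verts B) = {}" if "i < s" "j < s" "i \<noteq> j" for i j
    using dj' that by blast
  obtain D where D: "clique_in (suspend B s H) D" "card D = card C" using clique_in_iso[OF iso C] by blast
  define E where "E = (\<Union>i<s. verts (H i) - verts B)"
  have fD: "finite D" using D(2) cC r by (metis card.infinite not_numeral_le_zero order_trans)
  have cE: "card E \<le> (\<Sum>i<s. card (verts (H i) - verts B))" unfolding E_def by (rule card_UN_le) simp
  have fE: "finite E" unfolding E_def using sus by (auto simp: suspendable_def simple_graph_def)
  have DE: "D - E \<subseteq> verts B" using D(1) by (auto simp: clique_in_def suspend_def E_def)
  have "card (D - E) \<ge> card D - card E" using fE by (simp add: diff_card_le_card_Diff)
  then have c2: "card (D - E) \<ge> 2" using cE sm D(2) cC by linarith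
  then obtain T where T: "T \<subseteq> D - E" "card T = 2" by (meson obtain_subset_with_card_n)
  then obtain b1 b2 where "T = {b1, b2}" "b1 \<noteq> b2" by (auto simp: card_2_iff)
  then have b: "b1 \<in> D - E" "b2 \<in> D - E" "b1 \<noteq> b2" using T by auto
  have bB: "b1 \<in> verts B" "b2 \<in> verts B" using b DE by auto
  have HB: "v = x i" if "i < s" "v \<in> verts (H i)" "v \<in> verts B" for i v
  proof -
    have "verts B \<inter> verts (H i) = {x i}" using sus[OF that(1)] by (simp add: suspendable_def)
    then show ?thesis using that by blast
  qed
  have Hs: "e \<subseteq> verts (H i)" if "i < s" "e \<in> edges (H i)" for i e
    using sus[OF that(1)] that unfolding suspendable_def simple_graph_def by blast
  have Bs: "e \<subseteq> verts B" if "e \<in> edges B" for e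
    using bip that unfolding bipartite_def simple_graph_def by blast
  have DA: "{u, v} \<in> edges (suspend B s H)" if "u \<in> D" "v \<in> D" "u \<noteq> v" for u v
    using D(1) that by (simp add: clique_in_def)
  have noE: "D \<inter> E = {}"
  proof (rule ccontr)
    assume "D \<inter> E \<noteq> {}"
    then obtain c i where c: "c \<in> D" "i < s" "c \<in> verts (H i)" "c \<notin> verts B" by (auto simp: E_def)
    have adjc: "v = x i" if v: "v \<in> D" "v \<in> verts B" for v
    proof -
      have "v \<noteq> c" using v c by blast
      then have "{c, v} \<in> edges (suspend B s H)" using DA[OF c(1) v(1)] by simp
      moreover have "{c, v} \<notin> edges B" using Bs[of "{c, v}"] c(4) by auto
      ultimately have "{c, v} \<in> (\<Union>i<s. edges (H i))" by (simp add: suspend_def)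
      then obtain j where j: "j < s" "{c, v} \<in> edges (H j)" by blast
      then have "c \<in> verts (H j)" "v \<in> verts (H j)" using Hs[OF j] by auto
      have "j = i"
      proof (rule ccontr)
        assume "j \<noteq> i"
        then have "(verts (H j) - verts B) \<inter> (verts (H i) - verts B) = {}" using dj[OF j(1) c(2)] by simp
        then show False using c \<open>c \<in> verts (H j)\<close> by blast
      qed
      then show ?thesis using HB[OF c(2) _ v(2)] \<open>v \<in> verts (H j)\<close> by simp
    qed
    show False using adjc[of b1] adjc[of b2] b bB by simp
  qed
  have DB: "D \<subseteq> verts B" using DE noE by blast
  have eB: "{u, v} \<in> edges B" if uv: "u \<in> D" "v \<in> D" "u \<noteq> v" for u v
  proof -
    have "{u, v} \<in> edges (suspend B s H)" using DA[OF uv] .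
    moreover have nH: "{u, v} \<notin> edges (H i)" if "i < s" for i
    proof
      assume "{u, v} \<in> edges (H i)"
      then have "u \<in> verts (H i)" "v \<in> verts (H i)" using Hs[OF that] by auto
      then have "u = x i" "v = x i" using HB[OF that] uv DB by auto
      then show False using uv by simp
    qed
    moreover have "{u, v} \<notin> (\<Union>i<s. edges (H i))" using nH by blast
    ultimately show ?thesis by (simp add: suspend_def)
  qed
  obtain X Y where XY: "X \<union> Y = verts B" "X \<inter> Y = {}" "edges B \<subseteq> {{x, y} | x y. x \<in> X \<and> y \<in> Y}"
    using bip unfolding bipartite_def by blast
  have cross: "(u \<in> X) \<noteq> (v \<in> X)" if uv: "u \<in> D" "v \<in> D" "u \<noteq> v" for u v
  proof -
    obtain x y where "{u, v} = {x, y}" "x \<in> X" "y \<in> Y" using eB[OF uv] XY(3) by blast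
    then show ?thesis using XY(2) by (auto simp: doubleton_eq_iff)
  qed
  have "card D \<ge> 3" using D(2) cC r by simp
  then obtain T where T: "T \<subseteq> D" "card T = 3" by (meson obtain_subset_with_card_n)
  then obtain u v w where uvw: "u \<in> D" "v \<in> D" "w \<in> D" "u \<noteq> v" "u \<noteq> w" "v \<noteq> w"
    by (auto simp: card_3_iff)
  show False using cross[OF uvw(1,2,4)] cross[OF uvw(1,3,5)] cross[OF uvw(2,3,6)] by blast
qed

definition complete_on :: "'a set \<Rightarrow> 'a graph" where
  "complete_on S = \<lparr>verts = S, edges = {{i, j} | i j. i \<in> S \<and> j \<in> S \<and> i \<noteq> j}\<rparr>"

lemma complete_graph_on: "complete_graph r = complete_on {..<r}"
  by (simp add: complete_graph_def complete_on_def)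

lemma simple_complete_on: "finite S \<Longrightarrow> simple_graph (complete_on S)"
  by (auto simp: simple_graph_def complete_on_def)

lemma image_pairs:
  assumes "inj_on f S"
  shows "(\<lambda>e. f ` e) ` {{i, j} | i j. i \<in> S \<and> j \<in> S \<and> i \<noteq> j} = {{i, j} | i j. i \<in> f ` S \<and> j \<in> f ` S \<and> i \<noteq> j}"
    (is "?L = ?R")
proof
  show "?L \<subseteq> ?R"
  proof
    fix e assume "e \<in> ?L"
    then obtain i j where "i \<in> S" "j \<in> S" "i \<noteq> j" "e = f ` {i, j}" by blast
    moreover then have "f i \<noteq> f j" using assms by (auto dest: inj_onD)
    ultimately show "e \<in> ?R" by auto
  qed
  show "?R \<subseteq> ?L"
  proof
    fix e assume "e \<in> ?R"
    then obtain i j where ij: "i \<in> S" "j \<in> S" "f i \<noteq> f j" "e = {f i, f j}" by blast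
    then have "e = f ` {i, j}" "i \<noteq> j" by auto
    then show "e \<in> ?L" using ij by blast
  qed
qed

lemma complete_on_iso:
  assumes "finite S" "card S = r" shows "complete_on S \<simeq> complete_graph r"
proof -
  obtain f where f: "bij_betw f S {0..<r}" using assms ex_bij_betw_finite_nat by blast
  then have i: "inj_on f S" and im: "f ` S = {..<r}" by (auto simp: bij_betw_def)
  have "complete_on S \<simeq> graph_image f (complete_on S)"
    by (rule iso_image(1)[OF simple_complete_on[OF assms(1)]]) (simp add: complete_on_def i)
  also have "graph_image f (complete_on S) = complete_graph r"
    unfolding complete_graph_on using image_pairs[OF i] im by (simp add: graph_image_def complete_on_def)
  finally show ?thesis .
qed

lemma simple_turan2: "simple_graph (turan2 m)"
  by (auto simp: simple_graph_def turan2_def)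

lemma bipartite_turan2: "bipartite (turan2 m)"
proof -
  have 1: "{..<m div 2} \<union> {m div 2..<m} = verts (turan2 m)" by (auto simp: turan2_def)
  have 2: "{..<m div 2} \<inter> {m div 2..<m} = {}" by auto
  have 3: "edges (turan2 m) \<subseteq> {{x, y} | x y. x \<in> {..<m div 2} \<and> y \<in> {m div 2..<m}}"
    by (simp add: turan2_def)
  show ?thesis unfolding bipartite_def
    by (intro conjI simple_turan2 exI[of _ "{..<m div 2}"] exI[of _ "{m div 2..<m}"] 1 2 3)
qed

lemma Tstar_basics:
  assumes G: "G \<in> Tstar r n" and n: "n \<ge> r" and r: "r \<ge> 1"
  shows "G \<in> near_bip n (r + 1)" "\<exists>C. clique_in G C \<and> card C = r" "simple_graph G"
proof -
  obtain K x where K: "K \<simeq> complete_graph r" and s: "suspendable (turan2 (n + 1 - r)) K x"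
    and iso: "G \<simeq> suspend (turan2 (n + 1 - r)) 1 (\<lambda>_. K)"
    using G unfolding Tstar_def by blast
  let ?T = "turan2 (n + 1 - r)" and ?S = "suspend (turan2 (n + 1 - r)) 1 (\<lambda>_. K)"
  show "simple_graph G" using iso by (simp add: isomorphic_def)
  obtain f where f: "inj_on f (verts (complete_graph r))" "K = graph_image f (complete_graph r)"
    using iso_as_image[OF iso_sym[OF K]] .
  have fK: "finite (verts K)" using s by (simp add: suspendable_def simple_graph_def)
  have cK: "card (verts K) = r" unfolding f(2) using card_image[OF f(1)] by (simp add: graph_image_def complete_graph_def)
  have int: "verts ?T \<inter> verts K = {x}" using s by (simp add: suspendable_def)
  have cd: "card (verts K - verts ?T) = r - 1"
  proof -
    have "verts K - verts ?T = verts K - {x}" using int by blast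
    moreover have "x \<in> verts K" using int by blast
    ultimately show ?thesis using cK by simp
  qed
  have vS: "verts ?S = verts ?T \<union> (verts K - verts ?T)" by (auto simp: suspend_def)
  have "card (verts ?S) = card (verts ?T) + card (verts K - verts ?T)"
    unfolding vS by (rule card_Un_disjoint) (use fK in \<open>auto simp: turan2_def\<close>)
  then have cS: "card (verts ?S) = n" using cd n r by (simp add: turan2_def)
  have cG: "card (verts G) = n"
  proof -
    obtain g where "bij_betw g (verts G) (verts ?S)" using iso unfolding isomorphic_def by blast
    then show ?thesis using bij_betw_same_card cS by metis
  qed
  show "G \<in> near_bip n (r + 1)"
    unfolding near_bip_def mem_Collect_eq
  proof (rule conjI[OF cG], rule exI[of _ ?T], rule exI[of _ "1::nat"], rule exI[of _ "\<lambda>_. K"], rule exI[of _ "\<lambda>_. x"], intro conjI)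
    show "(\<Sum>i<1::nat. card (verts K - verts ?T)) + 2 \<le> r + 1" using cd r by simp
  qed (use bipartite_turan2 s iso in auto)
  have "clique_in (complete_graph r) {..<r}" by (auto simp: clique_in_def complete_graph_def)
  then obtain C where C: "clique_in K C" "card C = r" using clique_in_iso[OF iso_sym[OF K], of "{..<r}"] by auto
  then have "clique_in ?S C" by (auto simp: clique_in_def suspend_def)
  then show "\<exists>C. clique_in G C \<and> card C = r" using clique_in_iso[OF iso_sym[OF iso]] C by metis
qed

text \<open>The set whose maximum defines \<open>bP\<close> is finite, as a graph on \<open>n\<close> vertices has at most
  \<open>n\<^sup>t\<close> path lists.\<close>

lemma Tstar_le_bP:
  assumes G: "G \<in> Tstar r n" and n: "n \<ge> r" and r: "r \<ge> 3"
  shows "num_copies (path_graph t) G \<le> bP t r n"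
proof -
  let ?S = "{num_copies (path_graph t) H | H. H \<in> near_bip n (r + 1) - near_bip n r}"
  have "G \<notin> near_bip n r"
    using Tstar_basics(2)[OF G n] no_large_clique_in_near_bip r by fastforce
  then have mem: "num_copies (path_graph t) G \<in> ?S" using Tstar_basics(1)[OF G n] r by auto
  have "?S \<subseteq> {..n ^ t}"
  proof
    fix k assume "k \<in> ?S"
    then obtain H where H: "k = num_copies (path_graph t) H" "H \<in> near_bip n (r + 1)" by blast
    have sH: "simple_graph H" "card (verts H) = n" using H(2) by (auto simp: near_bip_def isomorphic_def)
    have fH: "finite (verts H)" using sH by (simp add: simple_graph_def)
    have "k \<le> card (path_autos t) * k" using path_autos_pos(2)[of t] by simp
    also have "\<dots> = card (path_lists (adj H) (verts H) t)" using card_path_lists[OF sH(1)] H(1) by simp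
    also have "\<dots> \<le> card {xs. set xs \<subseteq> verts H \<and> length xs = t}"
      by (rule card_mono[OF finite_lists_length_eq[OF fH]]) (auto simp: path_lists_def)
    also have "\<dots> = n ^ t" using card_lists_length_eq[OF fH] sH by simp
    finally show "k \<in> {..n ^ t}" by simp
  qed
  then have "finite ?S" using finite_subset by blast
  then show ?thesis unfolding bP_def using mem by (rule Max_ge)
qed

lemma fin_graph_adj: "simple_graph G \<Longrightarrow> fin_graph (verts G) (adj G)"
  by unfold_locales (auto simp: simple_graph_def adj_def insert_commute)

text \<open>One graph is suspended at every vertex \<open>x\<close> of \<open>B\<close>: the one induced by \<open>x\<close> and all
  outside vertices assigned to \<open>x\<close>, which may be \<open>x\<close> alone.\<close>

lemma near_bip_of_hung:
  fixes G :: "nat graph" and c :: "nat \<Rightarrow> bool"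
  assumes G: "simple_graph G" and B: "B \<subseteq> verts G" and c: "\<forall>u\<in>B. \<forall>v\<in>B. adj G u v \<longrightarrow> c u \<noteq> c v"
    and h: "fin_graph.hung (verts G) (adj G) B att" and r: "card (verts G - B) + 2 \<le> r"
  shows "G \<in> near_bip (card (verts G)) r"
proof -
  interpret fin_graph "verts G" "adj G" using fin_graph_adj[OF G] .
  have fB: "finite B" using B fin finite_subset by blast
  define BG where "BG = \<lparr>verts = B, edges = {e \<in> edges G. e \<subseteq> B}\<rparr>"
  define fib where "fib = (\<lambda>x. {v \<in> verts G - B. att v = x})"
  obtain h where hb: "bij_betw h {0..<card B} B" using ex_bij_betw_nat_finite[OF fB] by blast
  then have him: "h ` {0..<card B} = B" and hinj: "inj_on h {0..<card B}" by (auto simp: bij_betw_def)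
  have hB: "h i \<in> B" if "i < card B" for i using him that by auto
  define HG where "HG = (\<lambda>i. \<lparr>verts = insert (h i) (fib (h i)), edges = {e \<in> edges G. e \<subseteq> insert (h i) (fib (h i))}\<rparr>)"
  have ed: "\<exists>u v. e = {u, v} \<and> u \<noteq> v \<and> u \<in> verts G \<and> v \<in> verts G" if "e \<in> edges G" for e
    using G that unfolding simple_graph_def by (metis card_2_iff insert_subset)
  have sB: "simple_graph BG" using G fB by (auto simp: simple_graph_def BG_def)
  have sH: "simple_graph (HG i)" for i using G fin by (auto simp: simple_graph_def HG_def fib_def)
  have bB: "bipartite BG"
    unfolding bipartite_def
  proof (intro conjI sB exI)
    show "{u \<in> B. c u} \<union> {u \<in> B. \<not> c u} = verts BG" by (auto simp: BG_def)
    show "{u \<in> B. c u} \<inter> {u \<in> B. \<not> c u} = {}" by auto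
    show "edges BG \<subseteq> {{x, y} |x y. x \<in> {u \<in> B. c u} \<and> y \<in> {u \<in> B. \<not> c u}}"
    proof
      fix e assume "e \<in> edges BG"
      then have e: "e \<in> edges G" "e \<subseteq> B" by (auto simp: BG_def)
      then obtain u v where uv: "e = {u, v}" using ed by blast
      then have "c u \<noteq> c v" using c e by (auto simp: adj_def)
      then have "(c u \<and> \<not> c v) \<or> (c v \<and> \<not> c u)" by blast
      then show "e \<in> {{x, y} |x y. x \<in> {u \<in> B. c u} \<and> y \<in> {u \<in> B. \<not> c u}}"
        using uv e(2) by (auto simp: insert_commute)
    qed
  qed
  have dif: "verts (HG i) - verts BG = fib (h i)" if "i < card B" for i
    using hB[OF that] by (auto simp: HG_def BG_def fib_def)
  have susp: "suspendable BG (HG i) (h i)" if "i < card B" for i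
    using sB sH hB[OF that] by (auto simp: suspendable_def HG_def BG_def fib_def)
  have sm: "(\<Sum>i<card B. card (verts (HG i) - verts BG)) = card (verts G - B)"
  proof -
    have "(\<Sum>i<card B. card (verts (HG i) - verts BG)) = (\<Sum>i\<in>{0..<card B}. card (fib (h i)))"
      by (rule sum.cong) (use dif in auto)
    also have "\<dots> = (\<Sum>x\<in>B. card (fib x))" using sum.reindex_bij_betw[OF hb] by fast
    also have "\<dots> = card (\<Union>x\<in>B. fib x)"
      by (rule card_UN_disjoint[symmetric]) (use fB fin in \<open>auto simp: fib_def\<close>)
    also have "(\<Union>x\<in>B. fib x) = verts G - B" using \<open>hung B att\<close> by (auto simp: fib_def hung_def)
    finally show ?thesis .
  qed
  have idx: "\<exists>i<card B. h i = b" if "b \<in> B" for b using that him by force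
  have attB: "att v \<in> B" if "v \<in> verts G - B" for v using \<open>hung B att\<close> that by (auto simp: hung_def)
  have vS: "verts (suspend BG (card B) HG) = verts G"
  proof
    show "verts (suspend BG (card B) HG) \<subseteq> verts G" using B hB by (auto simp: suspend_def BG_def HG_def fib_def)
    show "verts G \<subseteq> verts (suspend BG (card B) HG)"
    proof
      fix v assume v: "v \<in> verts G"
      show "v \<in> verts (suspend BG (card B) HG)"
      proof (cases "v \<in> B")
        case False
        then obtain i where i: "i < card B" "h i = att v" using idx[of "att v"] attB[of v] v by blast
        then have "v \<in> verts (HG i)" using v False by (simp add: HG_def fib_def)
        then show ?thesis using i by (auto simp: suspend_def)
      qed (simp add: suspend_def BG_def)
    qed
  qed
  have eS: "edges (suspend BG (card B) HG) = edges G"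
  proof
    show "edges (suspend BG (card B) HG) \<subseteq> edges G" by (auto simp: suspend_def BG_def HG_def)
    show "edges G \<subseteq> edges (suspend BG (card B) HG)"
    proof
      fix e assume e: "e \<in> edges G"
      then obtain u v where uv: "e = {u, v}" "u \<in> verts G" "v \<in> verts G" using ed by blast
      have key: "e \<in> edges (suspend BG (card B) HG)" if w: "a \<notin> B" "e = {a, b}" "a \<in> verts G" "b \<in> verts G" for a b
      proof -
        obtain i where i: "i < card B" "h i = att a" using idx attB w by blast
        have ab: "adj G a b" using e w by (simp add: adj_def)
        have "b \<in> insert (h i) (fib (h i))"
        proof (cases "b \<in> B")
          case True
          then have "att a = b" using \<open>hung B att\<close> w ab unfolding hung_def by blast
          then show ?thesis using i by simp
        next
          case False
          then have "att a = att b" using \<open>hung B att\<close> w ab unfolding hung_def by blast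
          then show ?thesis using i False w by (simp add: fib_def)
        qed
        then have "e \<in> edges (HG i)" using e w i by (simp add: HG_def fib_def)
        then show ?thesis using i by (auto simp: suspend_def)
      qed
      show "e \<in> edges (suspend BG (card B) HG)"
      proof (cases "e \<subseteq> B")
        case True
        then show ?thesis using e by (simp add: suspend_def BG_def)
      next
        case False
        then consider "u \<notin> B" | "v \<notin> B" using uv by auto
        then show ?thesis
        proof cases
          case 1 then show ?thesis using key uv by blast
        next
          case 2 then show ?thesis using key[of v u] uv by (simp add: insert_commute)
        qed
      qed
    qed
  qed
  have iso: "G \<simeq> suspend BG (card B) HG"
  proof -
    have "simple_graph (suspend BG (card B) HG)" using G unfolding simple_graph_def vS eS .
    then show ?thesis unfolding isomorphic_def vS eS using G by (intro conjI exI[of _ id]) auto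
  qed
  show ?thesis
    unfolding near_bip_def mem_Collect_eq
  proof (intro conjI refl exI[of _ BG] exI[of _ "card B"] exI[of _ HG] exI[of _ h] bB iso)
    show "\<forall>i<card B. suspendable BG (HG i) (h i)" using susp by blast
    show "\<forall>i<card B. \<forall>j<card B. i \<noteq> j \<longrightarrow> (verts (HG i) - verts BG) \<inter> (verts (HG j) - verts BG) = {}"
    proof (intro allI impI)
      fix i j assume ij: "i < card B" "j < card B" "i \<noteq> j"
      then have "h i \<noteq> h j" using hinj by (auto dest: inj_onD)
      then show "(verts (HG i) - verts BG) \<inter> (verts (HG j) - verts BG) = {}"
        using dif ij by (auto simp: fib_def)
    qed
    show "(\<Sum>i<card B. card (verts (HG i) - verts BG)) + 2 \<le> r" using sm r by simp
  qed
qed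

section \<open>Path lists of the extremal graphs\<close>

context fin_graph
begin

text \<open>Only the lists with at most two clique vertices besides \<open>x\<close> are counted, all at one
  end of the list; these are the orders that decide the comparison.\<close>

lemma suspended_clique_count:
  assumes PR: "P \<inter> R = {}" "P \<subseteq> V" "R \<subseteq> V" and ad: "\<And>u v. bip P R u v \<Longrightarrow> A u v"
    and x: "x \<in> P" and L: "L \<inter> (P \<union> R) = {}" "L \<subseteq> V" "\<And>u. u \<in> L \<Longrightarrow> A u x"
    "\<And>u w. u \<in> L \<Longrightarrow> w \<in> L \<Longrightarrow> u \<noteq> w \<Longrightarrow> A u w" and t: "t \<ge> 4"
  shows "Kcount (card P) (card R) t + 2 * card L * alt_count (card R) (card P - 1) (t - 2)
     + 2 * (card L * (card L - 1)) * alt_count (card R) (card P - 1) (t - 3) \<le> card (path_lists A V t)"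
proof -
  have fin3: "finite P" "finite R" "finite L" using PR L fin finite_subset by blast+
  have RP: "R \<inter> P = {}" using PR by blast
  have Rx: "R \<inter> (P - {x}) = {}" using PR by blast
  define al where "al = (\<lambda>j. alternating_lists R (P - {x}) j)"
  have al: "length ys = j" "distinct ys" "set ys \<subseteq> (P \<union> R) - {x}" "successively A (x # ys)" if "ys \<in> al j" for ys j
  proof -
    have a: "length ys = j" "distinct ys" "set ys \<subseteq> R \<union> (P - {x})" "successively (bip R (P - {x})) ys"
      "ys \<noteq> [] \<Longrightarrow> hd ys \<in> R"
      using that alternating_lists_iff[OF Rx, of ys j] unfolding al_def by auto
    show "length ys = j" "distinct ys" using a by auto
    show "set ys \<subseteq> (P \<union> R) - {x}" using a(3) x PR(1) by blast
    have "successively A ys" by (rule successively_mono[OF a(4)]) (auto intro!: ad simp: bip_def)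
    moreover have "ys \<noteq> [] \<Longrightarrow> A x (hd ys)" using a(5) x by (intro ad) (auto simp: bip_def)
    ultimately show "successively A (x # ys)" by (cases ys) auto
  qed
  have cal: "card (al j) = alt_count (card R) (card P - 1) j" for j
    unfolding al_def using card_alternating_lists[of R "P - {x}" j] fin3 x by simp
  have fal: "finite (al j)" for j unfolding al_def by (rule finite_alternating_lists) (use fin3 in auto)
  define S1 where "S1 = alternating_lists P R t \<union> alternating_lists R P t"
  define S2 where "S2 = (\<lambda>(u, ys). u # x # ys) ` (L \<times> al (t - 2))"
  \<comment> \<open>ordered pairs of distinct clique vertices\<close>
  define E where "E = (SIGMA u:L. L - {u})"
  define S4 where "S4 = (\<lambda>((u, w), ys). u # w # x # ys) ` (E \<times> al (t - 3))"
  have fE: "finite E" using fin3 by (auto simp: E_def)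
  have cE: "card E = card L * (card L - 1)" using fin3 by (simp add: E_def)
  have c2: "card S2 = card L * alt_count (card R) (card P - 1) (t - 2)"
  proof -
    have "card S2 = card (L \<times> al (t - 2))" unfolding S2_def by (rule card_image) (auto simp: inj_on_def)
    then show ?thesis by (simp add: card_cartesian_product cal)
  qed
  have c4: "card S4 = card L * (card L - 1) * alt_count (card R) (card P - 1) (t - 3)"
  proof -
    have "card S4 = card (E \<times> al (t - 3))" unfolding S4_def by (rule card_image) (auto simp: inj_on_def)
    then show ?thesis by (simp add: card_cartesian_product cal cE)
  qed
  have f2: "finite S2" "finite S4" using fin3 fal fE by (auto simp: S2_def S4_def)
  have xL: "x \<notin> L" using x L by blast
  have s2: "xs \<in> path_lists A V t \<and> hd xs \<in> L \<and> last xs \<notin> L \<and> xs ! 1 \<notin> L" if xs: "xs \<in> S2" for xs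
  proof -
    obtain u ys where e: "xs = u # x # ys" "u \<in> L" "ys \<in> al (t - 2)" using xs by (auto simp: S2_def)
    note y = al[OF e(3)]
    have yL: "set ys \<inter> L = {}" using y(3) L(1) by blast
    have "set ys \<subseteq> V" using y(3) PR by blast
    then have "xs \<in> path_lists A V t" using e y L x PR yL xL t
      by (auto simp: path_lists_def)
    moreover have "last xs \<notin> L" using e yL xL by (cases ys rule: rev_cases) auto
    ultimately show ?thesis using e xL by simp
  qed
  have s4: "xs \<in> path_lists A V t \<and> hd xs \<in> L \<and> last xs \<notin> L \<and> xs ! 1 \<in> L" if xs: "xs \<in> S4" for xs
  proof -
    obtain u w ys where e: "xs = u # w # x # ys" "(u, w) \<in> E" "ys \<in> al (t - 3)" using xs by (auto simp: S4_def)
    then have uw: "u \<in> L" "w \<in> L" "u \<noteq> w" by (auto simp: E_def)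
    note y = al[OF e(3)]
    have yL: "set ys \<inter> L = {}" using y(3) L(1) by blast
    have "set ys \<subseteq> V" using y(3) PR by blast
    then have "xs \<in> path_lists A V t" using e(1) uw y L x PR yL xL t
      by (auto simp: path_lists_def)
    moreover have "last xs \<notin> L" using e yL xL by (cases ys rule: rev_cases) auto
    ultimately show ?thesis using e uw by simp
  qed
  have s1: "xs \<in> path_lists A V t \<and> hd xs \<notin> L \<and> last xs \<notin> L" if "xs \<in> S1" for xs
  proof -
    have a: "length xs = t" "distinct xs" "set xs \<subseteq> P \<union> R" "successively (bip P R) xs"
      using that alternating_lists_iff[OF PR(1), of xs t] alternating_lists_iff[OF RP, of xs t] bip_commute[of R P] by (auto simp: S1_def)
    have ne: "xs \<noteq> []" using a t by auto
    have "successively A xs" by (rule successively_mono[OF a(4)]) (auto intro: ad)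
    then have "xs \<in> path_lists A V t" using a PR by (auto simp: path_lists_def)
    moreover have "set xs \<inter> L = {}" using a(3) L by blast
    ultimately show ?thesis using hd_in_set[OF ne] last_in_set[OF ne] by blast
  qed
  have f1: "finite S1" "card S1 = Kcount (card P) (card R) t"
  proof -
    show "finite S1" using fin3 finite_alternating_lists by (auto simp: S1_def)
    have d: "alternating_lists P R t \<inter> alternating_lists R P t = {}"
    proof (rule ccontr)
      assume "\<not> ?thesis"
      then obtain xs where xs: "xs \<in> alternating_lists P R t" "xs \<in> alternating_lists R P t" by blast
      then have "xs \<noteq> []" using alternating_lists_iff[OF PR(1), of xs t] t by auto
      then have "hd xs \<in> P" "hd xs \<in> R" using xs alternating_lists_iff[OF PR(1), of xs t] alternating_lists_iff[OF RP, of xs t] by auto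
      then show False using PR by blast
    qed
    show "card S1 = Kcount (card P) (card R) t"
      unfolding S1_def Kcount_def by (simp add: card_Un_disjoint[OF _ _ d] finite_alternating_lists card_alternating_lists fin3)
  qed
  have rv: "xs \<in> path_lists A V t \<and> last xs \<in> L \<and> hd xs \<notin> L" if xs: "xs \<in> rev ` (S2 \<union> S4)" for xs
  proof -
    obtain ys where y: "ys \<in> S2 \<union> S4" "xs = rev ys" using xs by blast
    then have p: "ys \<in> path_lists A V t" "hd ys \<in> L" "last ys \<notin> L" using s2[of ys] s4[of ys] by blast+
    have "ys \<noteq> []" using p(1) t by (auto simp: path_lists_def)
    then show ?thesis using p y by (simp add: path_lists_def successively_flip hd_rev last_rev)
  qed
  have d24: "S2 \<inter> S4 = {}" using s2 s4 by blast
  have c24: "card (S2 \<union> S4) = card S2 + card S4" by (rule card_Un_disjoint[OF f2 d24])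
  have crev: "card (rev ` (S2 \<union> S4)) = card S2 + card S4" using c24 by (simp add: card_image)
  have d1: "S1 \<inter> (S2 \<union> S4) = {}" using s1 s2 s4 by blast
  have d2: "(S1 \<union> (S2 \<union> S4)) \<inter> rev ` (S2 \<union> S4) = {}" using s1 s2 s4 rv by blast
  have "card (S1 \<union> (S2 \<union> S4) \<union> rev ` (S2 \<union> S4)) = card S1 + (card S2 + card S4) + (card S2 + card S4)"
    using card_Un_disjoint[OF _ _ d2] card_Un_disjoint[OF _ _ d1] f1(1) f2 c24 crev by simp
  moreover have "card (S1 \<union> (S2 \<union> S4) \<union> rev ` (S2 \<union> S4)) \<le> card (path_lists A V t)"
    by (rule card_mono[OF finite_path_lists[OF fin]]) (use s1 s2 s4 rv in blast)
  moreover have "2 * card L * alt_count (card R) (card P - 1) (t - 2) = 2 * card S2" unfolding c2 by simp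
  moreover have "2 * (card L * (card L - 1)) * alt_count (card R) (card P - 1) (t - 3) = 2 * card S4" unfolding c4 by simp
  ultimately show ?thesis using f1(2) by linarith
qed

end

text \<open>The clique consists of \<open>x\<close> and the vertices following those of the Turan graph.\<close>

definition turan_clique :: "nat \<Rightarrow> nat \<Rightarrow> nat \<Rightarrow> nat graph" where
  "turan_clique r n x = suspend (turan2 (n + 1 - r)) 1 (\<lambda>_. complete_on (insert x {n + 1 - r..<n}))"

lemma turan_clique_Tstar:
  assumes r: "1 \<le> r" "r \<le> n" and x: "x < n + 1 - r"
  shows "turan_clique r n x \<in> Tstar r n"
proof -
  let ?K = "complete_on (insert x {n + 1 - r..<n})"
  have c: "card (insert x {n + 1 - r..<n}) = r" using r x by simp
  have K: "?K \<simeq> complete_graph r" by (rule complete_on_iso[OF _ c]) simp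
  have "simple_graph ?K" by (rule simple_complete_on) simp
  moreover have "verts (turan2 (n + 1 - r)) \<inter> verts ?K = {x}" using x by (auto simp: turan2_def complete_on_def)
  ultimately have s: "suspendable (turan2 (n + 1 - r)) ?K x"
    unfolding suspendable_def using simple_turan2 by blast
  have sim: "simple_graph (turan_clique r n x)"
    using s unfolding suspendable_def simple_graph_def turan_clique_def suspend_def by auto
  have "turan_clique r n x \<simeq> turan_clique r n x"
    unfolding isomorphic_def using sim by (intro conjI exI[of _ id]) auto
  then show ?thesis unfolding Tstar_def mem_Collect_eq
    by (intro exI[of _ ?K] exI[of _ x] conjI K s) (simp add: turan_clique_def)
qed

text \<open>The clique is suspended on the side that maximises the leading term. The second term
  is then only known to be at least the minimum over both sides, which differs from the
  maximum in lower order.\<close>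

lemma turan_clique_count:
  assumes r: "1 \<le> r" "r \<le> n" and t: "t \<ge> 4" and n2: "n + 1 - r \<ge> 2"
  defines "k \<equiv> n + 1 - r"
  defines "p \<equiv> k div 2" and "q \<equiv> k - k div 2"
  shows "\<exists>G\<in>Tstar r n. Kbal k t + 2 * (r - 1) * rooted_max p q (t - 2)
     + 2 * ((r - 1) * (r - 2)) * rooted_min p q (t - 3) \<le> card (path_lists (adj G) (verts G) t)"
proof -
  let ?P = "{..<p}" and ?R = "{p..<k}" and ?L = "{k..<n}"
  have pk: "p \<le> k" "1 \<le> p" "p < k" "k \<le> n" using n2 r by (auto simp: p_def k_def)
  have cd: "card ?P = p" "card ?R = q" "card ?L = r - 1" using r by (auto simp: q_def p_def k_def)
  have main: "Kcount p q t + 2 * (r - 1) * a (t - 2) + 2 * ((r - 1) * (r - 2)) * a (t - 3)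
     \<le> card (path_lists (adj (turan_clique r n x)) (verts (turan_clique r n x)) t)"
    if xa: "(x \<in> ?P \<and> a = alt_count q (p - 1)) \<or> (x \<in> ?R \<and> a = alt_count p (q - 1))" for x a
  proof -
    let ?G = "turan_clique r n x"
    have xk: "x < k" using xa pk by auto
    have "simple_graph ?G" using Tstar_basics(3)[OF turan_clique_Tstar[OF r xk[unfolded k_def]]] r by simp
    then interpret fin_graph "verts ?G" "adj ?G" by (rule fin_graph_adj)
    have vG: "verts ?G = {..<n}" using xk pk by (auto simp: turan_clique_def suspend_def turan2_def complete_on_def k_def)
    have ad: "adj ?G u v" if "bip ?P ?R u v" for u v
      using that unfolding adj_def turan_clique_def suspend_def turan2_def k_def[symmetric] p_def[symmetric] bip_def
      by (auto simp: insert_commute)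
    have aL: "adj ?G u v" if "u \<in> insert x ?L" "v \<in> insert x ?L" "u \<noteq> v" for u v
      using that unfolding adj_def turan_clique_def suspend_def complete_on_def k_def[symmetric]
      by auto
    have PRk: "?P \<union> ?R = {..<k}" "?R \<union> ?P = {..<k}" using pk by auto
    have dj0: "?P \<inter> ?R = {}" "?R \<inter> ?P = {}" "?L \<inter> {..<k} = {}" by auto
    have dj1: "?P \<subseteq> verts ?G" "?R \<subseteq> verts ?G" "?L \<subseteq> verts ?G" unfolding vG using pk by auto
    note dj = dj0(1,2) dj0(3)[folded PRk(1)] dj0(3)[folded PRk(2)] dj1
    have l: "adj ?G u x" if "u \<in> ?L" for u by (rule aL) (use that xk in auto)
    have ll: "adj ?G u w" if "u \<in> ?L" "w \<in> ?L" "u \<noteq> w" for u w by (rule aL) (use that in auto)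
    have r2: "r - 1 - 1 = r - 2" by simp
    from xa show ?thesis
    proof
      assume xP: "x \<in> ?P \<and> a = alt_count q (p - 1)"
      then have x: "x \<in> ?P" and a: "a = alt_count q (p - 1)" by blast+
      have "Kcount (card ?P) (card ?R) t + 2 * card ?L * alt_count (card ?R) (card ?P - 1) (t - 2)
          + 2 * (card ?L * (card ?L - 1)) * alt_count (card ?R) (card ?P - 1) (t - 3) \<le> card (path_lists (adj ?G) (verts ?G) t)"
        by (rule suspended_clique_count[OF dj(1,5,6) _ x dj(3,7) _ _ t]; (rule ad l ll; assumption))
      then show ?thesis unfolding cd r2 a .
    next
      assume xR: "x \<in> ?R \<and> a = alt_count p (q - 1)"
      have ad': "adj ?G u v" if "bip ?R ?P u v" for u v using ad that by (simp add: bip_commute)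
      from xR have x: "x \<in> ?R" and a: "a = alt_count p (q - 1)" by blast+
      have "Kcount (card ?R) (card ?P) t + 2 * card ?L * alt_count (card ?P) (card ?R - 1) (t - 2)
          + 2 * (card ?L * (card ?L - 1)) * alt_count (card ?P) (card ?R - 1) (t - 3) \<le> card (path_lists (adj ?G) (verts ?G) t)"
        by (rule suspended_clique_count[OF dj(2,6,5) _ x dj(4,7) _ _ t]; (rule ad' l ll; assumption))
      then show ?thesis unfolding cd r2 a Kcount_commute[of q p] .
    qed
  qed
  have Kb: "Kbal k t = Kcount p q t" by (simp add: Kbal_def p_def q_def)
  show ?thesis
  proof (cases "alt_count p (q - 1) (t - 2) \<le> alt_count q (p - 1) (t - 2)")
    case True
    then have rm: "rooted_max p q (t - 2) = alt_count q (p - 1) (t - 2)" by (simp add: rooted_max_def)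
    have mn: "2 * ((r - 1) * (r - 2)) * rooted_min p q (t - 3) \<le> 2 * ((r - 1) * (r - 2)) * alt_count q (p - 1) (t - 3)"
      by (intro mult_le_mono2) (simp add: rooted_min_def)
    have "(0::nat) \<in> ?P" using pk by simp
    then have "Kcount p q t + 2 * (r - 1) * alt_count q (p - 1) (t - 2) + 2 * ((r - 1) * (r - 2)) * alt_count q (p - 1) (t - 3)
     \<le> card (path_lists (adj (turan_clique r n 0)) (verts (turan_clique r n 0)) t)" by (intro main) simp
    moreover have "turan_clique r n 0 \<in> Tstar r n" using turan_clique_Tstar[OF r] pk k_def by simp
    ultimately show ?thesis unfolding Kb rm using mn by (meson add_left_mono order_trans)
  next
    case False
    then have rm: "rooted_max p q (t - 2) = alt_count p (q - 1) (t - 2)" by (simp add: rooted_max_def)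
    have mn: "2 * ((r - 1) * (r - 2)) * rooted_min p q (t - 3) \<le> 2 * ((r - 1) * (r - 2)) * alt_count p (q - 1) (t - 3)"
      by (intro mult_le_mono2) (simp add: rooted_min_def)
    have "p \<in> ?R" using pk by simp
    then have "Kcount p q t + 2 * (r - 1) * alt_count p (q - 1) (t - 2) + 2 * ((r - 1) * (r - 2)) * alt_count p (q - 1) (t - 3)
     \<le> card (path_lists (adj (turan_clique r n p)) (verts (turan_clique r n p)) t)" by (intro main) simp
    moreover have "turan_clique r n p \<in> Tstar r n" using turan_clique_Tstar[OF r] pk k_def by simp
    ultimately show ?thesis unfolding Kb rm using mn by (meson add_left_mono order_trans)
  qed
qed

section \<open>Comparison with the extremal graphs\<close>

lemma suspend_one:
  "suspend B 1 (\<lambda>_. K) = \<lparr>verts = verts B \<union> verts K, edges = edges B \<union> edges K\<rparr>"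
proof -
  have "{..<1::nat} = {0}" by auto
  then show ?thesis by (simp add: suspend_def)
qed

lemma image_cross:
  "(\<lambda>e. f ` e) ` {{u, v} | u v. u \<in> P \<and> v \<in> R} = {{i, j} | i j. i \<in> f ` P \<and> j \<in> f ` R}" (is "?L = ?R")
proof
  show "?L \<subseteq> ?R"
  proof
    fix e assume "e \<in> ?L"
    then obtain u v where "u \<in> P" "v \<in> R" "e = f ` {u, v}" by blast
    then have "e = {f u, f v}" "f u \<in> f ` P" "f v \<in> f ` R" by simp_all
    then show "e \<in> ?R" by blast
  qed
  show "?R \<subseteq> ?L"
  proof
    fix e assume "e \<in> ?R"
    then obtain u v where uv: "u \<in> P" "v \<in> R" "e = {f u, f v}" by blast
    then have "e = f ` {u, v}" by simp
    then show "e \<in> ?L" using uv by blast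
  qed
qed

text \<open>Number the vertices of the two parts and of the clique consecutively.\<close>

lemma Tstar_recognition_aux:
  fixes G :: "nat graph"
  assumes G: "simple_graph G" and V: "verts G = P \<union> R \<union> L" and dj: "P \<inter> R = {}" "L \<inter> (P \<union> R) = {}"
    and x: "x \<in> P \<union> R" and r: "1 \<le> r" "r \<le> n" and cL: "card L = r - 1"
    and cP: "card P = (n + 1 - r) div 2" and cR: "card R = (n + 1 - r) - (n + 1 - r) div 2"
    and ad: "\<And>u v. {u, v} \<in> edges G \<longleftrightarrow> bip P R u v \<or> (u \<in> insert x L \<and> v \<in> insert x L \<and> u \<noteq> v)"
  shows "G \<in> Tstar r n"
proof -
  define k where "k = n + 1 - r"
  define p where "p = k div 2"
  have pk: "p \<le> k" "k \<le> n" using r by (auto simp: p_def k_def)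
  have kk: "Suc n - r = k" by (simp add: k_def)
  have fin3: "finite P" "finite R" "finite L" using G V by (auto simp: simple_graph_def)
  obtain f1 where f1: "bij_betw f1 P {..<p}"
    using finite_same_card_bij[OF fin3(1) finite_lessThan, of p] cP by (auto simp: p_def k_def)
  obtain f2 where f2: "bij_betw f2 R {p..<k}"
    using finite_same_card_bij[OF fin3(2) finite_atLeastLessThan, of p k] cR by (auto simp: p_def k_def)
  obtain f3 where f3: "bij_betw f3 L {k..<n}"
    using finite_same_card_bij[OF fin3(3) finite_atLeastLessThan, of k n] cL r by (auto simp: k_def)
  define f where "f = (\<lambda>v. if v \<in> P then f1 v else if v \<in> R then f2 v else f3 v)"
  have b1: "bij_betw f P {..<p}" using f1 by (rule bij_betw_cong[THEN iffD1, rotated]) (simp add: f_def)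
  have b2: "bij_betw f R {p..<k}"
    using f2 by (rule bij_betw_cong[THEN iffD1, rotated]) (use dj in \<open>auto simp: f_def\<close>)
  have b3: "bij_betw f L {k..<n}"
    using f3 by (rule bij_betw_cong[THEN iffD1, rotated]) (use dj in \<open>auto simp: f_def\<close>)
  have i1: "f ` P = {..<p}" "f ` R = {p..<k}" "f ` L = {k..<n}" using b1 b2 b3 by (simp_all add: bij_betw_def)
  have b12: "bij_betw f (P \<union> R) ({..<p} \<union> {p..<k})" by (rule bij_betw_combine[OF b1 b2]) auto
  have b123: "bij_betw f (P \<union> R \<union> L) (({..<p} \<union> {p..<k}) \<union> {k..<n})"
    by (rule bij_betw_combine[OF b12 b3]) (use pk in auto)
  then have inj: "inj_on f (verts G)" unfolding V by (simp add: bij_betw_def)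
  have injx: "inj_on f (insert x L)" using inj by (rule inj_on_subset) (use x V in auto)
  have fx: "f x < k" using x i1 pk by (metis UnE imageI atLeastLessThan_iff lessThan_iff less_le_trans)
  have eG: "edges G = {{u, v} | u v. u \<in> P \<and> v \<in> R} \<union> {{u, v} | u v. u \<in> insert x L \<and> v \<in> insert x L \<and> u \<noteq> v}"
    (is "_ = ?X \<union> ?Y")
  proof
    show "edges G \<subseteq> ?X \<union> ?Y"
    proof
      fix e assume e: "e \<in> edges G"
      then obtain u v where uv: "e = {u, v}" using G unfolding simple_graph_def by (meson card_2_iff)
      then have "bip P R u v \<or> (u \<in> insert x L \<and> v \<in> insert x L \<and> u \<noteq> v)" using e ad by blast
      moreover have "{u, v} \<in> ?X" if "bip P R u v"
      proof -
        from that consider "u \<in> P" "v \<in> R" | "v \<in> P" "u \<in> R" by (auto simp: bip_def)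
        then show ?thesis
        proof cases
          case 1 then show ?thesis by blast
        next
          case 2
          then have "{v, u} \<in> ?X" by blast
          then show ?thesis by (simp add: insert_commute)
        qed
      qed
      moreover have "{u, v} \<in> ?Y" if "u \<in> insert x L \<and> v \<in> insert x L \<and> u \<noteq> v" using that by blast
      ultimately show "e \<in> ?X \<union> ?Y" unfolding uv by blast
    qed
    show "?X \<union> ?Y \<subseteq> edges G"
    proof
      fix e assume "e \<in> ?X \<union> ?Y"
      then consider u v where "e = {u, v}" "u \<in> P" "v \<in> R" | u v where "e = {u, v}" "u \<in> insert x L" "v \<in> insert x L" "u \<noteq> v"
        by blast
      then show "e \<in> edges G"
      proof cases
        case 1 then show ?thesis using ad[of u v] by (simp add: bip_def)
      next
        case 2 then show ?thesis using ad[of u v] by simp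
      qed
    qed
  qed
  have "graph_image f G = turan_clique r n (f x)"
  proof -
    have v: "f ` verts G = verts (turan_clique r n (f x))"
      unfolding V image_Un i1 using fx pk
      by (auto simp: turan_clique_def suspend_def turan2_def complete_on_def kk)
    have "(\<lambda>e. f ` e) ` edges G = {{i, j} | i j. i \<in> {..<p} \<and> j \<in> {p..<k}} \<union>
        {{i, j} | i j. i \<in> insert (f x) {k..<n} \<and> j \<in> insert (f x) {k..<n} \<and> i \<noteq> j}"
      unfolding eG image_Un image_cross image_pairs[OF injx] image_insert i1 ..
    also have "\<dots> = edges (turan_clique r n (f x))"
      unfolding turan_clique_def suspend_one by (simp add: turan2_def complete_on_def kk p_def)
    finally have e: "(\<lambda>e. f ` e) ` edges G = edges (turan_clique r n (f x))" .
    show ?thesis unfolding graph_image_def v e by simp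
  qed
  then have iso: "G \<simeq> turan_clique r n (f x)" using iso_image(1)[OF G inj] by simp
  have "turan_clique r n (f x) \<in> Tstar r n" using turan_clique_Tstar[OF r] fx by (simp add: k_def)
  then obtain K y where "K \<simeq> complete_graph r" "suspendable (turan2 (n + 1 - r)) K y"
    "turan_clique r n (f x) \<simeq> suspend (turan2 (n + 1 - r)) 1 (\<lambda>_. K)"
    unfolding Tstar_def mem_Collect_eq by (elim exE conjE)
  then show ?thesis unfolding Tstar_def mem_Collect_eq
    by (intro exI[of _ K] exI[of _ y] conjI iso_trans[OF iso])
qed

lemma Tstar_recognition:
  fixes G :: "nat graph"
  assumes G: "simple_graph G" and V: "verts G = P \<union> R \<union> L" and dj: "P \<inter> R = {}" "L \<inter> (P \<union> R) = {}"
    and x: "x \<in> P \<union> R" and r: "1 \<le> r" "r \<le> n" and cL: "card L = r - 1"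
    and cPR: "card P + card R = n + 1 - r" "(card P - card R) + (card R - card P) \<le> 1"
    and ad: "\<And>u v. {u, v} \<in> edges G \<longleftrightarrow> bip P R u v \<or> (u \<in> insert x L \<and> v \<in> insert x L \<and> u \<noteq> v)"
  shows "G \<in> Tstar r n"
proof (cases "card P \<le> card R")
  case True
  then have "card P = (n + 1 - r) div 2" "card R = (n + 1 - r) - (n + 1 - r) div 2"
    unfolding cPR(1)[symmetric] using cPR(2) by auto
  then show ?thesis using Tstar_recognition_aux[OF G V dj x r cL _ _ ad] by blast
next
  case False
  then have c: "card R = (n + 1 - r) div 2" "card P = (n + 1 - r) - (n + 1 - r) div 2"
    unfolding cPR(1)[symmetric] using cPR(2) by auto
  have V': "verts G = R \<union> P \<union> L" and dj': "R \<inter> P = {}" "L \<inter> (R \<union> P) = {}" and x': "x \<in> R \<union> P"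
    using V dj x by auto
  have ad': "{u, v} \<in> edges G \<longleftrightarrow> bip R P u v \<or> (u \<in> insert x L \<and> v \<in> insert x L \<and> u \<noteq> v)" for u v
    using ad by (simp add: bip_commute[of R P])
  show ?thesis by (rule Tstar_recognition_aux[OF G V' dj' x' r cL c ad'])
qed

text \<open>In the application \<open>m\<close> is about \<open>n/4\<close>.\<close>

lemma power_thresholds:
  fixes C1 C2 t :: nat
  assumes t: "t \<ge> 4"
  shows "\<exists>m0. \<forall>m\<ge>m0. \<forall>n\<le>15 * m. C1 * n ^ (t - 3) + C2 * n ^ (t - 4) < m ^ (t - 2) \<and> C2 * n ^ (t - 4) < m ^ (t - 3)"
proof (intro exI[of _ "(C1 + C2) * 15 ^ t + 1"] allI impI)
  fix m n :: nat assume m: "(C1 + C2) * 15 ^ t + 1 \<le> m" and n: "n \<le> 15 * m"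
  obtain j where j: "t = j + 4" using t by (metis add.commute le_Suc_ex)
  have m1: "1 \<le> m" using m by simp
  have b: "n ^ i \<le> 15 ^ t * m ^ i" if "i \<le> t" for i
  proof -
    have "n ^ i \<le> (15 * m) ^ i" by (rule power_mono[OF n]) simp
    also have "\<dots> = 15 ^ i * m ^ i" by (rule power_mult_distrib)
    also have "\<dots> \<le> 15 ^ t * m ^ i" using that by (intro mult_le_mono1 power_increasing) auto
    finally show ?thesis .
  qed
  have m4: "m ^ j \<le> m ^ (j + 1)" using m1 by (intro power_increasing) auto
  have e1: "C1 * n ^ (j + 1) \<le> C1 * (15 ^ t * m ^ (j + 1))" using b[of "j + 1"] j by (intro mult_le_mono2) auto
  have e2: "C2 * n ^ j \<le> C2 * (15 ^ t * m ^ j)" using b[of j] j by (intro mult_le_mono2) auto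
  have e3: "C2 * (15 ^ t * m ^ j) \<le> C2 * (15 ^ t * m ^ (j + 1))" using m4 by (intro mult_le_mono2)
  have ds: "(C1 + C2) * 15 ^ t * m ^ i = C1 * (15 ^ t * m ^ i) + C2 * (15 ^ t * m ^ i)" for i
    by (simp only: add_mult_distrib mult.assoc)
  have "C1 * n ^ (j + 1) + C2 * n ^ j \<le> (C1 + C2) * 15 ^ t * m ^ (j + 1)"
    using e1 e2 e3 ds[of "j + 1"] by linarith
  also have "\<dots> < m * m ^ (j + 1)" using m m1 by (intro mult_strict_right_mono) auto
  finally have A: "C1 * n ^ (j + 1) + C2 * n ^ j < m ^ (j + 2)" by simp
  have "C2 * n ^ j \<le> (C1 + C2) * 15 ^ t * m ^ j" using e2 ds[of j] by linarith
  also have "\<dots> < m * m ^ j" using m m1 by (intro mult_strict_right_mono) auto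
  finally have B: "C2 * n ^ j < m ^ (j + 1)" by simp
  show "C1 * n ^ (t - 3) + C2 * n ^ (t - 4) < m ^ (t - 2) \<and> C2 * n ^ (t - 4) < m ^ (t - 3)"
    using A B j by (simp add: numeral_eq_Suc)
qed

text \<open>The sizes \<open>p\<close>, \<open>q\<close> differ from the balanced ones, in either order, by at most \<open>s + 1\<close>.\<close>

lemma rooted_lipschitz:
  assumes n: "p \<le> n" "q \<le> n" and k: "k = p + q"
  defines "s \<equiv> ((p - q) + (q - p)) div 2"
  shows "rooted_max p q j \<le> rooted_min (k div 2) (k - k div 2) j + j * (2 * (s + 1)) * n ^ (j - 1)"
proof -
  let ?p = "k div 2" and ?q = "k - k div 2"
  have d: "p - ?p \<le> s + 1" "p - ?q \<le> s + 1" "q - ?p \<le> s + 1" "q - ?q \<le> s + 1" "?p \<le> n" "?q \<le> n"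
    unfolding k s_def using n by linarith+
  have key: "alt_count a (b - 1) j \<le> alt_count a' (b' - 1) j + j * (2 * (s + 1)) * n ^ (j - 1)"
    if "a \<le> n" "b \<le> n" "a' \<le> n" "b' \<le> n" "a - a' \<le> s + 1" "b - b' \<le> s + 1" for a b a' b'
  proof -
    have "(b - 1) - (b' - 1) \<le> b - b'" by linarith
    then have "(b - 1) - (b' - 1) \<le> s + 1" using that(6) by (rule order_trans)
    from add_mono[OF that(5) this] have d2: "(a - a') + ((b - 1) - (b' - 1)) \<le> 2 * (s + 1)" by simp
    have "alt_count a (b - 1) j \<le> alt_count a' (b' - 1) j + j * ((a - a') + ((b - 1) - (b' - 1))) * n ^ (j - 1)"
      by (rule alt_count_lipschitz) (use that in auto)
    also have "\<dots> \<le> alt_count a' (b' - 1) j + j * (2 * (s + 1)) * n ^ (j - 1)"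
      using d2 by (intro add_left_mono mult_le_mono1 mult_le_mono2)
    finally show ?thesis .
  qed
  show ?thesis
    unfolding rooted_max_def rooted_min_def
    using key[OF n(2,1) d(6,5,4,1)] key[OF n(2,1) d(5,6,3,2)] key[OF n(1,2) d(6,5,2,3)] key[OF n(1,2) d(5,6,1,4)]
    by (simp add: max_def min_def)
qed

text \<open>Here \<open>F\<close> counts the missing pairs of the core, \<open>a\<close> the outside vertices with a
  neighbour in the core and \<open>e\<close> the ordered adjacent pairs of outside vertices whose second
  member has one. With \<open>s\<close> the number of vertices to be moved for balance, the losses \<open>s\<close>,
  \<open>F\<close> and \<open>r1 - a\<close> are each multiplied by at least \<open>m\<^bsup>t-2\<^esup>\<close>, while the possible gains are
  \<open>s\<close> times order \<open>n\<^bsup>t-3\<^esup>\<close> plus order \<open>n\<^bsup>t-4\<^esup>\<close>. Hence all three vanish, and then the loss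
  from \<open>e\<close>, of order \<open>n\<^bsup>t-3\<^esup>\<close>, must vanish too.\<close>

lemma final_comparison:
  fixes p q n t m r1 r2 a e X Y F C k :: nat
  assumes t: "t \<ge> 4" and m: "m \<ge> 1" and pq: "m + t \<le> p" "m + t \<le> q" "p \<le> n" "q \<le> n" and k: "k = p + q"
    and a: "a \<le> r1" and e: "e \<le> r1 * r2"
    and low: "Kbal k t + 2 * r1 * rooted_max (k div 2) (k - k div 2) (t - 2)
        + 2 * (r1 * r2) * rooted_min (k div 2) (k - k div 2) (t - 3) \<le> X"
    and up: "X \<le> Y + 2 * a * rooted_max p q (t - 2) + 2 * e * rooted_max p q (t - 3) + C * n ^ (t - 4)"
    and bip: "Y + F * alt_count (p - 1) (q - 1) (t - 2) \<le> Kcount p q t"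
    and th: "(8 * t * r1 + 4 * t * (r1 * r2)) * n ^ (t - 3) + (4 * t * (r1 * r2) + C) * n ^ (t - 4) < m ^ (t - 2)"
      "(4 * t * (r1 * r2) + C) * n ^ (t - 4) < m ^ (t - 3)"
  shows "F = 0 \<and> a = r1 \<and> e = r1 * r2 \<and> (p - q) + (q - p) \<le> 1"
proof -
  define s where "s = ((p - q) + (q - p)) div 2"
  define \<alpha> where "\<alpha> = m ^ (t - 2)"
  define \<beta> where "\<beta> = m ^ (t - 3)"
  define N3 where "N3 = n ^ (t - 3)"
  define N4 where "N4 = n ^ (t - 4)"
  define RM where "RM = rooted_max (k div 2) (k - k div 2) (t - 2)"
  define Rm where "Rm = rooted_min (k div 2) (k - k div 2) (t - 3)"
  have k0: "m + t \<le> k div 2" "m + t \<le> k - k div 2" using pq k by linarith+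
  have t4: "t - 2 - 1 = t - 3" "t - 3 - 1 = t - 4" by simp_all
  have N43: "N4 \<le> N3" unfolding N3_def N4_def using pq m by (intro power_increasing) auto
  have Kb: "Kcount p q t + s * \<alpha> \<le> Kbal k t"
    unfolding \<alpha>_def s_def k by (rule Kcount_le_Kbal) (use pq t m in auto)
  have F: "Y + F * \<alpha> \<le> Kcount p q t"
  proof -
    have "\<alpha> \<le> alt_count (p - 1) (q - 1) (t - 2)" unfolding \<alpha>_def by (rule alt_count_lower) (use pq t in auto)
    then have "F * \<alpha> \<le> F * alt_count (p - 1) (q - 1) (t - 2)" by (rule mult_le_mono2)
    then show ?thesis using bip by linarith
  qed
  have RM\<alpha>: "\<alpha> \<le> RM"
  proof -
    have "\<alpha> \<le> alt_count (k - k div 2) (k div 2 - 1) (t - 2)" unfolding \<alpha>_def by (rule alt_count_lower) (use k0 t in auto)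
    then show ?thesis by (simp add: RM_def rooted_max_def le_max_iff_disj)
  qed
  have Rm\<beta>: "\<beta> \<le> Rm"
  proof -
    have "\<beta> \<le> alt_count (k - k div 2) (k div 2 - 1) (t - 3)" "\<beta> \<le> alt_count (k div 2) (k - k div 2 - 1) (t - 3)"
      unfolding \<beta>_def by (rule alt_count_lower; use k0 t in auto)+
    then show ?thesis by (simp add: Rm_def rooted_min_def)
  qed
  have U1: "rooted_max p q (t - 2) \<le> RM + 4 * t * s * N3"
  proof (cases "s = 0")
    case True
    then have "p = q \<or> p = Suc q \<or> q = Suc p" unfolding s_def by linarith
    then have "(p = k div 2 \<and> q = k - k div 2) \<or> (q = k div 2 \<and> p = k - k div 2)" unfolding k by auto
    then have "rooted_max p q (t - 2) = RM" unfolding RM_def rooted_max_def by (auto simp: max.commute)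
    then show ?thesis by simp
  next
    case False
    have "rooted_max p q (t - 2) \<le> rooted_min (k div 2) (k - k div 2) (t - 2) + (t - 2) * (2 * (s + 1)) * N3"
      using rooted_lipschitz[OF pq(3,4) k, of "t - 2"] unfolding s_def[symmetric] t4 N3_def .
    also have "rooted_min (k div 2) (k - k div 2) (t - 2) \<le> RM"
      unfolding RM_def rooted_max_def rooted_min_def by linarith
    also have "(t - 2) * (2 * (s + 1)) * N3 \<le> t * (4 * s) * N3"
    proof (rule mult_le_mono1)
      show "(t - 2) * (2 * (s + 1)) \<le> t * (4 * s)" by (rule mult_le_mono) (use False in auto)
    qed
    finally show ?thesis by (simp add: mult_ac)
  qed
  have U2: "rooted_max p q (t - 3) \<le> Rm + 2 * t * (s + 1) * N4"
  proof -
    have "rooted_max p q (t - 3) \<le> Rm + (t - 3) * (2 * (s + 1)) * N4"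
      using rooted_lipschitz[OF pq(3,4) k, of "t - 3"] unfolding s_def[symmetric] t4 N4_def Rm_def .
    also have "(t - 3) * (2 * (s + 1)) * N4 \<le> t * (2 * (s + 1)) * N4" by (intro mult_le_mono1) auto
    finally show ?thesis by (simp add: mult_ac)
  qed
  have a1: "2 * a * rooted_max p q (t - 2) \<le> 2 * a * RM + 8 * t * r1 * s * N3"
  proof -
    have "2 * a * rooted_max p q (t - 2) \<le> 2 * a * (RM + 4 * t * s * N3)" by (rule mult_le_mono2[OF U1])
    also have "\<dots> = 2 * a * RM + 2 * a * (4 * t * s * N3)" by (rule add_mult_distrib2)
    also have "2 * a * (4 * t * s * N3) \<le> 2 * r1 * (4 * t * s * N3)" using a by (intro mult_le_mono1) simp
    finally show ?thesis by (simp add: mult_ac)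
  qed
  have e1: "2 * e * rooted_max p q (t - 3) \<le> 2 * e * Rm + 4 * t * (r1 * r2) * s * N3 + 4 * t * (r1 * r2) * N4"
  proof -
    have "2 * e * rooted_max p q (t - 3) \<le> 2 * e * (Rm + 2 * t * (s + 1) * N4)" by (rule mult_le_mono2[OF U2])
    also have "\<dots> = 2 * e * Rm + 2 * e * (2 * t * (s + 1) * N4)" by (rule add_mult_distrib2)
    also have "2 * e * (2 * t * (s + 1) * N4) \<le> 2 * (r1 * r2) * (2 * t * (s + 1) * N4)" using e by (intro mult_le_mono1) simp
    also have "2 * (r1 * r2) * (2 * t * (s + 1) * N4) = 4 * t * (r1 * r2) * s * N4 + 4 * t * (r1 * r2) * N4"
      by (simp add: algebra_simps)
    also have "4 * t * (r1 * r2) * s * N4 \<le> 4 * t * (r1 * r2) * s * N3" using N43 by (intro mult_le_mono2)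
    finally show ?thesis by simp
  qed
  obtain a' where a': "r1 = a + a'" using a le_Suc_ex by blast
  obtain e' where e': "r1 * r2 = e + e'" using e le_Suc_ex by blast
  define C1 where "C1 = 8 * t * r1 + 4 * t * (r1 * r2)"
  define C2 where "C2 = 4 * t * (r1 * r2) + C"
  have th': "C1 * N3 + C2 * N4 < \<alpha>" "C2 * N4 < \<beta>"
    using th unfolding C1_def C2_def N3_def N4_def \<alpha>_def \<beta>_def .
  have r1RM: "2 * r1 * RM = 2 * a * RM + 2 * (a' * RM)" unfolding a' by (simp add: algebra_simps)
  have r2Rm: "2 * (r1 * r2) * Rm = 2 * e * Rm + 2 * (e' * Rm)" unfolding e' by (simp add: algebra_simps)
  have c1: "8 * t * r1 * s * N3 + 4 * t * (r1 * r2) * s * N3 = s * (C1 * N3)" by (simp add: C1_def algebra_simps)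
  have c2: "4 * t * (r1 * r2) * N4 + C * N4 = C2 * N4" by (simp add: C2_def algebra_simps)
  have main0: "s * \<alpha> + F * \<alpha> + 2 * (a' * RM) + 2 * (e' * Rm) \<le> s * (C1 * N3) + C2 * N4"
    using low[folded RM_def Rm_def] up[folded N4_def] Kb F a1 e1 r1RM r2Rm c1 c2 by linarith
  have "a' * \<alpha> \<le> a' * RM" "e' * \<beta> \<le> e' * Rm" using RM\<alpha> Rm\<beta> by (simp_all add: mult_le_mono2)
  then have main: "s * \<alpha> + F * \<alpha> + a' * \<alpha> + e' * \<beta> \<le> s * (C1 * N3) + C2 * N4" using main0 by linarith
  have s0: "s = 0"
  proof (rule ccontr)
    assume "s \<noteq> 0"
    then have "s * (C1 * N3 + C2 * N4) < s * \<alpha>" using th'(1) by simp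
    moreover have "C2 * N4 \<le> s * (C2 * N4)" using \<open>s \<noteq> 0\<close> by simp
    ultimately show False using main by (simp add: add_mult_distrib2)
  qed
  have small: "F * \<alpha> + a' * \<alpha> + e' * \<beta> \<le> C2 * N4" using main s0 by simp
  have "C2 * N4 < \<alpha>" using th'(1) by linarith
  moreover have "\<alpha> \<le> F * \<alpha>" if "F \<noteq> 0" using that by simp
  moreover have "\<alpha> \<le> a' * \<alpha>" if "a' \<noteq> 0" using that by simp
  moreover have "\<beta> \<le> e' * \<beta>" if "e' \<noteq> 0" using that by simp
  ultimately have "F = 0" "a' = 0" "e' = 0" using small th'(2) by linarith+
  then show ?thesis using a' e' s0 unfolding s_def by auto
qed

section \<open>Structure of graphs with many paths\<close>

context fin_graph
begin

text \<open>Vertices of degree at least \<open>n/D\<close> form \<open>M\<close>. The robustness parameter \<open>a\<close> is an eighth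
  of that degree, and the deficiency of the degree sum is chosen so small that at most \<open>a\<^sup>2\<close>
  pairs are missing, whence each side loses at most \<open>a\<close> vertices on passing to the core.\<close>

lemma core_structure:
  fixes N D t :: nat
  assumes cf: "cycle_free N" and N: "odd N" "N \<ge> 5" and D: "D \<ge> 100"
    and a: "N + t + 4 \<le> card V div D div 8"
    and ds: "(1/2 - 1 / (512 * real D ^ 2)) * real (card V) ^ 2 \<le> real degsum"
    and large: "2 * real N * real (card V) \<le> real (card V) ^ 2 / (512 * real D ^ 2)"
  defines "M \<equiv> {v \<in> V. card V div D \<le> deg v}"
  shows "\<exists>c. linked N M 4 c \<and> card V div 4 + t \<le> card {v \<in> M. c v} \<and> card V div 4 + t \<le> card {v \<in> M. \<not> c v}"
proof -
  define n where "n = card V"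
  define d where "d = n div D"
  define a where "a = d div 8"
  have a1: "N + t + 4 \<le> a" using a by (simp add: a_def d_def n_def)
  have da: "8 * a \<le> d" "d \<le> 15 * a" unfolding a_def using a1[unfolded a_def] by linarith+
  have nD: "D * d \<le> n" "n < D * (d + 1)" unfolding d_def using D
    by (simp_all add: dividend_less_times_div)
  have n16: "n \<le> 16 * D * a"
  proof -
    have "D * (d + 1) \<le> D * (16 * a)" using da a1 by (intro mult_le_mono2) linarith
    then show ?thesis using nD(2) by (simp add: mult_ac)
  qed
  have n100: "100 * d \<le> n" using nD(1) D by (meson le_trans mult_le_mono1)
  have npos: "0 < n" using n100 da a1 by linarith
  then have Vne: "V \<noteq> {}" by (auto simp: n_def)
  obtain k where k: "N = Suc (Suc k)" using N by (cases N; cases "N - 1") auto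
  obtain X Y where XY: "X \<union> Y = V" "X \<inter> Y = {}"
    "card (missing X Y) + degsum \<le> 2 * card X * card Y + 2 * k * card V"
    using missing_partition[OF cf[unfolded k] Vne] by (elim exE conjE)
  have fXY: "finite X" "finite Y" using XY(1) fin by (metis finite_Un)+
  \<comment> \<open>chosen such that \<open>2 * \<delta> * (16 * D * a)\<^sup>2 = a\<^sup>2\<close>, where \<open>16 * D * a\<close> bounds \<open>n\<close>\<close>
  define \<delta> where "\<delta> = 1 / (512 * real D ^ 2)"
  have \<delta>: "\<delta> > 0" "\<delta> < 1/100"
  proof -
    have D1: "1 \<le> real D ^ 2" using D by (simp add: one_le_power)
    show "\<delta> > 0" using D by (simp add: \<delta>_def)
    have "1 / (512 * real D ^ 2) \<le> 1 / 512" using D D1 by (intro divide_left_mono) auto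
    then show "\<delta> < 1/100" by (simp add: \<delta>_def)
  qed
  have sXY: "real (card X) + real (card Y) = real n"
    unfolding n_def XY(1)[symmetric] using card_Un_disjoint[OF fXY XY(2)] by simp
  have r1: "real (card (missing X Y)) + real degsum \<le> 2 * (real (card X) * real (card Y)) + 2 * real k * real n"
  proof -
    have "real (card (missing X Y) + degsum) \<le> real (2 * card X * card Y + 2 * k * card V)"
      using XY(3) by (simp only: of_nat_le_iff)
    then show ?thesis by (simp add: n_def mult_ac)
  qed
  have kn: "2 * real k * real n \<le> \<delta> * real n ^ 2"
  proof -
    have "2 * real k * real n \<le> 2 * real N * real n" using k by (intro mult_right_mono) auto
    also have "\<dots> \<le> \<delta> * real n ^ 2" using large by (simp add: n_def \<delta>_def)
    finally show ?thesis .
  qed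
  have ds': "(1/2 - \<delta>) * real n ^ 2 \<le> real degsum" using ds by (simp add: \<delta>_def n_def)
  have amgm: "4 * (real (card X) * real (card Y)) \<le> real n ^ 2"
  proof -
    have "0 \<le> (real (card X) - real (card Y)) ^ 2" by simp
    then show ?thesis unfolding sXY[symmetric] by (simp add: power2_eq_square algebra_simps)
  qed
  have miss: "real (card (missing X Y)) \<le> 2 * \<delta> * real n ^ 2"
    using r1 kn ds' amgm by (simp add: algebra_simps)
  have big: "(1/2 - 2 * \<delta>) * real n ^ 2 \<le> 2 * (real (card X) * real (card Y))"
    using r1 kn ds' by (simp add: algebra_simps)
  have third: "n \<le> 3 * card S" if S: "real (card S) + real (card T) = real n"
      "(1/2 - 2 * \<delta>) * real n ^ 2 \<le> 2 * (real (card S) * real (card T))" for S T :: "'a set"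
  proof (rule ccontr)
    assume "\<not> ?thesis"
    then have x: "3 * real (card S) < real n" by linarith
    define x where "x = real (card S)"
    have T: "real (card T) = real n - x" using S(1) by (simp add: x_def)
    \<comment> \<open>a part smaller than \<open>n/3\<close> would make the product of the sizes at most \<open>2n\<^sup>2/9\<close>\<close>
    have "x * (real n - x) \<le> 2 * real n ^ 2 / 9"
    proof -
      have "0 \<le> (real n / 3 - x) * (2 * real n / 3 - x)" using x npos by (intro mult_nonneg_nonneg) (auto simp: x_def)
      moreover have "(real n / 3 - x) * (2 * real n / 3 - x) = 2 * real n ^ 2 / 9 - x * (real n - x)"
        by (simp add: power2_eq_square field_simps)
      ultimately show ?thesis by linarith
    qed
    then have "(1/2 - 2 * \<delta>) * real n ^ 2 \<le> 4 / 9 * real n ^ 2" using S(2) by (simp add: T x_def)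
    then have "1/2 - 2 * \<delta> \<le> 4/9" using npos by simp
    then show False using \<delta> by simp
  qed
  have X3: "n \<le> 3 * card X" using third[OF sXY big] .
  have Y3: "n \<le> 3 * card Y"
    using third[of Y X] sXY big by (simp add: mult_ac add.commute)
  define X' where "X' = {x \<in> X. card (Y - nb x) \<le> a}"
  define Y' where "Y' = {y \<in> Y. card (X - nb y) \<le> a}"
  have ms: "card (missing X Y) \<le> a * a"
  proof -
    have "real n ^ 2 \<le> (16 * real D * real a) ^ 2"
    proof (rule power_mono)
      have "real n \<le> real (16 * D * a)" using n16 by (simp only: of_nat_le_iff)
      then show "real n \<le> 16 * real D * real a" by simp
    qed simp
    then have "2 * \<delta> * real n ^ 2 \<le> 2 * \<delta> * (16 * real D * real a) ^ 2" using \<delta>(1) by (intro mult_left_mono) auto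
    also have "\<dots> = real a * real a"
      using D by (simp add: \<delta>_def power_mult_distrib power2_eq_square)
    finally have "real (card (missing X Y)) \<le> real (a * a)" using miss by simp
    then show ?thesis by (simp only: of_nat_le_iff)
  qed
  have cX: "card (X - X') \<le> a"
  proof -
    have e: "X - X' = {x \<in> X. \<not> card (Y - nb x) \<le> a}" by (auto simp: X'_def)
    have "card (X - X') * a \<le> a * a" unfolding e by (rule order_trans[OF core_size[OF fXY] ms])
    then show ?thesis using a1 by simp
  qed
  have cY: "card (Y - Y') \<le> a"
  proof -
    have e: "Y - Y' = {x \<in> Y. \<not> card (X - nb x) \<le> a}" by (auto simp: Y'_def)
    have "card (Y - Y') * a \<le> a * a"
      unfolding e by (rule order_trans[OF core_size[OF fXY(2,1)] ms[unfolded card_missing_swap[of X Y]]])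
    then show ?thesis using a1 by simp
  qed
  have X'Y': "X' \<subseteq> X" "Y' \<subseteq> Y" by (auto simp: X'_def Y'_def)
  have rb: "robust X' Y' a"
    unfolding robust_def
  proof (intro conjI ballI)
    show "X' \<subseteq> V" "Y' \<subseteq> V" using X'Y' XY by auto
    fix x assume "x \<in> X'"
    moreover have "card (Y' - nb x) \<le> card (Y - nb x)" using X'Y' fXY by (intro card_mono) auto
    ultimately show "card (Y' - nb x) \<le> a" by (simp add: X'_def)
  next
    fix y assume "y \<in> Y'"
    moreover have "card (X' - nb y) \<le> card (X - nb y)" using X'Y' fXY by (intro card_mono) auto
    ultimately show "card (X' - nb y) \<le> a" by (simp add: Y'_def)
  qed
  have out: "card (V - (X' \<union> Y')) \<le> 2 * a"
  proof -
    have "V - (X' \<union> Y') \<subseteq> (X - X') \<union> (Y - Y')" using XY by blast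
    then have "card (V - (X' \<union> Y')) \<le> card ((X - X') \<union> (Y - Y'))" by (rule card_mono[rotated]) (use fXY in auto)
    also have "\<dots> \<le> card (X - X') + card (Y - Y')" by (rule card_Un_le)
    finally show ?thesis using cX cY by linarith
  qed
  have szX: "card X \<le> card X' + a"
  proof -
    have "card X = card X' + card (X - X')"
      using card_Diff_subset[of X' X] card_mono[of X X'] X'Y' fXY finite_subset by fastforce
    then show ?thesis using cX by simp
  qed
  have szY: "card Y \<le> card Y' + a"
  proof -
    have "card Y = card Y' + card (Y - Y')"
      using card_Diff_subset[of Y' Y] card_mono[of Y Y'] X'Y' fXY finite_subset by fastforce
    then show ?thesis using cY by simp
  qed
  \<comment> \<open>twice the threshold \<open>3 * a\<close> and the at most \<open>2 * a\<close> vertices outside the core add up to at most the minimum degree in \<open>M\<close>\<close>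
  define c where "c = (\<lambda>v. 3 * a \<le> card (nb v \<inter> X'))"
  have cl: "linked N M 4 c" "X' \<subseteq> {v \<in> M. \<not> c v}" "Y' \<subseteq> {v \<in> M. c v}"
    unfolding M_def c_def n_def[symmetric] d_def[symmetric]
    by (rule core_linked[OF cf N rb]; use out da a1 szX szY X3 Y3 n100 in linarith)+
  have fM: "finite M" using fin by (simp add: M_def)
  have "card Y' \<le> card {v \<in> M. c v}" "card X' \<le> card {v \<in> M. \<not> c v}"
    by (rule card_mono; use cl fM in auto)+
  moreover have "n div 4 + t \<le> card X'" "n div 4 + t \<le> card Y'"
    using szX szY X3 Y3 n100 da a1 by linarith+
  ultimately show ?thesis using cl(1) unfolding n_def[symmetric] by (intro exI[of _ c]) linarith
qed

lemma linked_parts_independent: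
  assumes "linked N M \<mu> c" "odd N" "\<mu> \<le> N" "cycle_free N" "M \<subseteq> V"
  shows "independent {v \<in> M. c v}" "independent {v \<in> M. \<not> c v}"
  using linked_proper[OF assms] by (fastforce simp: independent_def)+

text \<open>By \<open>dn\<close> the \<open>l\<close> vertices outside \<open>M\<close> lie on at most a \<open>1/r\<close> fraction of the path lists
  that \<open>l\<close> further vertices of a balanced complete bipartite graph would provide. If \<open>l \<ge>
  r\<close>, then compared with \<open>Kbal (n + 1 - r) t\<close> there is a loss of \<open>l - r + 1 \<ge> l/r\<close> vertices,
  which is not compensated. If \<open>l = r - 1\<close>, the same slack bounds the number of missing
  pairs.\<close>

lemma few_low_vertices:
  fixes N r t :: nat
  assumes L: "linked N M 4 c" and cf: "cycle_free N" and N: "odd N" "4 \<le> N" and M: "M \<subseteq> V"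
    and low: "\<And>v. v \<in> V - M \<Longrightarrow> deg v \<le> d" and dn: "2 * r * t * 8 ^ t * d \<le> card V"
    and pq: "m + t \<le> card {v \<in> M. c v}" "m + t \<le> card {v \<in> M. \<not> c v}" and m: "card V \<le> 8 * m" "m \<ge> 1"
    and t: "t \<ge> 2" and r: "r \<ge> 1" "r \<le> card V"
    and many: "Kbal (card V + 1 - r) t \<le> card (path_lists A V t)"
  shows "card (V - M) < r"
    and "card (V - M) = r - 1 \<Longrightarrow> 64 * card (missing {v \<in> M. c v} {v \<in> M. \<not> c v}) \<le> card V"
proof -
  let ?P = "{v \<in> M. c v}" and ?R = "{v \<in> M. \<not> c v}"
  define n where "n = card V"
  define l where "l = card (V - M)"
  define F where "F = card (missing ?P ?R)"
  have fM: "finite M" using M fin finite_subset by blast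
  have PRM: "?P \<union> ?R = M" by blast
  have dj: "?P \<inter> ?R = {}" by blast
  have cM: "card ?P + card ?R = n - l"
  proof -
    have "card ?P + card ?R = card M" using card_Un_disjoint[of ?P ?R] fM dj unfolding PRM by simp
    also have "\<dots> = n - l" unfolding n_def l_def using card_Diff_subset[OF fM M] card_mono[OF fin M] by simp
    finally show ?thesis .
  qed
  have ln: "l \<le> n" unfolding l_def n_def by (rule card_mono[OF fin]) auto
  note ind = linked_parts_independent[OF L N cf M]
  have bc: "card (path_lists A M t) + F * alt_count (card ?P - 1) (card ?R - 1) (t - 2) \<le> Kcount (card ?P) (card ?R) t"
    using bipartite_count[OF _ _ dj ind t] fM unfolding PRM F_def by simp
  have "Kcount (card ?P) (card ?R) t + (((card ?P - card ?R) + (card ?R - card ?P)) div 2) * m ^ (t - 2) \<le> Kbal (n - l) t"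
    using Kcount_le_Kbal[OF pq t m(2)] unfolding cM .
  then have Kb: "card (path_lists A M t) + F * alt_count (card ?P - 1) (card ?R - 1) (t - 2) \<le> Kbal (n - l) t" using bc by linarith
  have lc: "card (path_lists A V t) \<le> card (path_lists A M t) + 2 * t * l * d * n ^ (t - 2)"
    using low_vertex_count[OF t M low] unfolding l_def n_def .
  have half: "m + t \<le> (n - l) div 2" using pq unfolding cM[symmetric] by linarith
  obtain j where j: "t = j + 2" using t by (metis add.commute le_Suc_ex)
  have tj: "t - 1 = j + 1" "t - 2 = j" using j by simp_all
  have d8: "2 * r * t * d * 8 ^ t * n ^ j \<le> 8 ^ (j + 1) * m ^ (j + 1)"
  proof -
    have "2 * r * t * d * 8 ^ t * n ^ j \<le> n * n ^ j" using dn by (intro mult_le_mono1) (simp add: n_def mult_ac)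
    also have "\<dots> = n ^ (j + 1)" by simp
    also have "\<dots> \<le> (8 * m) ^ (j + 1)" by (rule power_mono) (use m in \<open>auto simp: n_def\<close>)
    also have "\<dots> = 8 ^ (j + 1) * m ^ (j + 1)" by (rule power_mult_distrib)
    finally show ?thesis .
  qed
  have "l < r"
  proof (rule ccontr)
    assume "\<not> l < r"
    then have lr: "r \<le> l" by simp
    define i where "i = l - r + 1"
    have i: "l = i + r - 1" "1 \<le> i" using lr r by (auto simp: i_def)
    have li: "l \<le> r * i"
    proof -
      obtain i' where i': "i = Suc i'" using i by (cases i) auto
      have "l = i' + r" using i i' by simp
      moreover have "i' \<le> r * i'" using r by simp
      ultimately show ?thesis unfolding i' by simp
    qed
    have "n - l + i = n + 1 - r" using i ln lr by (simp add: i_def)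
    then have "Kbal (n - l) t + i * m ^ (t - 1) \<le> Kbal (n + 1 - r) t"
      using Kbal_add[OF half, of i] t by simp
    then have "i * m ^ (t - 1) \<le> 2 * t * l * d * n ^ (t - 2)" using Kb lc many[folded n_def] by linarith
    also have "\<dots> \<le> 2 * t * (r * i) * d * n ^ (t - 2)" using li by (intro mult_le_mono1 mult_le_mono2)
    finally have "i * m ^ (j + 1) \<le> 2 * t * (r * i) * d * n ^ j" unfolding tj .
    also have "\<dots> = i * (2 * r * t * d * n ^ j)" by (simp only: mult_ac)
    finally have "i * m ^ (j + 1) \<le> i * (2 * r * t * d * n ^ j)" .
    then have "m ^ (j + 1) \<le> 2 * r * t * d * n ^ j" using i(2) by simp
    then have "8 ^ t * m ^ (j + 1) \<le> 8 ^ t * (2 * r * t * d * n ^ j)" by (rule mult_le_mono2)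
    also have "\<dots> = 2 * r * t * d * 8 ^ t * n ^ j" by (simp only: mult_ac)
    also have "\<dots> \<le> 8 ^ (j + 1) * m ^ (j + 1)" by (rule d8)
    finally show False using m(2) j by simp
  qed
  then show "card (V - M) < r" by (simp add: l_def)
  show "64 * card (missing ?P ?R) \<le> card V" if l1: "card (V - M) = r - 1"
  proof -
    have l: "l = r - 1" using l1 by (simp add: l_def)
    have "n - l = n + 1 - r" using l r by (simp add: n_def)
    then have "F * alt_count (card ?P - 1) (card ?R - 1) (t - 2) \<le> 2 * t * l * d * n ^ (t - 2)"
      using Kb lc many[folded n_def] by simp
    moreover have "m ^ j \<le> alt_count (card ?P - 1) (card ?R - 1) (t - 2)"
      using alt_count_lower[of m j "card ?P - 1" "card ?R - 1"] pq j by simp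
    then have "F * m ^ j \<le> F * alt_count (card ?P - 1) (card ?R - 1) (t - 2)" by (rule mult_le_mono2)
    moreover have "2 * t * l * d * n ^ (t - 2) \<le> 2 * r * t * d * n ^ j"
    proof -
      have "2 * t * l * d * n ^ (t - 2) = l * (2 * t * d * n ^ j)" unfolding tj by (simp only: mult_ac)
      also have "\<dots> \<le> r * (2 * t * d * n ^ j)" using l by (intro mult_le_mono1) simp
      also have "\<dots> = 2 * r * t * d * n ^ j" by (simp only: mult_ac)
      finally show ?thesis .
    qed
    ultimately have "F * m ^ j \<le> 2 * r * t * d * n ^ j" by linarith
    also have "\<dots> \<le> 2 * r * t * d * (8 ^ j * m ^ j)"
    proof (rule mult_le_mono2)
      have "n ^ j \<le> (8 * m) ^ j" by (rule power_mono) (use m in \<open>auto simp: n_def\<close>)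
      then show "n ^ j \<le> 8 ^ j * m ^ j" by (simp add: power_mult_distrib)
    qed
    also have "\<dots> = (2 * r * t * d * 8 ^ j) * m ^ j" by (simp only: mult_ac)
    finally have "F * m ^ j \<le> (2 * r * t * d * 8 ^ j) * m ^ j" .
    then have "F \<le> 2 * r * t * d * 8 ^ j" using m(2) by simp
    then have "64 * F \<le> 64 * (2 * r * t * d * 8 ^ j)" by (rule mult_le_mono2)
    also have "\<dots> = 2 * r * t * 8 ^ t * d"
    proof -
      have "(8::nat) ^ t = 64 * 8 ^ j" unfolding j by (simp add: power_add)
      then show ?thesis by (simp only: mult_ac)
    qed
    also note dn
    finally show ?thesis unfolding F_def .
  qed
qed

text \<open>With few missing pairs any two vertices of the same colour have a common neighbour,
  which provides the paths on three vertices.\<close>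

lemma linked_common_neighbours:
  assumes L: "linked N M 4 c" and M: "M \<subseteq> V"
    and F: "2 * card (missing {v \<in> M. c v} {v \<in> M. \<not> c v}) < card {v \<in> M. c v}"
      "2 * card (missing {v \<in> M. c v} {v \<in> M. \<not> c v}) < card {v \<in> M. \<not> c v}"
  shows "linked N M 3 c"
proof -
  let ?P = "{v \<in> M. c v}" and ?R = "{v \<in> M. \<not> c v}"
  have fM: "finite M" using M fin finite_subset by blast
  have fm: "finite (missing ?P ?R)" by (rule finite_subset[of _ "?P \<times> ?R"]) (use fM in \<open>auto simp: missing_def\<close>)
  have mP: "card {y \<in> ?R. \<not> A u y} \<le> card (missing ?P ?R)" if "u \<in> ?P" for u
    by (rule card_inj_on_le[of "Pair u"]) (use that fm in \<open>auto simp: missing_def inj_on_def\<close>)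
  have mR: "card {x \<in> ?P. \<not> A x v} \<le> card (missing ?P ?R)" if "v \<in> ?R" for v
    by (rule card_inj_on_le[of "\<lambda>x. (x, v)"]) (use that fm in \<open>auto simp: missing_def inj_on_def\<close>)
  have common: "\<exists>w\<in>M. A u w \<and> A w v" if uv: "u \<in> M" "v \<in> M" "c u = c v" for u v
  proof -
    have ex: "\<exists>w\<in>S. A u w \<and> A w v" if S: "card {y \<in> S. \<not> A u y} \<le> f" "card {y \<in> S. \<not> A v y} \<le> f" "2 * f < card S" "finite S" for S f
    proof (rule ccontr)
      assume "\<not> ?thesis"
      then have "S \<subseteq> {y \<in> S. \<not> A u y} \<union> {y \<in> S. \<not> A v y}" using sym by blast
      then have "card S \<le> card ({y \<in> S. \<not> A u y} \<union> {y \<in> S. \<not> A v y})" by (rule card_mono[rotated]) (use S in auto)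
      also have "\<dots> \<le> card {y \<in> S. \<not> A u y} + card {y \<in> S. \<not> A v y}" by (rule card_Un_le)
      finally show False using S by linarith
    qed
    have s: "{x \<in> ?P. \<not> A x v} = {x \<in> ?P. \<not> A v x}" for v using sym by blast
    show ?thesis
    proof (cases "c u")
      case True
      then have "\<exists>w\<in>?R. A u w \<and> A w v" using ex[of ?R, OF mP mP F(2)] uv fM by auto
      then show ?thesis by blast
    next
      case False
      then have "\<exists>w\<in>?P. A u w \<and> A w v" using ex[of ?P, OF mR[unfolded s] mR[unfolded s] F(1)] uv fM by auto
      then show ?thesis by blast
    qed
  qed
  show ?thesis
    unfolding linked_def
  proof (intro ballI allI impI)
    fix u v m assume u: "u \<in> M" and v: "v \<in> M" and ne: "u \<noteq> v" and m: "3 \<le> m" "m \<le> N" and p: "odd m \<longleftrightarrow> c u = c v"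
    show "path_between M u v m"
    proof (cases "m = 3")
      case True
      then have "c u = c v" using p by simp
      then obtain w where w: "w \<in> M" "A u w" "A w v" using common u v by blast
      then have "w \<noteq> u" "w \<noteq> v" using irrefl by auto
      then show ?thesis unfolding path_between_def
        by (intro exI[of _ "[u, w, v]"]) (use w u v ne True in auto)
    next
      case False
      then show ?thesis using linkedD[OF L u v ne _ m(2) p] m(1) by simp
    qed
  qed
qed

end

text \<open>The bounds of \<open>path_lists_bound\<close> for even and odd \<open>t\<close> combined with their asymptotic
  evaluation.\<close>

lemma many_paths_imp_dense:
  fixes \<delta> c :: real and k t :: nat
  assumes d: "\<delta> > 0" and t: "t \<ge> 2"
  shows "\<exists>n0. \<forall>n\<ge>n0. \<forall>G :: nat graph. simple_graph G \<longrightarrow> card (verts G) = n \<longrightarrow>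
     fin_graph.cycle_free (verts G) (adj G) (Suc (Suc k)) \<longrightarrow>
     2 * (real n / 2 - c) ^ t \<le> real (card (path_lists (adj G) (verts G) t)) \<longrightarrow>
     (1/2 - \<delta>) * real n ^ 2 \<le> real (fin_graph.degsum (verts G) (adj G))"
proof -
  define h where "h = (t - 2) div 2"
  have th: "t = 2 * h + 2 \<or> t = 2 * h + 3" using t unfolding h_def by linarith
  obtain n0 where n0: "\<forall>n\<ge>n0. \<forall>D.
     (2 * (real n / 2 - c) ^ (2 * h + 2) \<le> (real n ^ 2 / 4 + 2 * real k * real n) ^ h * D \<longrightarrow> (1/2 - \<delta>) * real n ^ 2 \<le> D) \<and>
     (2 * (real n / 2 - c) ^ (2 * h + 3) \<le> (real n ^ 2 / 4 + 2 * real k * real n) ^ h * ((real n + 2 * real k) * D / 2) \<longrightarrow> (1/2 - \<delta>) * real n ^ 2 \<le> D)"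
    using degsum_asymptotics[OF d, of c h k] by blast
  show ?thesis
  proof (intro exI[of _ n0] allI impI)
    fix n and G :: "nat graph"
    assume n: "n0 \<le> n" and G: "simple_graph G" and cV: "card (verts G) = n"
      and cf: "fin_graph.cycle_free (verts G) (adj G) (Suc (Suc k))"
      and many: "2 * (real n / 2 - c) ^ t \<le> real (card (path_lists (adj G) (verts G) t))"
    interpret fin_graph "verts G" "adj G" using fin_graph_adj[OF G] .
    have two_step_cap: "two_step_cap k = real n ^ 2 / 4 + 2 * real k * real n" by (simp add: two_step_cap_def cV)
    from th show "(1/2 - \<delta>) * real n ^ 2 \<le> real degsum"
    proof
      assume e: "t = 2 * h + 2"
      have "2 * (real n / 2 - c) ^ (2 * h + 2) \<le> (real n ^ 2 / 4 + 2 * real k * real n) ^ h * real degsum"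
        using many path_lists_bound(1)[OF cf, of h] unfolding e two_step_cap by linarith
      then show ?thesis using n0 n by blast
    next
      assume e: "t = 2 * h + 3"
      have "2 * (real n / 2 - c) ^ (2 * h + 3) \<le> (real n ^ 2 / 4 + 2 * real k * real n) ^ h * ((real n + 2 * real k) * real degsum / 2)"
        using many path_lists_bound(2)[OF cf, of h] unfolding e two_step_cap cV by linarith
      then show ?thesis using n0 n by blast
    qed
  qed
qed

context fin_graph
begin

text \<open>With fewer than \<open>r - 1\<close> outside vertices the lower bound 4 for the paths in the core
  leaves enough room to absorb all ears. With \<open>r - 1\<close> of them the lower bound 3 is needed,
  which is available as the core then misses few pairs; if at least one ear is absorbed, at
  most \<open>r - 2\<close> vertices remain outside.\<close>

lemma near_bipartite_or_hung:
  fixes N r t D :: nat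
  assumes cf: "cycle_free N" and N: "odd N" "N \<ge> 5" and r: "3 \<le> r" "r + 2 \<le> N" and t: "t \<ge> 2"
  defines "D \<equiv> 2 * r * t * 8 ^ t"
  assumes a: "N + t + 4 \<le> card V div D div 8"
    and ds: "(1/2 - 1 / (512 * real D ^ 2)) * real (card V) ^ 2 \<le> real degsum"
    and large: "2 * real N * real (card V) \<le> real (card V) ^ 2 / (512 * real D ^ 2)"
    and many: "Kbal (card V + 1 - r) t \<le> card (path_lists A V t)"
  shows "(\<exists>B c att. B \<subseteq> V \<and> (\<forall>u\<in>B. \<forall>v\<in>B. A u v \<longrightarrow> (c u :: bool) \<noteq> c v) \<and> hung B att \<and> card (V - B) + 2 \<le> r) \<or>
    (\<exists>P R att. P \<inter> R = {} \<and> P \<union> R \<subseteq> V \<and> independent P \<and> independent R \<and> hung (P \<union> R) att \<and>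
       card (V - (P \<union> R)) = r - 1 \<and> card V div 4 + t \<le> card P \<and> card V div 4 + t \<le> card R)"
proof -
  define n where "n = card V"
  define d where "d = n div D"
  define M where "M = {v \<in> V. d \<le> deg v}"
  have D100: "D \<ge> 100"
  proof -
    have "8 ^ 2 \<le> (8::nat) ^ t" using t by (intro power_increasing) auto
    moreover have "2 * 3 * 2 \<le> 2 * r * t" using r t by (intro mult_le_mono) auto
    ultimately have "(2 * 3 * 2) * 8 ^ 2 \<le> 2 * r * t * 8 ^ t" by (rule mult_le_mono[rotated])
    then show ?thesis by (simp add: D_def)
  qed
  obtain c where c: "linked N M 4 c" "n div 4 + t \<le> card {v \<in> M. c v}" "n div 4 + t \<le> card {v \<in> M. \<not> c v}"
    using core_structure[OF cf N D100 a ds large] unfolding M_def d_def n_def by blast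
  have MV: "M \<subseteq> V" by (auto simp: M_def)
  have fM: "finite M" using MV fin finite_subset by blast
  have d8: "N + t + 4 \<le> d div 8" using a by (simp add: d_def n_def)
  have Dd: "D * d \<le> n" by (simp add: d_def)
  have n100: "100 * d \<le> n" using Dd D100 by (meson le_trans mult_le_mono1)
  have "8 * (N + t + 4) \<le> 8 * (d div 8)" using d8 by (rule mult_le_mono2)
  also have "\<dots> \<le> d" by simp
  finally have dd: "8 * (N + t + 4) \<le> d" .
  have d1: "4 \<le> d" using dd by simp
  then have "4 \<le> n" using n100 by simp
  then have n4: "n div 4 \<ge> 1" by (simp add: less_eq_div_iff_mult_less_eq)
  then have n8: "n \<le> 8 * (n div 4)" using dividend_less_times_div[of 4 n] by linarith
  have n8': "card V \<le> 8 * (n div 4)" using n8 by (simp add: n_def)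
  have low: "deg v \<le> d" if "v \<in> V - M" for v using that by (auto simp: M_def)
  have dn: "2 * r * t * 8 ^ t * d \<le> card V" using Dd by (simp add: D_def n_def)
  have "N \<le> d" using dd by simp
  then have rn: "r \<le> card V" using r n100 by (simp add: n_def)
  have N4: "4 \<le> N" "3 \<le> N" using N by simp_all
  have t2: "2 \<le> t" using t by simp
  have r1: "1 \<le> r" using r by simp
  have fl1: "card (V - M) < r"
    by (rule few_low_vertices(1)[OF c(1) cf N(1) N4(1) MV _ dn c(2,3) n8' n4 t2 r1 rn many]) (rule low)
  have fl2: "64 * card (missing {v \<in> M. c v} {v \<in> M. \<not> c v}) \<le> card V" if "card (V - M) = r - 1"
    by (rule few_low_vertices(2)[OF c(1) cf N(1) N4(1) MV _ dn c(2,3) n8' n4 t2 r1 rn many that]) (rule low)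
  have Mne: "M \<noteq> {}" using c(2) t by auto
  have absorb: "\<exists>B c att. B \<subseteq> V \<and> (\<forall>u\<in>B. \<forall>v\<in>B. A u v \<longrightarrow> (c u :: bool) \<noteq> c v) \<and> hung B att \<and> card (V - B) + 2 \<le> r"
    if "B \<subseteq> V" "\<forall>u\<in>B. \<forall>v\<in>B. A u v \<longrightarrow> c' u \<noteq> c' v" "hung B att" "card (V - B) + 2 \<le> r" for B att and c' :: "'a \<Rightarrow> bool"
    using that by (intro exI[of _ B] exI[of _ c'] exI[of _ att] conjI)
  show ?thesis
  proof (cases "card (V - M) = r - 1")
    case False
    then have l: "card (V - M) + 2 \<le> r" using fl1 by linarith
    have "card (V - M) + 4 \<le> N" using l r by linarith
    from linked_decomposition[OF c(1) N(1) cf MV Mne this]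
    obtain B and c' :: "'a \<Rightarrow> bool" and att
      where B: "M \<subseteq> B" "B \<subseteq> V" "\<forall>u\<in>B. \<forall>v\<in>B. A u v \<longrightarrow> c' u \<noteq> c' v" "hung B att"
      by (elim exE conjE)
    have "card (V - B) \<le> card (V - M)" using B(1) fin by (intro card_mono) auto
    then show ?thesis using absorb[OF B(2,3,4)] l by simp
  next
    case True
    have F: "64 * card (missing {v \<in> M. c v} {v \<in> M. \<not> c v}) \<le> n" using fl2[OF True] by (simp add: n_def)
    have l3: "linked N M 3 c"
      by (rule linked_common_neighbours[OF c(1) MV]; use F c(2,3) t in linarith)
    have "card (V - M) + 3 \<le> N" using True r by linarith
    from linked_decomposition[OF l3 N(1) cf MV Mne this]
    obtain B and c' :: "'a \<Rightarrow> bool" and att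
      where B: "M \<subseteq> B" "B \<subseteq> V" "\<forall>u\<in>B. \<forall>v\<in>B. A u v \<longrightarrow> c' u \<noteq> c' v" "hung B att"
      by (elim exE conjE)
    show ?thesis
    proof (cases "B = M")
      case False
      then have "V - B \<subset> V - M" using B(1,2) by blast
      then have "card (V - B) < card (V - M)" using fin by (intro psubset_card_mono) auto
      then show ?thesis using absorb[OF B(2,3,4)] True r by simp
    next
      case eq: True
      have u: "{v \<in> M. c v} \<union> {v \<in> M. \<not> c v} = M" by blast
      show ?thesis
      proof (rule disjI2, rule exI[of _ "{v \<in> M. c v}"], rule exI[of _ "{v \<in> M. \<not> c v}"],
          rule exI[of _ att], intro conjI)
        show "hung ({v \<in> M. c v} \<union> {v \<in> M. \<not> c v}) att" unfolding u using B(4) eq by simp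
        show "card (V - ({v \<in> M. c v} \<union> {v \<in> M. \<not> c v})) = r - 1" unfolding u by (rule True)
        show "{v \<in> M. c v} \<union> {v \<in> M. \<not> c v} \<subseteq> V" unfolding u by (rule MV)
        show "card V div 4 + t \<le> card {v \<in> M. c v}" "card V div 4 + t \<le> card {v \<in> M. \<not> c v}"
          using c(2,3) by (simp_all add: n_def)
        show "independent {v \<in> M. c v}" "independent {v \<in> M. \<not> c v}"
          using linked_parts_independent[OF c(1) N(1) N4(1) cf MV] .
      qed blast
    qed
  qed
qed

end

section \<open>The theorem\<close>

text \<open>The outside vertices are pairwise adjacent, so they all hang at the same vertex \<open>att
  w\<close>, and together with it they form the clique.\<close>

lemma complete_structure_edges:
  assumes G: "simple_graph G" and PR: "P \<inter> R = {}" "P \<union> R \<subseteq> verts G"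
    and ind: "fin_graph.independent (adj G) P" "fin_graph.independent (adj G) R"
    and h: "fin_graph.hung (verts G) (adj G) (P \<union> R) att"
    and full: "fin_graph.missing (adj G) P R = {}"
    and att: "fin_graph.attached (verts G) (adj G) (P \<union> R) att = verts G - (P \<union> R)"
    and cl: "\<And>u v. u \<in> verts G - (P \<union> R) \<Longrightarrow> v \<in> verts G - (P \<union> R) \<Longrightarrow> u \<noteq> v \<Longrightarrow> adj G u v"
    and w: "w \<in> verts G - (P \<union> R)"
  shows "{u, v} \<in> edges G \<longleftrightarrow> bip P R u v \<or>
    (u \<in> insert (att w) (verts G - (P \<union> R)) \<and> v \<in> insert (att w) (verts G - (P \<union> R)) \<and> u \<noteq> v)"
proof -
  interpret fin_graph "verts G" "adj G" using fin_graph_adj[OF G] .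
  let ?M = "P \<union> R" and ?L = "verts G - (P \<union> R)"
  have one: "att u = att w" if "u \<in> ?L" for u
  proof (cases "u = w")
    case False
    then have "adj G u w" using cl that w by blast
    then show ?thesis using h that w unfolding hung_def by blast
  qed simp
  have aM: "att w \<in> ?M" using h w unfolding hung_def by blast
  have toL: "adj G u (att w)" if "u \<in> ?L" for u
  proof -
    have "u \<in> attached ?M att" using that att by simp
    then show ?thesis using one[OF that] by (simp add: attached_def)
  qed
  have cross: "adj G u v" if "u \<in> P" "v \<in> R" for u v using full that by (auto simp: missing_def)
  have LM: "adj G u v \<longleftrightarrow> v = att w" if u: "u \<in> ?L" and v: "v \<in> ?M" for u v
    using hungD[OF h u v] one[OF u] toL[OF u] by metis
  have MM: "adj G u v \<longleftrightarrow> bip P R u v" if u: "u \<in> ?M" and v: "v \<in> ?M" for u v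
  proof
    assume "adj G u v"
    then show "bip P R u v" using u v ind by (auto simp: independent_def bip_def)
  next
    assume "bip P R u v"
    then show "adj G u v" using cross sym by (auto simp: bip_def)
  qed
  have nb: "\<not> bip P R u v" if "u \<in> ?L \<or> v \<in> ?L" for u v using that by (auto simp: bip_def)
  have "adj G u v \<longleftrightarrow> bip P R u v \<or> (u \<in> insert (att w) ?L \<and> v \<in> insert (att w) ?L \<and> u \<noteq> v)"
  proof -
    consider "u \<in> ?M" "v \<in> ?M" | "u \<in> ?L" "v \<in> ?M" | "u \<in> ?M" "v \<in> ?L" | "u \<in> ?L" "v \<in> ?L"
      | "u \<notin> verts G \<or> v \<notin> verts G" by blast
    then show ?thesis
    proof cases
      case 1 then show ?thesis using MM[OF 1] by auto
    next
      case 2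
      then have "u \<noteq> v" by blast
      then show ?thesis using LM[OF 2] nb[of u v] 2 by auto
    next
      case 3
      then have "u \<noteq> v" by blast
      moreover have "adj G u v \<longleftrightarrow> adj G v u" using sym by blast
      ultimately show ?thesis using LM[OF 3(2,1)] nb[of u v] 3 by auto
    next
      case 4 then show ?thesis using cl[OF 4] irrefl[of u] nb[of u v] by auto
    next
      case 5
      then have "\<not> adj G u v" using dom dom' by blast
      moreover have "att w \<in> verts G" using aM PR by blast
      moreover have "\<not> bip P R u v" using 5 PR by (auto simp: bip_def)
      ultimately show ?thesis using 5 by auto
    qed
  qed
  then show ?thesis by (simp add: adj_def)
qed

text \<open>There are \<open>(r - 1) * (r - 2)\<close> ordered pairs of distinct outside vertices, so the
  equalities from \<open>final_comparison\<close> say that all pairs are adjacent and all outside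
  vertices are attached.\<close>

lemma hung_extremal_imp_Tstar:
  fixes G :: "nat graph" and r t n m :: nat
  assumes G: "simple_graph G" and n: "card (verts G) = n" and t: "t \<ge> 4" and r: "3 \<le> r" "r \<le> n"
    and PR: "P \<inter> R = {}" "P \<union> R \<subseteq> verts G"
    and ind: "fin_graph.independent (adj G) P" "fin_graph.independent (adj G) R"
    and h: "fin_graph.hung (verts G) (adj G) (P \<union> R) att"
    and L: "card (verts G - (P \<union> R)) = r - 1"
    and m: "m \<ge> 1" "m + t \<le> card P" "m + t \<le> card R"
    and th: "(8 * t * (r - 1) + 4 * t * ((r - 1) * (r - 2))) * n ^ (t - 3)
        + (4 * t * ((r - 1) * (r - 2)) + 2 ^ t * (2 * (r - 1)) ^ 4) * n ^ (t - 4) < m ^ (t - 2)"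
      "(4 * t * ((r - 1) * (r - 2)) + 2 ^ t * (2 * (r - 1)) ^ 4) * n ^ (t - 4) < m ^ (t - 3)"
    and low: "Kbal (n + 1 - r) t
        + 2 * (r - 1) * rooted_max ((n + 1 - r) div 2) ((n + 1 - r) - (n + 1 - r) div 2) (t - 2)
        + 2 * ((r - 1) * (r - 2)) * rooted_min ((n + 1 - r) div 2) ((n + 1 - r) - (n + 1 - r) div 2) (t - 3)
       \<le> card (path_lists (adj G) (verts G) t)"
  shows "G \<in> Tstar r n"
proof -
  interpret fin_graph "verts G" "adj G" using fin_graph_adj[OF G] .
  let ?M = "P \<union> R"
  let ?L = "verts G - ?M"
  have fPR: "finite P" "finite R" using PR fin finite_subset by auto
  have fL: "finite ?L" using fin by simp
  have cPR: "card P + card R = n + 1 - r"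
  proof -
    have "card ?M = card P + card R" by (rule card_Un_disjoint[OF fPR PR(1)])
    moreover have "card ?L = n - card ?M" unfolding n[symmetric] using PR(2) fPR by (intro card_Diff_subset) auto
    moreover have "card ?M \<le> n" unfolding n[symmetric] by (rule card_mono[OF fin PR(2)])
    ultimately show ?thesis using L r by linarith
  qed
  have le: "card P \<le> n" "card R \<le> n" using cPR r by linarith+
  have Vne: "verts G \<noteq> {}" using m(2) m(1) PR by auto
  have t2: "t \<ge> 2" using t by simp
  have attL: "attached ?M att \<subseteq> ?L" by (auto simp: attached_def)
  have ca: "card (attached ?M att) \<le> r - 1" using card_mono[OF fL attL] L by simp
  define E where "E = (SIGMA u:?L. ?L - {u})"
  have fE: "finite E" using fL by (simp add: E_def)
  have cE: "card E = (r - 1) * (r - 2)"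
  proof -
    have "card E = (\<Sum>u\<in>?L. card (?L - {u}))" unfolding E_def using fL by simp
    also have "\<dots> = (\<Sum>u\<in>?L. r - 2)" by (rule sum.cong) (use fL L in auto)
    finally show ?thesis using L by simp
  qed
  have chE: "chains ?M att \<subseteq> E" using irrefl by (auto simp: chains_def attached_def E_def)
  have cc: "card (chains ?M att) \<le> (r - 1) * (r - 2)" using card_mono[OF fE chE] cE by simp
  have fin_res: "card (missing P R) = 0 \<and> card (attached ?M att) = r - 1 \<and> card (chains ?M att) = (r - 1) * (r - 2) \<and>
      (card P - card R) + (card R - card P) \<le> 1"
  proof (rule final_comparison[OF t m le cPR[symmetric] ca cc low _ bipartite_count[OF fPR PR(1) ind t2] th])
    show "card (path_lists (adj G) (verts G) t) \<le> card (path_lists (adj G) ?M t)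
        + 2 * card (attached ?M att) * rooted_max (card P) (card R) (t - 2)
        + 2 * card (chains ?M att) * rooted_max (card P) (card R) (t - 3)
        + 2 ^ t * (2 * (r - 1)) ^ 4 * n ^ (t - 4)"
      using hung_count[OF h PR(2,1) ind t Vne] unfolding L n .
  qed
  have full: "missing P R = {}"
  proof -
    have "finite (missing P R)" by (rule finite_subset[of _ "P \<times> R"]) (use fPR in \<open>auto simp: missing_def\<close>)
    then show ?thesis using fin_res by simp
  qed
  have att: "attached ?M att = ?L" using card_subset_eq[OF fL attL] fin_res L by simp
  have ch: "chains ?M att = E" using card_subset_eq[OF fE chE] fin_res cE by simp
  have cl: "adj G u v" if "u \<in> ?L" "v \<in> ?L" "u \<noteq> v" for u v
  proof -
    have "(u, v) \<in> chains ?M att" unfolding ch E_def using that by simp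
    then show ?thesis by (simp add: chains_def)
  qed
  have "?L \<noteq> {}" using L r by (metis card.empty diff_is_0_eq not_numeral_le_zero numeral_le_one_iff order_trans semiring_norm(70))
  then obtain w where w: "w \<in> ?L" by blast
  note ed = complete_structure_edges[OF G PR ind h full att cl w]
  have V: "verts G = P \<union> R \<union> ?L" using PR by blast
  have dj: "?L \<inter> (P \<union> R) = {}" by blast
  have x: "att w \<in> P \<union> R" using h w unfolding hung_def by blast
  have r1: "1 \<le> r" using r by simp
  have bal: "(card P - card R) + (card R - card P) \<le> 1" using fin_res by simp
  show ?thesis by (rule Tstar_recognition[OF G V PR(1) dj x r1 r(2) L cPR bal ed])
qed

theorem theorem1p3:
  fixes l t r :: nat
  assumes "l \<ge> 2" and "t \<ge> 4" and "3 \<le> r" and "r \<le> 2 * l - 1"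
    and "odd t \<Longrightarrow> r \<le> t - 1"
  shows "\<exists>n0. \<forall>n\<ge>n0. \<forall>G :: nat graph.
    simple_graph G \<and> card (verts G) = n \<and> free_of (cycle_graph (2 * l + 1)) G \<and>
    num_copies (path_graph t) G \<ge> bP t r n \<longrightarrow>
    G \<in> near_bip n r \<or> G \<in> Sfam t r n"
proof -
  define N where "N = 2 * l + 1"
  \<comment> \<open>vertices of degree below \<open>n / D\<close> are those allowed outside the core\<close>
  define D where "D = 2 * r * t * 8 ^ t"
  define c where "c = real (r + t)"
  have N: "odd N" "N \<ge> 5" "r + 2 \<le> N" "N \<ge> 3" using assms(1,4) by (auto simp: N_def)
  have NS: "Suc (Suc (2 * l - 1)) = N" using assms(1) by (simp add: N_def)
  have D0: "D > 0" using assms by (simp add: D_def)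
  have t2: "t \<ge> 2" using assms(2) by simp
  have \<delta>: "1 / (512 * real D ^ 2) > 0" using D0 by simp
  from many_paths_imp_dense[OF \<delta> t2, where c = c and k = "2 * l - 1"]
  obtain n1 where n1: "\<forall>n\<ge>n1. \<forall>G :: nat graph. simple_graph G \<longrightarrow> card (verts G) = n \<longrightarrow>
     fin_graph.cycle_free (verts G) (adj G) (Suc (Suc (2 * l - 1))) \<longrightarrow>
     2 * (real n / 2 - c) ^ t \<le> real (card (path_lists (adj G) (verts G) t)) \<longrightarrow>
     (1/2 - 1 / (512 * real D ^ 2)) * real n ^ 2 \<le> real (fin_graph.degsum (verts G) (adj G))"
    by (elim exE)
  define C2 where "C2 = 4 * t * ((r - 1) * (r - 2)) + 2 ^ t * (2 * (r - 1)) ^ 4"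
  define C1 where "C1 = 8 * t * (r - 1) + 4 * t * ((r - 1) * (r - 2))"
  from power_thresholds[OF assms(2), of C1 C2]
  obtain m0 where m0: "\<forall>m\<ge>m0. \<forall>n\<le>15 * m. C1 * n ^ (t - 3) + C2 * n ^ (t - 4) < m ^ (t - 2) \<and> C2 * n ^ (t - 4) < m ^ (t - 3)"
    by (elim exE)
  \<comment> \<open>the summands serve, in this order, the density, the final comparison, the size of the core, the linear error in the stability estimate, and the truncated subtractions\<close>
  define n0 where "n0 = n1 + 4 * (m0 + 1) + D * (8 * (N + t + 4)) + 1024 * N * D ^ 2 + 2 * (r + t) + 4"
  show ?thesis
  proof (intro exI[of _ n0] allI impI)
    fix n and G :: "nat graph"
    assume n: "n0 \<le> n"
      and GG: "simple_graph G \<and> card (verts G) = n \<and> free_of (cycle_graph (2 * l + 1)) G \<and>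
        num_copies (path_graph t) G \<ge> bP t r n"
    from GG have G: "simple_graph G" "card (verts G) = n" "free_of (cycle_graph N) G" and many: "num_copies (path_graph t) G \<ge> bP t r n"
      by (simp_all add: N_def)
    have nn: "n1 \<le> n" "4 * (m0 + 1) \<le> n" "D * (8 * (N + t + 4)) \<le> n" "1024 * N * D ^ 2 \<le> n" "2 * (r + t) \<le> n" "4 \<le> n"
      using n unfolding n0_def by linarith+
    have rn: "r \<le> n" "1 \<le> r" using nn(5) assms(3) by simp_all
    interpret fin_graph "verts G" "adj G" using fin_graph_adj[OF G(1)] .
    have cf: "cycle_free N"
      unfolding cycle_free_def by (intro allI impI no_closed_list[OF G(1,3) N(4)])
    let ?k = "n + 1 - r"
    have k2: "?k \<ge> 2" using nn(5) assms(2) by simp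
    from turan_clique_count[OF rn(2,1) assms(2) k2]
    obtain T where T: "T \<in> Tstar r n" "Kbal ?k t + 2 * (r - 1) * rooted_max (?k div 2) (?k - ?k div 2) (t - 2)
       + 2 * ((r - 1) * (r - 2)) * rooted_min (?k div 2) (?k - ?k div 2) (t - 3) \<le> card (path_lists (adj T) (verts T) t)"
      by (elim bexE)
    have "num_copies (path_graph t) T \<le> num_copies (path_graph t) G"
      using Tstar_le_bP[OF T(1) rn(1) assms(3), of t] many by linarith
    then have "card (path_lists (adj T) (verts T) t) \<le> card (path_lists (adj G) (verts G) t)"
      using num_copies_le_iff[OF Tstar_basics(3)[OF T(1) rn] G(1)] by simp
    then have low: "Kbal ?k t + 2 * (r - 1) * rooted_max (?k div 2) (?k - ?k div 2) (t - 2)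
       + 2 * ((r - 1) * (r - 2)) * rooted_min (?k div 2) (?k - ?k div 2) (t - 3) \<le> card (path_lists (adj G) (verts G) t)"
      using T(2) by linarith
    then have lowK: "Kbal ?k t \<le> card (path_lists (adj G) (verts G) t)" by linarith
    have "2 * (real n / 2 - c) ^ t \<le> real (card (path_lists (adj G) (verts G) t))"
    proof -
      define m where "m = ?k div 2 - t"
      have halves: "x div 2 \<le> x - x div 2" "x \<le> 2 * (x div 2) + 1" for x :: nat by linarith+
      have combine: "n \<le> 2 * (y + r)" if "n + 1 = x + r" "x \<le> 2 * y + 1" for x y using that by presburger
      have "t * 2 \<le> ?k" using nn(5) by simp
      then have "t \<le> ?k div 2" by (simp only: less_eq_div_iff_mult_less_eq zero_less_numeral)
      then have mt: "m + t = ?k div 2" by (simp add: m_def)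
      have k_half: "?k div 2 \<le> ?k - ?k div 2" by (rule halves(1))
      have "n + 1 = ?k + r" using rn(1) by simp
      then have n_half: "n \<le> 2 * (?k div 2 + r)" using halves(2)[of ?k] by (rule combine)
      have mk: "m + t \<le> ?k div 2" "m + t \<le> ?k - ?k div 2" using mt k_half by simp_all
      have mk3: "n \<le> 2 * (m + (r + t))" using n_half unfolding mt[symmetric] by (simp only: add_ac)
      have "2 * m ^ t \<le> Kbal ?k t"
        unfolding Kbal_def Kcount_def using alt_count_lower[OF mk(1,2)] alt_count_lower[OF mk(2,1)] by linarith
      then have "real (2 * m ^ t) \<le> real (card (path_lists (adj G) (verts G) t))" using lowK by (simp only: of_nat_le_iff)
      moreover have "(real n / 2 - c) ^ t \<le> real m ^ t"
      proof (rule power_mono)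
        have "real n \<le> real (2 * (m + (r + t)))" using mk3 by (simp only: of_nat_le_iff)
        then show "real n / 2 - c \<le> real m" by (simp add: c_def)
        have "real (2 * (r + t)) \<le> real n" using nn(5) by (simp only: of_nat_le_iff)
        then show "0 \<le> real n / 2 - c" by (simp add: c_def)
      qed
      ultimately show ?thesis by simp
    qed
    then have ds: "(1/2 - 1 / (512 * real D ^ 2)) * real (card (verts G)) ^ 2 \<le> real degsum"
      using n1 nn(1) G(1,2) cf NS by simp
    have large: "2 * real N * real (card (verts G)) \<le> real (card (verts G)) ^ 2 / (512 * real D ^ 2)"
    proof -
      have "real (1024 * N * D ^ 2) \<le> real n" using nn(4) by (simp only: of_nat_le_iff)
      then have "1024 * real N * real D ^ 2 * real n \<le> real n * real n" by (intro mult_right_mono) auto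
      then show ?thesis using D0 by (simp add: G(2) field_simps power2_eq_square)
    qed
    have a: "N + t + 4 \<le> card (verts G) div D div 8"
      using nn(3) D0 by (simp add: G(2) less_eq_div_iff_mult_less_eq mult_ac)
    have dich: "(\<exists>B c att. B \<subseteq> verts G \<and> (\<forall>u\<in>B. \<forall>v\<in>B. adj G u v \<longrightarrow> (c u :: bool) \<noteq> c v) \<and> hung B att \<and> card (verts G - B) + 2 \<le> r) \<or>
      (\<exists>P R att. P \<inter> R = {} \<and> P \<union> R \<subseteq> verts G \<and> independent P \<and> independent R \<and> hung (P \<union> R) att \<and>
       card (verts G - (P \<union> R)) = r - 1 \<and> card (verts G) div 4 + t \<le> card P \<and> card (verts G) div 4 + t \<le> card R)"
      by (rule near_bipartite_or_hung[OF cf N(1,2) assms(3) N(3) t2 a[unfolded D_def] ds[unfolded D_def] large[unfolded D_def]])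
        (use lowK G(2) in simp)
    from dich show "G \<in> near_bip n r \<or> G \<in> Sfam t r n"
    proof
      assume "\<exists>B c att. B \<subseteq> verts G \<and> (\<forall>u\<in>B. \<forall>v\<in>B. adj G u v \<longrightarrow> (c u :: bool) \<noteq> c v) \<and> hung B att \<and> card (verts G - B) + 2 \<le> r"
      then obtain B c att where B: "B \<subseteq> verts G" "\<forall>u\<in>B. \<forall>v\<in>B. adj G u v \<longrightarrow> (c u :: bool) \<noteq> c v" "hung B att" "card (verts G - B) + 2 \<le> r"
        by (elim exE conjE)
      then show ?thesis using near_bip_of_hung[OF G(1) B] G(2) by simp
    next
      assume "\<exists>P R att. P \<inter> R = {} \<and> P \<union> R \<subseteq> verts G \<and> independent P \<and> independent R \<and> hung (P \<union> R) att \<and>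
       card (verts G - (P \<union> R)) = r - 1 \<and> card (verts G) div 4 + t \<le> card P \<and> card (verts G) div 4 + t \<le> card R"
      then obtain P R att where P: "P \<inter> R = {}" "P \<union> R \<subseteq> verts G" "independent P" "independent R" "hung (P \<union> R) att"
        "card (verts G - (P \<union> R)) = r - 1" "card (verts G) div 4 + t \<le> card P" "card (verts G) div 4 + t \<le> card R"
        by (elim exE conjE)
      let ?m = "n div 4"
      have "m0 + 1 \<le> ?m" using nn(2) by (simp add: less_eq_div_iff_mult_less_eq)
      then have m: "1 \<le> ?m" "m0 \<le> ?m" by simp_all
      have m15: "n \<le> 15 * ?m" using dividend_less_times_div[of 4 n] m(1) by linarith
      have th: "C1 * n ^ (t - 3) + C2 * n ^ (t - 4) < ?m ^ (t - 2)" "C2 * n ^ (t - 4) < ?m ^ (t - 3)"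
        using m0 m(2) m15 by blast+
      have GT: "G \<in> Tstar r n"
        by (rule hung_extremal_imp_Tstar[OF G(1,2) assms(2,3) rn(1) P(1-6) m(1) P(7,8)[unfolded G(2)]
              th[unfolded C1_def C2_def] low])
      have "num_copies (path_graph t) H \<le> num_copies (path_graph t) G" if "H \<in> Tstar r n" for H
        using Tstar_le_bP[OF that rn(1) assms(3), of t] many by linarith
      then show ?thesis using GT by (simp add: Sfam_def)
    qed
  qed
qed

end
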